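(* Let $A,B$ be matrices as in the context. The $C^*$-algebra $\mathcal O_{A,B}$ is isomorphic to the inverse semigroup crossed product $C_0(X_A)\rtimes_\alpha\mathcal S^{A,B}$.
   Context: Data. Let $N\in\{1,2,\dots\}\cup\{\infty\}$ and $V=\{1,\dots,N\}$ (all positive integers if $N=\infty$). $A$ is an $N\times N$ matrix with entries in $\{0,1,2,\dots\}$, $B$ an $N\times N$ matrix with entries in $\mathbb Z$, both row-finite. Put $\Omega_A=\{(i,j)\in V\times V: A_{i,j}\ge1\}$, $\Omega_A(i)=\{j:(i,j)\in\Omega_A\}$. Standing assumption: $\Omega_A(i)\neq\emptyset$ for all $i$, and $B_{i,j}=0$ whenever $(i,j)\notin\Omega_A$. Katsura algebra. $\mathcal O_{A,B}$ is the universal $C^*$-algebra generated by mutually orthogonal projections $q_i$ ($i\in V$), partial unitaries $u_i$ with $u_iu_i^*=u_i^*u_i=q_i$, and partial isometries $s_{i,j,n}$ ($(i,j)\in\Omega_A$, $n\in\mathbb Z$) subject to: (i) $s_{i,j,n}u_j=s_{i,j,n+A_{i,j}}$ and $u_is_{i,j,n}=s_{i,j,n+B_{i,j}}$; (ii) $s_{i,j,n}^*s_{i,j,n}=q_j$; (iii) $q_i=\sum_{j\in\Omega_A(i)}\sum_{n=1}^{A_{i,j}}s_{i,j,n}s_{i,j,n}^*$. $\mathcal S^{A,B}\subset\mathcal O_{A,B}$ is the multiplicative semigroup generated by all $u_i,u_i^*,s_{i,j,n},s_{i,j,n}^*$; it is an inverse semigroup with zero whose nonzero elements have the form $s_Iu_i^ts_J^*$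 with $t\in\mathbb Z$ and $I,J$ finite paths ending at $i$ in the graph with vertices $V$ and edges $s_{i,j,n}$, $1\le n\le A_{i,j}$, from $i$ to $j$ ($s_I$ is the product of the edges; $s_I=q_i$ for the length-zero path at $i$). Action. $X_A$ is the locally compact Hausdorff space of infinite paths $s_{i_1,i_2,n_1}s_{i_2,i_3,n_2}\cdots$ with $1\le n_k\le A_{i_k,i_{k+1}}$, with the topology having the cylinder sets (paths with a prescribed finite initial segment) as basis. For $t\in\mathbb Z$, $u_{i_1}^t\cdot(s_{i_1,i_2,n_1}s_{i_2,i_3,n_2}\cdots)=s_{i_1,i_2,m_1}s_{i_2,i_3,m_2}\cdots$, where $k_0=t$ and recursively $n_r+k_{r-1}B_{i_r,i_{r+1}}=m_r+k_rA_{i_r,i_{r+1}}$ with $1\le m_r\le A_{i_r,i_{r+1}}$, $k_r\in\mathbb Z$. For $s=s_Iu_i^ts_J^*\in\mathcal S^{A,B}$, $X_{s^*s}$ is the set of $\gamma\in X_A$ of the form $\gamma=s_J\gamma'$, and $\alpha_s:X_{s^*s}\to X_{ss^*}$, $\alpha_s(s_J\gamma')=s_I(u_i^t\cdot\gamma')$; $X_0=\emptyset$. This is an action of $\mathcal S^{A,B}$ on $X_A$ by partial homeomorphisms between open sets. Crossed product. For an action $\alpha$ of an inverse semigroup $S$ on a locally compact Hausdorff space $X$, a covariant representation on a Hilbert space $H$ is a pair $(\pi,\sigma)$ of a nondegenerate $*$-representation $\pi$ of $C_0(X)$ and a $*$-homomorphism $\sigma$ of $S$ into partial isometries on $H$ (a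 multiplicative map with $\sigma_{s^*}=\sigma_s^*$) such that $\sigma_s\pi(f)\sigma_s^*=\pi(f\circ\alpha_{s^*})$ for $f\in C_0(X_{s^*s})$, and $\sigma_eH=\overline{\pi(C_0(X_e))H}$ for idempotents $e$. $C_0(X)\rtimes_\alpha S$ is the closed linear span of the elements $\pi(f)\sigma_s$ ($s\in S$, $f\in C_0(X_{ss^*})$) for a universal covariant representation. *)

theory Defs
  imports "HOL-Analysis.Analysis" "HOL-Library.Extended_Nat"
begin

text \<open>
  Hilbert spaces are closed complex subspaces of a type in the class below, and C*-algebras are
  norm-closed self-adjoint algebras of bounded operators on such a type.  The inner product is
  linear in its first argument.
\<close>

class chilbert_space = real_inner + complete_space +
  fixes scaleC :: "complex \<Rightarrow> 'a \<Rightarrow> 'a"  (infixr \<open>*\<^sub>C\<close> 75)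
    and cinner :: "'a \<Rightarrow> 'a \<Rightarrow> complex"
  assumes scaleC_add_right: "c *\<^sub>C (x + y) = c *\<^sub>C x + c *\<^sub>C y"
    and scaleC_add_left: "(c + d) *\<^sub>C x = c *\<^sub>C x + d *\<^sub>C x"
    and scaleC_scaleC: "c *\<^sub>C d *\<^sub>C x = (c * d) *\<^sub>C x"
    and scaleC_of_real: "complex_of_real r *\<^sub>C x = r *\<^sub>R x"
    and cinner_add_left: "cinner (x + y) z = cinner x z + cinner y z"
    and cinner_scaleC_left: "cinner (c *\<^sub>C x) y = c * cinner x y"
    and cinner_commute: "cinner x y = cnj (cinner y x)"
    and Re_cinner: "Re (cinner x y) = inner x y"

lemma vector_space_scaleC:
  "vector_space (scaleC :: complex \<Rightarrow> 'h \<Rightarrow> 'h::chilbert_space)"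
proof
  show "1 *\<^sub>C x = x" for x :: 'h
    using scaleC_of_real[of 1 x] by simp
qed (simp_all add: scaleC_add_right scaleC_add_left scaleC_scaleC)

lemma norm_eq_sqrt_cinner: "norm x = sqrt (Re (cinner x x))" for x :: "'h::chilbert_space"
  by (simp add: Re_cinner norm_eq_sqrt_inner)

lemma norm_scaleC: "norm (c *\<^sub>C x) = cmod c * norm x" for x :: "'h::chilbert_space"
proof -
  have "cinner (c *\<^sub>C x) (c *\<^sub>C x) = c * cnj c * cinner x x"
    by (metis cinner_commute cinner_scaleC_left complex_cnj_mult mult.assoc)
  also have "c * cnj c = complex_of_real ((cmod c)\<^sup>2)"
    by (simp add: complex_norm_square[symmetric])
  finally have "Re (cinner (c *\<^sub>C x) (c *\<^sub>C x)) = (cmod c)\<^sup>2 * Re (cinner x x)"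
    by simp
  then show ?thesis
    by (simp add: norm_eq_sqrt_cinner real_sqrt_mult)
qed

lemma bounded_linear_scaleC: "bounded_linear (scaleC c :: 'h \<Rightarrow> 'h::chilbert_space)"
proof
  show "c *\<^sub>C r *\<^sub>R x = r *\<^sub>R c *\<^sub>C x" for r and x :: 'h
    by (metis mult.commute scaleC_of_real scaleC_scaleC)
  show "\<exists>K. \<forall>x::'h. norm (c *\<^sub>C x) \<le> norm x * K"
    by (metis norm_scaleC mult.commute order_refl)
qed (simp add: scaleC_add_right)

definition closed_csubspace :: "'h::chilbert_space set \<Rightarrow> bool" where
  "closed_csubspace H \<longleftrightarrow> closed H \<and> module.subspace scaleC H"

text \<open>
  The operators on a closed subspace \<open>H\<close>, extended by zero to the orthogonal complement of
  \<open>H\<close>.  As \<^typ>\<open>'h \<Rightarrow>\<^sub>L 'h\<close> consists of real-linear operators, complex linearity is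
  required explicitly.
\<close>

definition bounded_ops :: "'h::chilbert_space set \<Rightarrow> ('h \<Rightarrow>\<^sub>L 'h) set" where
  "bounded_ops H = {T. (\<forall>c x. blinfun_apply T (c *\<^sub>C x) = c *\<^sub>C blinfun_apply T x) \<and>
     (\<forall>x. blinfun_apply T x \<in> H) \<and>
     (\<forall>x. (\<forall>y\<in>H. cinner x y = 0) \<longrightarrow> blinfun_apply T x = 0)}"

definition op_scale :: "complex \<Rightarrow> ('h::chilbert_space \<Rightarrow>\<^sub>L 'h) \<Rightarrow> ('h \<Rightarrow>\<^sub>L 'h)" where
  "op_scale c T = Blinfun (scaleC c) o\<^sub>L T"

lemma op_scale_apply: "blinfun_apply (op_scale c T) x = c *\<^sub>C blinfun_apply T x"
  by (simp add: op_scale_def bounded_linear_Blinfun_apply bounded_linear_scaleC)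

lemma vector_space_op_scale:
  "vector_space (op_scale :: complex \<Rightarrow> ('h \<Rightarrow>\<^sub>L 'h) \<Rightarrow> ('h::chilbert_space \<Rightarrow>\<^sub>L 'h))"
proof
  show "op_scale 1 T = T" for T :: "'h \<Rightarrow>\<^sub>L 'h"
    by (rule blinfun_eqI)
      (metis op_scale_apply of_real_1 scaleC_of_real scaleR_one)
qed (rule blinfun_eqI,
     simp add: op_scale_apply blinfun.add_left scaleC_add_right scaleC_add_left scaleC_scaleC)+

definition adj :: "('h::chilbert_space \<Rightarrow>\<^sub>L 'h) \<Rightarrow> ('h \<Rightarrow>\<^sub>L 'h)" where
  "adj T = (THE T'. \<forall>x y. cinner (blinfun_apply T x) y = cinner x (blinfun_apply T' y))"

definition is_projection :: "('h::chilbert_space \<Rightarrow>\<^sub>L 'h) \<Rightarrow> bool" where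
  "is_projection p \<longleftrightarrow> adj p = p \<and> p o\<^sub>L p = p"

definition partial_isometry :: "('h::chilbert_space \<Rightarrow>\<^sub>L 'h) \<Rightarrow> bool" where
  "partial_isometry v \<longleftrightarrow> v o\<^sub>L adj v o\<^sub>L v = v"

definition cstar_algebra :: "('h::chilbert_space \<Rightarrow>\<^sub>L 'h) set \<Rightarrow> bool" where
  "cstar_algebra \<A> \<longleftrightarrow> \<A> \<subseteq> bounded_ops UNIV \<and> closed \<A> \<and> module.subspace op_scale \<A> \<and>
     (\<forall>a\<in>\<A>. \<forall>b\<in>\<A>. a o\<^sub>L b \<in> \<A>) \<and> (\<forall>a\<in>\<A>. adj a \<in> \<A>)"

definition cstar_generated :: "('h::chilbert_space \<Rightarrow>\<^sub>L 'h) set \<Rightarrow> ('h \<Rightarrow>\<^sub>L 'h) set" where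
  "cstar_generated G = cstar_algebra hull G"

definition star_hom ::
  "('h::chilbert_space \<Rightarrow>\<^sub>L 'h) set \<Rightarrow> ('k::chilbert_space \<Rightarrow>\<^sub>L 'k) set
     \<Rightarrow> (('h \<Rightarrow>\<^sub>L 'h) \<Rightarrow> ('k \<Rightarrow>\<^sub>L 'k)) \<Rightarrow> bool" where
  "star_hom \<A> \<B> \<phi> \<longleftrightarrow> \<phi> ` \<A> \<subseteq> \<B> \<and>
     (\<forall>a\<in>\<A>. \<forall>b\<in>\<A>. \<phi> (a + b) = \<phi> a + \<phi> b \<and> \<phi> (a o\<^sub>L b) = \<phi> a o\<^sub>L \<phi> b) \<and>
     (\<forall>a\<in>\<A>. \<forall>c. \<phi> (op_scale c a) = op_scale c (\<phi> a)) \<and>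
     (\<forall>a\<in>\<A>. \<phi> (adj a) = adj (\<phi> a))"

definition cstar_isomorphic ::
  "('h::chilbert_space \<Rightarrow>\<^sub>L 'h) set \<Rightarrow> ('k::chilbert_space \<Rightarrow>\<^sub>L 'k) set \<Rightarrow> bool" where
  "cstar_isomorphic \<A> \<B> \<longleftrightarrow> (\<exists>\<phi>. star_hom \<A> \<B> \<phi> \<and> bij_betw \<phi> \<A> \<B>)"

text \<open>
  Universal objects below are universal for operators on (closed subspaces of) one fixed type.
  Since the universal algebras in question are separable, this is universality for all
  Hilbert spaces as soon as the type is infinite-dimensional in the following sense; on a
  finite-dimensional type it would be a much weaker property.
\<close>

definition infinite_dimensional :: "'h::chilbert_space itself \<Rightarrow> bool" where
  "infinite_dimensional _ \<longleftrightarrow>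
     (\<exists>e :: nat \<Rightarrow> 'h. \<forall>m n. cinner (e m) (e n) = (if m = n then 1 else 0))"


section \<open>Crossed products by inverse semigroup actions\<close>

text \<open>
  Functions in \<open>C\<^sub>0\<close> vanish outside the space, so that \<open>C\<^sub>0\<close> of an open subspace is literally
  contained in \<open>C\<^sub>0\<close> of the whole (locally compact Hausdorff) space.
\<close>

definition C0 :: "'x topology \<Rightarrow> ('x \<Rightarrow> complex) set" where
  "C0 X = {f. continuous_map X euclidean f \<and>
     (\<forall>\<epsilon>>0. \<exists>K. compactin X K \<and> (\<forall>x\<in>topspace X - K. cmod (f x) < \<epsilon>)) \<and>
     (\<forall>x. x \<notin> topspace X \<longrightarrow> f x = 0)}"

definition nondegenerate_star_rep ::
  "'x topology \<Rightarrow> 'h::chilbert_space set \<Rightarrow> (('x \<Rightarrow> complex) \<Rightarrow> ('h \<Rightarrow>\<^sub>L 'h)) \<Rightarrow> bool" where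
  "nondegenerate_star_rep X H \<pi> \<longleftrightarrow>
     (\<forall>f\<in>C0 X. \<pi> f \<in> bounded_ops H) \<and>
     (\<forall>f\<in>C0 X. \<forall>g\<in>C0 X. \<pi> (\<lambda>x. f x + g x) = \<pi> f + \<pi> g \<and> \<pi> (\<lambda>x. f x * g x) = \<pi> f o\<^sub>L \<pi> g) \<and>
     (\<forall>f\<in>C0 X. \<forall>c. \<pi> (\<lambda>x. c * f x) = op_scale c (\<pi> f)) \<and>
     (\<forall>f\<in>C0 X. \<pi> (\<lambda>x. cnj (f x)) = adj (\<pi> f)) \<and>
     closure (module.span scaleC {blinfun_apply (\<pi> f) x | f x. f \<in> C0 X \<and> x \<in> H}) = H"

text \<open>
  An action of the inverse semigroup \<open>S\<close> (with product \<open>mul\<close> and inverse \<open>ast\<close>) on \<open>X\<close> is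
  given by the open sets \<open>D e\<close> for idempotents \<open>e\<close> and the maps
  \<open>\<alpha> s : D (ast s \<cdot> s) \<rightarrow> D (s \<cdot> ast s)\<close>.
\<close>

definition covariant_rep ::
  "'g set \<Rightarrow> ('g \<Rightarrow> 'g \<Rightarrow> 'g) \<Rightarrow> ('g \<Rightarrow> 'g) \<Rightarrow> 'x topology \<Rightarrow> ('g \<Rightarrow> 'x set) \<Rightarrow> ('g \<Rightarrow> 'x \<Rightarrow> 'x)
     \<Rightarrow> 'h::chilbert_space set \<Rightarrow> (('x \<Rightarrow> complex) \<Rightarrow> ('h \<Rightarrow>\<^sub>L 'h)) \<Rightarrow> ('g \<Rightarrow> ('h \<Rightarrow>\<^sub>L 'h)) \<Rightarrow> bool" where
  "covariant_rep S mul ast X D \<alpha> H \<pi> \<sigma> \<longleftrightarrow>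
     closed_csubspace H \<and>
     nondegenerate_star_rep X H \<pi> \<and>
     (\<forall>s\<in>S. \<sigma> s \<in> bounded_ops H \<and> partial_isometry (\<sigma> s) \<and> \<sigma> (ast s) = adj (\<sigma> s)) \<and>
     (\<forall>s\<in>S. \<forall>t\<in>S. \<sigma> (mul s t) = \<sigma> s o\<^sub>L \<sigma> t) \<and>
     (\<forall>s\<in>S. \<forall>f\<in>C0 (subtopology X (D (mul (ast s) s))).
        \<sigma> s o\<^sub>L \<pi> f o\<^sub>L adj (\<sigma> s) =
          \<pi> (\<lambda>x. if x \<in> D (mul s (ast s)) then f (\<alpha> (ast s) x) else 0)) \<and>
     (\<forall>e\<in>S. mul e e = e \<longrightarrow>
        blinfun_apply (\<sigma> e) ` H =
          closure (module.span scaleC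
            {blinfun_apply (\<pi> f) x | f x. f \<in> C0 (subtopology X (D e)) \<and> x \<in> H}))"

definition crossed_product ::
  "'g set \<Rightarrow> ('g \<Rightarrow> 'g \<Rightarrow> 'g) \<Rightarrow> ('g \<Rightarrow> 'g) \<Rightarrow> 'x topology \<Rightarrow> ('g \<Rightarrow> 'x set)
     \<Rightarrow> (('x \<Rightarrow> complex) \<Rightarrow> ('h \<Rightarrow>\<^sub>L 'h)) \<Rightarrow> ('g \<Rightarrow> ('h \<Rightarrow>\<^sub>L 'h)) \<Rightarrow> ('h::chilbert_space \<Rightarrow>\<^sub>L 'h) set" where
  "crossed_product S mul ast X D \<pi> \<sigma> =
     closure (module.span op_scale
       {\<pi> f o\<^sub>L \<sigma> s | f s. s \<in> S \<and> f \<in> C0 (subtopology X (D (mul s (ast s))))})"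

definition universal_covariant_rep ::
  "'g set \<Rightarrow> ('g \<Rightarrow> 'g \<Rightarrow> 'g) \<Rightarrow> ('g \<Rightarrow> 'g) \<Rightarrow> 'x topology \<Rightarrow> ('g \<Rightarrow> 'x set) \<Rightarrow> ('g \<Rightarrow> 'x \<Rightarrow> 'x)
     \<Rightarrow> 'h::chilbert_space set \<Rightarrow> (('x \<Rightarrow> complex) \<Rightarrow> ('h \<Rightarrow>\<^sub>L 'h)) \<Rightarrow> ('g \<Rightarrow> ('h \<Rightarrow>\<^sub>L 'h)) \<Rightarrow> bool" where
  "universal_covariant_rep S mul ast X D \<alpha> H \<pi> \<sigma> \<longleftrightarrow>
     covariant_rep S mul ast X D \<alpha> H \<pi> \<sigma> \<and>
     (\<forall>(H' :: 'h set) \<pi>' \<sigma>'. covariant_rep S mul ast X D \<alpha> H' \<pi>' \<sigma>' \<longrightarrow>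
        (\<exists>\<psi>. star_hom (crossed_product S mul ast X D \<pi> \<sigma>) (bounded_ops H') \<psi> \<and>
          (\<forall>s\<in>S. \<forall>f\<in>C0 (subtopology X (D (mul s (ast s)))).
             \<psi> (\<pi> f o\<^sub>L \<sigma> s) = \<pi>' f o\<^sub>L \<sigma>' s)))"


section \<open>Katsura algebras\<close>

definition vertices :: "enat \<Rightarrow> nat set" where
  "vertices N = {i. 1 \<le> i \<and> enat i \<le> N}"

definition Omega :: "enat \<Rightarrow> (nat \<Rightarrow> nat \<Rightarrow> nat) \<Rightarrow> (nat \<times> nat) set" where
  "Omega N A = {(i, j). i \<in> vertices N \<and> j \<in> vertices N \<and> 1 \<le> A i j}"

definition katsura_matrices ::
  "enat \<Rightarrow> (nat \<Rightarrow> nat \<Rightarrow> nat) \<Rightarrow> (nat \<Rightarrow> nat \<Rightarrow> int) \<Rightarrow> bool" where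
  "katsura_matrices N A B \<longleftrightarrow> 1 \<le> N \<and>
     (\<forall>i\<in>vertices N. finite {j\<in>vertices N. A i j \<noteq> 0} \<and> finite {j\<in>vertices N. B i j \<noteq> 0}) \<and>
     (\<forall>i\<in>vertices N. \<exists>j. (i, j) \<in> Omega N A) \<and>
     (\<forall>i\<in>vertices N. \<forall>j\<in>vertices N. (i, j) \<notin> Omega N A \<longrightarrow> B i j = 0)"

definition katsura_family ::
  "enat \<Rightarrow> (nat \<Rightarrow> nat \<Rightarrow> nat) \<Rightarrow> (nat \<Rightarrow> nat \<Rightarrow> int)
     \<Rightarrow> (nat \<Rightarrow> ('h::chilbert_space \<Rightarrow>\<^sub>L 'h)) \<Rightarrow> (nat \<Rightarrow> ('h \<Rightarrow>\<^sub>L 'h)) \<Rightarrow> (nat \<Rightarrow> nat \<Rightarrow> int \<Rightarrow> ('h \<Rightarrow>\<^sub>L 'h))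
     \<Rightarrow> bool" where
  "katsura_family N A B q u s \<longleftrightarrow>
     (\<forall>i\<in>vertices N. q i \<in> bounded_ops UNIV \<and> u i \<in> bounded_ops UNIV) \<and>
     (\<forall>(i, j)\<in>Omega N A. \<forall>n. s i j n \<in> bounded_ops UNIV) \<and>
     (\<forall>i\<in>vertices N. is_projection (q i)) \<and>
     (\<forall>i\<in>vertices N. \<forall>j\<in>vertices N. i \<noteq> j \<longrightarrow> q i o\<^sub>L q j = 0) \<and>
     (\<forall>i\<in>vertices N. u i o\<^sub>L adj (u i) = q i \<and> adj (u i) o\<^sub>L u i = q i) \<and>
     (\<forall>(i, j)\<in>Omega N A. \<forall>n. partial_isometry (s i j n)) \<and>
     (\<forall>(i, j)\<in>Omega N A. \<forall>n.
        s i j n o\<^sub>L u j = s i j (n + int (A i j)) \<and> u i o\<^sub>L s i j n = s i j (n + B i j)) \<and>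
     (\<forall>(i, j)\<in>Omega N A. \<forall>n. adj (s i j n) o\<^sub>L s i j n = q j) \<and>
     (\<forall>i\<in>vertices N.
        q i = (\<Sum>j | (i, j) \<in> Omega N A. \<Sum>n\<in>{1..int (A i j)}. s i j n o\<^sub>L adj (s i j n)))"

definition katsura_algebra ::
  "enat \<Rightarrow> (nat \<Rightarrow> nat \<Rightarrow> nat) \<Rightarrow> (nat \<Rightarrow> ('h::chilbert_space \<Rightarrow>\<^sub>L 'h)) \<Rightarrow> (nat \<Rightarrow> ('h \<Rightarrow>\<^sub>L 'h))
     \<Rightarrow> (nat \<Rightarrow> nat \<Rightarrow> int \<Rightarrow> ('h \<Rightarrow>\<^sub>L 'h)) \<Rightarrow> ('h \<Rightarrow>\<^sub>L 'h) set" where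
  "katsura_algebra N A q u s =
     cstar_generated (q ` vertices N \<union> u ` vertices N \<union> {s i j n | i j n. (i, j) \<in> Omega N A})"

definition universal_katsura_family ::
  "enat \<Rightarrow> (nat \<Rightarrow> nat \<Rightarrow> nat) \<Rightarrow> (nat \<Rightarrow> nat \<Rightarrow> int)
     \<Rightarrow> (nat \<Rightarrow> ('h::chilbert_space \<Rightarrow>\<^sub>L 'h)) \<Rightarrow> (nat \<Rightarrow> ('h \<Rightarrow>\<^sub>L 'h)) \<Rightarrow> (nat \<Rightarrow> nat \<Rightarrow> int \<Rightarrow> ('h \<Rightarrow>\<^sub>L 'h))
     \<Rightarrow> bool" where
  "universal_katsura_family N A B q u s \<longleftrightarrow>
     katsura_family N A B q u s \<and>
     (\<forall>(q' :: nat \<Rightarrow> ('h \<Rightarrow>\<^sub>L 'h)) u' s'. katsura_family N A B q' u' s' \<longrightarrow>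
        (\<exists>\<phi>. star_hom (katsura_algebra N A q u s) (bounded_ops UNIV) \<phi> \<and>
          (\<forall>i\<in>vertices N. \<phi> (q i) = q' i \<and> \<phi> (u i) = u' i) \<and>
          (\<forall>(i, j)\<in>Omega N A. \<forall>n. \<phi> (s i j n) = s' i j n)))"

inductive_set semigroup_generated ::
  "('h::chilbert_space \<Rightarrow>\<^sub>L 'h) set \<Rightarrow> ('h \<Rightarrow>\<^sub>L 'h) set" for G where
  gen: "a \<in> G \<Longrightarrow> a \<in> semigroup_generated G"
| mult: "a \<in> semigroup_generated G \<Longrightarrow> b \<in> semigroup_generated G
    \<Longrightarrow> a o\<^sub>L b \<in> semigroup_generated G"

definition katsura_semigroup ::
  "enat \<Rightarrow> (nat \<Rightarrow> nat \<Rightarrow> nat) \<Rightarrow> (nat \<Rightarrow> ('h::chilbert_space \<Rightarrow>\<^sub>L 'h))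
     \<Rightarrow> (nat \<Rightarrow> nat \<Rightarrow> int \<Rightarrow> ('h \<Rightarrow>\<^sub>L 'h)) \<Rightarrow> ('h \<Rightarrow>\<^sub>L 'h) set" where
  "katsura_semigroup N A u s = semigroup_generated
     ({u i | i. i \<in> vertices N} \<union> {adj (u i) | i. i \<in> vertices N} \<union>
      {s i j n | i j n. (i, j) \<in> Omega N A} \<union> {adj (s i j n) | i j n. (i, j) \<in> Omega N A})"


section \<open>The path space and the action on it\<close>

text \<open>The triple \<open>(i, j, n)\<close> is the edge \<open>s\<^bsub>i,j,n\<^esub>\<close> from \<open>i\<close> to \<open>j\<close>.\<close>

type_synonym edge = "nat \<times> nat \<times> int"

definition edges :: "enat \<Rightarrow> (nat \<Rightarrow> nat \<Rightarrow> nat) \<Rightarrow> edge set" where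
  "edges N A = {(i, j, n). (i, j) \<in> Omega N A \<and> 1 \<le> n \<and> n \<le> int (A i j)}"

abbreviation src :: "edge \<Rightarrow> nat" where
  "src e \<equiv> fst e"

abbreviation tgt :: "edge \<Rightarrow> nat" where
  "tgt e \<equiv> fst (snd e)"

text \<open>The empty list stands for the length-zero path at whichever vertex \<open>i\<close> is its end.\<close>

fun path_ending_at :: "enat \<Rightarrow> (nat \<Rightarrow> nat \<Rightarrow> nat) \<Rightarrow> nat \<Rightarrow> edge list \<Rightarrow> bool" where
  "path_ending_at N A i [] \<longleftrightarrow> i \<in> vertices N"
| "path_ending_at N A i [e] \<longleftrightarrow> e \<in> edges N A \<and> tgt e = i"
| "path_ending_at N A i (e # e' # es) \<longleftrightarrow>
     e \<in> edges N A \<and> tgt e = src e' \<and> path_ending_at N A i (e' # es)"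

definition infinite_paths :: "enat \<Rightarrow> (nat \<Rightarrow> nat \<Rightarrow> nat) \<Rightarrow> (nat \<Rightarrow> edge) set" where
  "infinite_paths N A = {\<gamma>. \<forall>k. \<gamma> k \<in> edges N A \<and> tgt (\<gamma> k) = src (\<gamma> (Suc k))}"

definition prepend :: "edge list \<Rightarrow> (nat \<Rightarrow> edge) \<Rightarrow> (nat \<Rightarrow> edge)" where
  "prepend es \<gamma> = (\<lambda>k. if k < length es then es ! k else \<gamma> (k - length es))"

definition cylinder :: "enat \<Rightarrow> (nat \<Rightarrow> nat \<Rightarrow> nat) \<Rightarrow> edge list \<Rightarrow> (nat \<Rightarrow> edge) set" where
  "cylinder N A es = {\<gamma> \<in> infinite_paths N A. \<exists>\<gamma>'. \<gamma> = prepend es \<gamma>'}"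

definition path_space :: "enat \<Rightarrow> (nat \<Rightarrow> nat \<Rightarrow> nat) \<Rightarrow> (nat \<Rightarrow> edge) topology" where
  "path_space N A = topology_generated_by (range (cylinder N A))"

text \<open>
  With \<open>\<gamma> = s\<^bsub>i1,i2,n1\<^esub> s\<^bsub>i2,i3,n2\<^esub> \<dots>\<close>, \<open>carry A B t \<gamma> r\<close> is \<open>k\<^sub>r\<close> in the recursion
  \<open>n\<^sub>r + k\<^bsub>r-1\<^esub> B = m\<^sub>r + k\<^sub>r A\<close>; see the lemma following the two definitions.
\<close>

primrec carry ::
  "(nat \<Rightarrow> nat \<Rightarrow> nat) \<Rightarrow> (nat \<Rightarrow> nat \<Rightarrow> int) \<Rightarrow> int \<Rightarrow> (nat \<Rightarrow> edge) \<Rightarrow> nat \<Rightarrow> int" where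
  "carry A B t \<gamma> 0 = t"
| "carry A B t \<gamma> (Suc r) =
     (case \<gamma> r of (i, j, n) \<Rightarrow> (n + carry A B t \<gamma> r * B i j - 1) div int (A i j))"

definition u_act ::
  "(nat \<Rightarrow> nat \<Rightarrow> nat) \<Rightarrow> (nat \<Rightarrow> nat \<Rightarrow> int) \<Rightarrow> int \<Rightarrow> (nat \<Rightarrow> edge) \<Rightarrow> (nat \<Rightarrow> edge)" where
  "u_act A B t \<gamma> = (\<lambda>r. case \<gamma> r of (i, j, n) \<Rightarrow>
     (i, j, (n + carry A B t \<gamma> r * B i j - 1) mod int (A i j) + 1))"

lemma u_act_recursion:
  assumes "\<gamma> r = (i, j, n)" "1 \<le> A i j"
  shows "1 \<le> m \<and> m \<le> int (A i j) \<and> n + carry A B t \<gamma> r * B i j = m + k * int (A i j)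
    \<longleftrightarrow> k = carry A B t \<gamma> (Suc r) \<and> u_act A B t \<gamma> r = (i, j, m)"
proof -
  define a where "a = int (A i j)"
  define z where "z = n + carry A B t \<gamma> r * B i j - 1"
  have a: "a > 0" using assms by (simp add: a_def)
  have "1 \<le> m \<and> m \<le> a \<and> z + 1 = m + k * a \<longleftrightarrow> k = z div a \<and> z mod a + 1 = m"
  proof
    assume h: "1 \<le> m \<and> m \<le> a \<and> z + 1 = m + k * a"
    then have z: "z = (m - 1) + k * a" and "0 \<le> m - 1" "m - 1 < a" by auto
    then show "k = z div a \<and> z mod a + 1 = m"
      using a by simp
  next
    assume h: "k = z div a \<and> z mod a + 1 = m"
    then have "z = (m - 1) + k * a"
      using div_mult_mod_eq[of z a] by (metis add.commute add_diff_cancel_right')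
    then show "1 \<le> m \<and> m \<le> a \<and> z + 1 = m + k * a"
      using h a pos_mod_bound[of a z] pos_mod_sign[of a z] by (intro conjI) linarith+
  qed
  then show ?thesis
    using assms by (simp add: u_act_def z_def a_def)
qed

fun path_op ::
  "(nat \<Rightarrow> ('h::chilbert_space \<Rightarrow>\<^sub>L 'h)) \<Rightarrow> (nat \<Rightarrow> nat \<Rightarrow> int \<Rightarrow> ('h \<Rightarrow>\<^sub>L 'h)) \<Rightarrow> nat \<Rightarrow> edge list
     \<Rightarrow> ('h \<Rightarrow>\<^sub>L 'h)" where
  "path_op q s i [] = q i"
| "path_op q s i [(j, k, n)] = s j k n"
| "path_op q s i ((j, k, n) # e # es) = s j k n o\<^sub>L path_op q s i (e # es)"

definition u_pow ::
  "(nat \<Rightarrow> ('h::chilbert_space \<Rightarrow>\<^sub>L 'h)) \<Rightarrow> (nat \<Rightarrow> ('h \<Rightarrow>\<^sub>L 'h)) \<Rightarrow> nat \<Rightarrow> int \<Rightarrow> ('h \<Rightarrow>\<^sub>L 'h)" where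
  "u_pow q u i t =
     (if t \<ge> 0 then ((o\<^sub>L) (u i) ^^ nat t) (q i) else ((o\<^sub>L) (adj (u i)) ^^ nat (- t)) (q i))"

text \<open>\<open>a = s\<^sub>I u\<^sub>i\<^sup>t s\<^sub>J\<^sup>*\<close> with \<open>I\<close> and \<open>J\<close> ending at \<open>i\<close>; such a form of \<open>a\<close> need not be unique.\<close>

definition has_form ::
  "enat \<Rightarrow> (nat \<Rightarrow> nat \<Rightarrow> nat) \<Rightarrow> (nat \<Rightarrow> ('h::chilbert_space \<Rightarrow>\<^sub>L 'h)) \<Rightarrow> (nat \<Rightarrow> ('h \<Rightarrow>\<^sub>L 'h))
     \<Rightarrow> (nat \<Rightarrow> nat \<Rightarrow> int \<Rightarrow> ('h \<Rightarrow>\<^sub>L 'h))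
     \<Rightarrow> ('h \<Rightarrow>\<^sub>L 'h) \<Rightarrow> edge list \<Rightarrow> nat \<Rightarrow> int \<Rightarrow> edge list \<Rightarrow> bool" where
  "has_form N A q u s a I i t J \<longleftrightarrow>
     path_ending_at N A i I \<and> path_ending_at N A i J \<and>
     a = path_op q s i I o\<^sub>L u_pow q u i t o\<^sub>L adj (path_op q s i J)"

text \<open>The open set \<open>X\<^bsub>a*a\<^esub>\<close>; for an idempotent \<open>e = e*e\<close> this is \<open>X\<^sub>e\<close>.\<close>

definition katsura_dom ::
  "enat \<Rightarrow> (nat \<Rightarrow> nat \<Rightarrow> nat) \<Rightarrow> (nat \<Rightarrow> ('h::chilbert_space \<Rightarrow>\<^sub>L 'h)) \<Rightarrow> (nat \<Rightarrow> ('h \<Rightarrow>\<^sub>L 'h))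
     \<Rightarrow> (nat \<Rightarrow> nat \<Rightarrow> int \<Rightarrow> ('h \<Rightarrow>\<^sub>L 'h)) \<Rightarrow> ('h \<Rightarrow>\<^sub>L 'h) \<Rightarrow> (nat \<Rightarrow> edge) set" where
  "katsura_dom N A q u s a =
     {\<gamma>. a \<noteq> 0 \<and> (\<exists>I i t J \<gamma>'. has_form N A q u s a I i t J \<and>
        \<gamma>' \<in> infinite_paths N A \<and> src (\<gamma>' 0) = i \<and> \<gamma> = prepend J \<gamma>')}"

text \<open>
  For the generators of the Katsura algebra, the value of \<open>\<alpha>\<^sub>a\<close> on its domain does not depend on
  the form of \<open>a\<close> that is chosen.
\<close>

definition katsura_act ::
  "enat \<Rightarrow> (nat \<Rightarrow> nat \<Rightarrow> nat) \<Rightarrow> (nat \<Rightarrow> nat \<Rightarrow> int) \<Rightarrow> (nat \<Rightarrow> ('h::chilbert_space \<Rightarrow>\<^sub>L 'h))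
     \<Rightarrow> (nat \<Rightarrow> ('h \<Rightarrow>\<^sub>L 'h)) \<Rightarrow> (nat \<Rightarrow> nat \<Rightarrow> int \<Rightarrow> ('h \<Rightarrow>\<^sub>L 'h))
     \<Rightarrow> ('h \<Rightarrow>\<^sub>L 'h) \<Rightarrow> (nat \<Rightarrow> edge) \<Rightarrow> (nat \<Rightarrow> edge)" where
  "katsura_act N A B q u s a \<gamma> =
     (SOME \<delta>. \<exists>I i t J \<gamma>'. has_form N A q u s a I i t J \<and>
        \<gamma>' \<in> infinite_paths N A \<and> src (\<gamma>' 0) = i \<and> \<gamma> = prepend J \<gamma>' \<and>
        \<delta> = prepend I (u_act A B t \<gamma>'))"

end

theory Submission
  imports Defs
begin

text \<open>
  A covariant representation \<open>(\<pi>, \<sigma>)\<close> turns the generators into a Katsura family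
  \<open>(\<sigma> q, \<sigma> u, \<sigma> s)\<close>: by covariance \<open>\<sigma> (s\<^sub>I s\<^sub>I\<^sup>*)\<close> is \<open>\<pi>\<close> of the indicator function of the compact
  open cylinder of \<open>I\<close>, and the cylinder of a vertex is the disjoint union of the cylinders of the
  edges leaving it, which is relation (iii).  Hence there is \<open>\<phi>\<close> from the Katsura algebra to the
  crossed product.  Conversely, sending the indicator of the cylinder of \<open>I\<close> to \<open>s\<^sub>I s\<^sub>I\<^sup>*\<close> extends, by
  approximation with step functions, to a representation of \<open>C\<^sub>0(X\<^sub>A)\<close> in the Katsura algebra that is
  covariant together with the inclusion of the semigroup; this gives \<open>\<psi>\<close> in the other direction.
  The two maps are inverse to each other on generators, hence everywhere, as *-homomorphisms between
  C*-algebras are contractive.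

  That domain and action of an element of the semigroup do not depend on its form
  \<open>s\<^sub>I u\<^sub>i\<^sup>t s\<^sub>J\<^sup>*\<close> follows from the representation on the square-summable sequences over the (countable)
  orbit of a path \<open>\<gamma>\<close>, where the element maps the basis vector of \<open>\<gamma>\<close> to that of the image of \<open>\<gamma>\<close>,
  or to \<open>0\<close> if \<open>\<gamma>\<close> is not in the domain.
\<close>

section \<open>Operators on Hilbert spaces\<close>

text \<open>Universality speaks only of families and representations on the one type
  \<open>'h\<close>, and a homomorphism is an arbitrary function with algebraic properties. Because
  of the first, the basis of an orbit representation has to be found among the vectors of
  \<open>'h\<close>; this is what countability of orbits is for. Because of the second, continuity
  must come from algebra alone, and since the algebras need not have a unit, the square root
  argument uses y + y - y y in place of 1 - (1 - y)^2. Relation (iii) is additive, so a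
  representation of the semigroup alone cannot see it; the functions have to supply it. Conversely,
  orthogonality of the ranges of different edges is not among the relations and must be extracted
  from the sum in (iii). \<open>katsura_dom\<close> and \<open>katsura_act\<close> quantify over all
  forms of an element, so nothing about them can be read off one form before the universal property
  has been used. The crossed product is defined as a closed span. That it is closed under products
  is seen only when it is recognized as the closure of a homomorphic image.\<close>

instance chilbert_space \<subseteq> banach ..

lemma cinner_add_right: "cinner x (y + z) = cinner x y + cinner x z" for x :: "'h::chilbert_space"
  by (metis cinner_add_left cinner_commute complex_cnj_add)

lemma cinner_scaleC_right: "cinner x (c *\<^sub>C y) = cnj c * cinner x y" for x :: "'h::chilbert_space"
  by (metis cinner_commute cinner_scaleC_left complex_cnj_mult)

lemma scaleC_one [simp]: "1 *\<^sub>C x = x" for x :: "'h::chilbert_space"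
  by (metis of_real_1 scaleC_of_real scaleR_one)

lemma scaleC_zero_left [simp]: "0 *\<^sub>C x = 0" for x :: "'h::chilbert_space"
  by (metis of_real_0 scaleC_of_real scaleR_zero_left)

lemma scaleC_zero_right [simp]: "c *\<^sub>C 0 = 0" for c :: complex
  by (metis add_cancel_right_left scaleC_add_right)

text \<open>The imaginary part is a real inner product too; this reduces complex identities to pairs
  of real ones.\<close>

lemma Im_cinner: "Im (cinner x y) = inner x (\<i> *\<^sub>C y)" for x :: "'h::chilbert_space"
  by (simp add: Re_cinner[symmetric] cinner_scaleC_right)

lemma cinner_eq_iff:
  "cinner x y = cinner x' y' \<longleftrightarrow> inner x y = inner x' y' \<and> inner x (\<i> *\<^sub>C y) = inner x' (\<i> *\<^sub>C y')"
  for x :: "'h::chilbert_space"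
  by (simp add: complex_eq_iff Re_cinner Im_cinner)

lemma cinner_zero_left [simp]: "cinner 0 x = 0" and cinner_zero_right [simp]: "cinner x 0 = 0"
  for x :: "'h::chilbert_space"
  by (metis cinner_add_left add_cancel_right_left) (metis cinner_add_right add_cancel_right_left)

lemma cinner_minus_left [simp]: "cinner (- x) y = - cinner x y"
  and cinner_minus_right [simp]: "cinner x (- y) = - cinner x y" for x :: "'h::chilbert_space"
  by (metis add.right_inverse cinner_add_left cinner_zero_left eq_neg_iff_add_eq_0 add.commute)
     (metis add.right_inverse cinner_add_right cinner_zero_right eq_neg_iff_add_eq_0 add.commute)

lemma cinner_diff_left: "cinner (x - y) z = cinner x z - cinner y z"
  and cinner_diff_right: "cinner z (x - y) = cinner z x - cinner z y" for x :: "'h::chilbert_space"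
  by (simp_all only: diff_conv_add_uminus cinner_add_left cinner_add_right
      cinner_minus_left cinner_minus_right)

lemma cinner_self: "cinner x x = of_real ((norm x)\<^sup>2)" for x :: "'h::chilbert_space"
proof -
  have "Im (cinner x x) = 0"
    using arg_cong[OF cinner_commute[of x x], of Im] by simp
  then show ?thesis
    by (simp add: complex_eq_iff Re_cinner power2_norm_eq_inner)
qed

lemma cinner_self_eq_0 [simp]: "cinner x x = 0 \<longleftrightarrow> x = 0" for x :: "'h::chilbert_space"
  by (simp add: cinner_self)

lemma cinner_ext: "(\<And>y. cinner x y = cinner x' y) \<Longrightarrow> x = x'" for x :: "'h::chilbert_space"
  by (metis cinner_diff_left cinner_self_eq_0 eq_iff_diff_eq_0)

lemma cinner_sum_left: "cinner (sum f F) y = (\<Sum>i\<in>F. cinner (f i) y)" for y :: "'h::chilbert_space"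
  by (induction F rule: infinite_finite_induct) (simp_all add: cinner_add_left)

lemma cinner_sum_right: "cinner y (sum f F) = (\<Sum>i\<in>F. cinner y (f i))" for y :: "'h::chilbert_space"
  by (induction F rule: infinite_finite_induct) (simp_all add: cinner_add_right)

lemma Cauchy_Schwarz_cinner: "cmod (cinner x y) \<le> norm x * norm y" for x :: "'h::chilbert_space"
proof (cases "cinner x y = 0")
  case False
  \<comment> \<open>The phase of \<open>cinner x y\<close>: rotating \<open>y\<close> by it makes
    the product real and nonnegative, so the real inequality applies.\<close>
  define c where "c = sgn (cinner x y)"
  have c: "cmod c = 1" using False by (simp add: c_def norm_sgn)
  have "cinner x (c *\<^sub>C y) = of_real (cmod (cinner x y))"
    using False by (simp add: cinner_scaleC_right c_def sgn_eq complex_norm_square[symmetric]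
        field_simps power2_eq_square)
  then have "cmod (cinner x y) = inner x (c *\<^sub>C y)"
    by (metis Re_cinner Re_complex_of_real)
  also have "\<dots> \<le> norm x * norm (c *\<^sub>C y)" by (rule norm_cauchy_schwarz)
  finally show ?thesis by (simp add: norm_scaleC c)
qed simp

lemma bounded_linear_cinner_left: "bounded_linear (\<lambda>x. cinner x y)" for y :: "'h::chilbert_space"
proof (rule bounded_linear_intro[of _ "norm y"])
  show "cinner (r *\<^sub>R x) y = r *\<^sub>R cinner x y" for r x
    by (metis cinner_scaleC_left scaleC_of_real scaleR_conv_of_real)
qed (simp_all add: cinner_add_left Cauchy_Schwarz_cinner)

text \<open>The representing vector minimizes \<open>\<parallel>x\<parallel>\<^sup>2 - 2 f x\<close>; minimizing sequences are Cauchy by the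
  parallelogram law.\<close>

lemma riesz_representation:
  fixes f :: "'a::{real_inner,complete_space} \<Rightarrow> real"
  assumes "bounded_linear f"
  obtains y where "\<And>x. f x = inner y x"
proof -
  interpret bounded_linear f by fact
  obtain K where K: "\<And>x. norm (f x) \<le> norm x * K" using bounded by blast
  define \<Phi> where "\<Phi> x = (norm x)\<^sup>2 - 2 * f x" for x
  have below: "\<Phi> x \<ge> - K\<^sup>2" for x
  proof -
    have "2 * f x \<le> 2 * (norm x * K)" using K[of x] by (simp add: abs_le_iff)
    moreover have "2 * (norm x * K) \<le> (norm x)\<^sup>2 + K\<^sup>2"
      using zero_le_power2[of "norm x - K"] unfolding power2_diff by linarith
    ultimately show ?thesis by (simp add: \<Phi>_def)
  qed
  define d where "d = Inf (range \<Phi>)"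
  have bdd: "bdd_below (range \<Phi>)" using below by (auto intro!: bdd_belowI)
  have d: "d \<le> \<Phi> x" for x unfolding d_def by (rule cInf_lower) (use bdd in auto)
  have "\<exists>x. \<Phi> x < d + inverse (Suc n)" for n
    using cInf_less_iff[of "range \<Phi>" "d + inverse (Suc n)"] bdd by (auto simp: d_def)
  then obtain X where X: "\<And>n. \<Phi> (X n) < d + inverse (Suc n)" by metis
  \<comment> \<open>At the midpoint the linear terms cancel and the parallelogram law remains;
    \<Phi> is at least \<open>d\<close> there.\<close>
  have gap: "(dist x z)\<^sup>2 \<le> 2 * (\<Phi> x - d) + 2 * (\<Phi> z - d)" for x z
  proof -
    have "(dist x z)\<^sup>2 = 2 * \<Phi> x + 2 * \<Phi> z - 4 * \<Phi> ((1/2) *\<^sub>R (x + z))"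
      unfolding \<Phi>_def dist_norm power2_norm_eq_inner scaleR add
      by (simp add: algebra_simps inner_commute power2_eq_square)
    with d[of "(1/2) *\<^sub>R (x + z)"] show ?thesis by simp
  qed
  have "Cauchy X"
  proof (rule metric_CauchyI)
    fix e :: real assume e: "e > 0"
    then obtain M where M: "inverse (real (Suc M)) < e\<^sup>2 / 4"
      using reals_Archimedean[of "e\<^sup>2 / 4"] by auto
    have "dist (X m) (X n) < e" if "m \<ge> M" "n \<ge> M" for m n
    proof -
      have *: "\<Phi> (X k) - d < e\<^sup>2 / 4" if "k \<ge> M" for k
      proof -
        have "inverse (real (Suc k)) \<le> inverse (real (Suc M))" using that by (intro le_imp_inverse_le) auto
        then show ?thesis using X[of k] M by linarith
      qed
      have "(dist (X m) (X n))\<^sup>2 < e\<^sup>2"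
        using order.strict_trans1[OF gap[of "X m" "X n"]
            add_strict_mono[OF mult_strict_left_mono[OF *[OF that(1)]]
              mult_strict_left_mono[OF *[OF that(2)]], of 2 2]] by simp
      then show ?thesis using e by (simp add: power2_less_imp_less)
    qed
    then show "\<exists>M. \<forall>m\<ge>M. \<forall>n\<ge>M. dist (X m) (X n) < e" by blast
  qed
  then obtain y where y: "X \<longlonglongrightarrow> y" using Cauchy_convergent convergent_def by blast
  have "(\<lambda>n. \<Phi> (X n)) \<longlonglongrightarrow> \<Phi> y"
    unfolding \<Phi>_def by (intro tendsto_intros tendsto y)
  moreover have "(\<lambda>n. d + inverse (real (Suc n))) \<longlonglongrightarrow> d + 0"
    by (intro tendsto_intros LIMSEQ_inverse_real_of_nat)
  ultimately have "\<Phi> y \<le> d"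
    by (metis (no_types, lifting) LIMSEQ_le X add.right_neutral less_imp_le)
  then have min: "\<Phi> y \<le> \<Phi> x" for x using d[of x] by linarith
  have "f x = inner y x" for x
  proof (rule ccontr)
    assume ne: "f x \<noteq> inner y x"
    then have "x \<noteq> 0" by (auto simp: zero)
    define b where "b = inner y x - f x"
    \<comment> \<open>Along \<open>x\<close>, \<Phi> changes by a quadratic polynomial in the step
      length; \<open>t\<close> is its minimizer, and the minimum is negative as \<open>b\<close> is
      nonzero.\<close>
    define t where "t = - b / (norm x)\<^sup>2"
    have "\<Phi> (y + t *\<^sub>R x) = \<Phi> y + (t\<^sup>2 * (norm x)\<^sup>2 + 2 * t * b)"
      unfolding \<Phi>_def power2_norm_eq_inner scaleR add b_def
      by (simp add: algebra_simps inner_commute power2_eq_square)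
    also have "t\<^sup>2 * (norm x)\<^sup>2 + 2 * t * b = - b\<^sup>2 / (norm x)\<^sup>2"
      using \<open>x \<noteq> 0\<close> by (simp add: t_def field_simps power2_eq_square)
    also have "\<dots> < 0" using ne \<open>x \<noteq> 0\<close> by (simp add: b_def)
    finally show False using min[of "y + t *\<^sub>R x"] by linarith
  qed
  then show ?thesis using that by blast
qed

section \<open>Bounded operators and their adjoints\<close>

lemma bounded_ops_UNIV:
  "T \<in> bounded_ops UNIV \<longleftrightarrow> (\<forall>c x. blinfun_apply T (c *\<^sub>C x) = c *\<^sub>C blinfun_apply T x)"
  by (auto simp: bounded_ops_def) (metis blinfun.zero_right cinner_self_eq_0)

lemma bounded_ops_subset_UNIV: "bounded_ops H \<subseteq> bounded_ops UNIV"
  by (auto simp: bounded_ops_UNIV bounded_ops_def)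

text \<open>Riesz representation yields an adjoint for the real inner product; moving \<i> through
  \<open>T\<close>, which is complex-linear, shows that it serves for \<open>cinner\<close> as
  well.\<close>

lemma ex_adjoint:
  assumes "T \<in> bounded_ops UNIV"
  shows "\<exists>T'. \<forall>x y. cinner (blinfun_apply T x) y = cinner x (blinfun_apply T' y)"
proof -
  have lin: "bounded_linear (\<lambda>x. inner (blinfun_apply T x) y)" for y
    by (intro bounded_linear_compose[OF bounded_linear_inner_left] blinfun.bounded_linear_right)
  have "\<exists>g. \<forall>x. inner (blinfun_apply T x) y = inner g x" for y
    by (rule riesz_representation[OF lin[of y]]) blast
  then obtain g where g: "\<And>x y. inner (blinfun_apply T x) y = inner (g y) x" by metis
  have "bounded_linear g"
  proof (rule bounded_linear_intro[of _ "norm T"])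
    show "g (x + y) = g x + g y" for x y
      by (rule vector_eq_rdot[THEN iffD1]) (simp add: inner_add_left inner_add_right g[symmetric])
    show "g (r *\<^sub>R x) = r *\<^sub>R g x" for r x
      by (rule vector_eq_rdot[THEN iffD1]) (simp add: g[symmetric])
    show "norm (g y) \<le> norm y * norm T" for y
    proof (cases "g y = 0")
      case False
      have "norm (g y) * norm (g y) = inner (blinfun_apply T (g y)) y"
        by (simp add: g dot_square_norm power2_eq_square)
      also have "\<dots> \<le> norm (blinfun_apply T (g y)) * norm y" by (rule norm_cauchy_schwarz)
      also have "\<dots> \<le> (norm T * norm (g y)) * norm y" by (intro mult_right_mono norm_blinfun) auto
      finally show ?thesis using False by (simp add: mult.commute mult.left_commute)
    qed simp
  qed
  then have *: "inner (blinfun_apply T x) y = inner x (blinfun_apply (Blinfun g) y)" for x y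
    using g[of x y] by (simp add: bounded_linear_Blinfun_apply inner_commute)
  have "cinner (blinfun_apply T x) y = cinner x (blinfun_apply (Blinfun g) y)" for x y
  proof -
    have "inner (blinfun_apply T x) (\<i> *\<^sub>C y) = Re (cinner (blinfun_apply T x) (\<i> *\<^sub>C y))"
      by (simp add: Re_cinner)
    also have "\<dots> = Re (cinner (blinfun_apply T ((- \<i>) *\<^sub>C x)) y)"
      using assms unfolding bounded_ops_UNIV by (simp add: cinner_scaleC_left cinner_scaleC_right)
    also have "\<dots> = inner ((- \<i>) *\<^sub>C x) (blinfun_apply (Blinfun g) y)"
      by (simp only: Re_cinner *)
    also have "\<dots> = inner x (\<i> *\<^sub>C blinfun_apply (Blinfun g) y)"
      by (simp add: Re_cinner[symmetric] cinner_scaleC_left cinner_scaleC_right)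
    finally show ?thesis by (simp add: cinner_eq_iff *)
  qed
  then show ?thesis by blast
qed

text \<open>Uniqueness holds because a vector is determined by its inner products. The basic
  formulas for \<open>adj\<close> are obtained by guessing the adjoint and checking this
  identity.\<close>

lemma adj_eqI:
  assumes "\<And>x y. cinner (blinfun_apply T x) y = cinner x (blinfun_apply T' y)"
  shows "adj T = T'"
  unfolding adj_def
proof (rule the_equality)
  fix S assume S: "\<forall>x y. cinner (blinfun_apply T x) y = cinner x (blinfun_apply S y)"
  show "S = T'"
    by (rule blinfun_eqI, rule cinner_ext) (metis S assms cinner_commute)
qed (use assms in blast)

lemma cinner_adj_right:
  assumes "T \<in> bounded_ops UNIV"
  shows "cinner x (blinfun_apply (adj T) y) = cinner (blinfun_apply T x) y"
  using ex_adjoint[OF assms] adj_eqI by metis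

lemma cinner_adj_left:
  assumes "T \<in> bounded_ops UNIV"
  shows "cinner (blinfun_apply (adj T) x) y = cinner x (blinfun_apply T y)"
  by (metis assms cinner_adj_right cinner_commute)

lemma bounded_ops_adj: "T \<in> bounded_ops UNIV \<Longrightarrow> adj T \<in> bounded_ops UNIV"
  unfolding bounded_ops_UNIV[of "adj T"]
  by (intro allI cinner_ext) (simp add: cinner_adj_left cinner_scaleC_left)

lemma adj_adj: "T \<in> bounded_ops UNIV \<Longrightarrow> adj (adj T) = T"
  by (rule adj_eqI) (simp add: cinner_adj_left)

lemma bounded_ops_compose:
  "S \<in> bounded_ops UNIV \<Longrightarrow> T \<in> bounded_ops UNIV \<Longrightarrow> S o\<^sub>L T \<in> bounded_ops UNIV"
  by (simp add: bounded_ops_UNIV)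

lemma bounded_ops_add:
  "S \<in> bounded_ops UNIV \<Longrightarrow> T \<in> bounded_ops UNIV \<Longrightarrow> S + T \<in> bounded_ops UNIV"
  by (simp add: bounded_ops_UNIV blinfun.add_left scaleC_add_right)

lemma bounded_ops_scale: "T \<in> bounded_ops UNIV \<Longrightarrow> op_scale c T \<in> bounded_ops UNIV"
  by (simp add: bounded_ops_UNIV op_scale_apply scaleC_scaleC mult.commute)

lemma bounded_ops_zero: "0 \<in> bounded_ops UNIV"
  by (simp add: bounded_ops_UNIV)

lemma adj_compose:
  "S \<in> bounded_ops UNIV \<Longrightarrow> T \<in> bounded_ops UNIV \<Longrightarrow> adj (S o\<^sub>L T) = adj T o\<^sub>L adj S"
  by (rule adj_eqI) (simp add: cinner_adj_right)

lemma adj_add: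
  "S \<in> bounded_ops UNIV \<Longrightarrow> T \<in> bounded_ops UNIV \<Longrightarrow> adj (S + T) = adj S + adj T"
  by (rule adj_eqI) (simp add: cinner_adj_right blinfun.add_left cinner_add_left cinner_add_right)

lemma adj_scale: "T \<in> bounded_ops UNIV \<Longrightarrow> adj (op_scale c T) = op_scale (cnj c) (adj T)"
  by (rule adj_eqI)
    (simp add: cinner_adj_right op_scale_apply cinner_scaleC_left cinner_scaleC_right)

lemma adj_zero [simp]: "adj 0 = 0"
  by (rule adj_eqI) simp

lemma norm_adj_le:
  assumes T: "T \<in> bounded_ops UNIV"
  shows "norm (adj T) \<le> norm T"
proof (rule norm_blinfun_bound)
  fix y
  let ?z = "blinfun_apply (adj T) y"
  show "norm ?z \<le> norm T * norm y"
  proof (cases "?z = 0")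
    case False
    have "norm ?z * norm ?z = cmod (cinner ?z ?z)"
      by (simp add: cinner_self norm_mult power2_eq_square)
    also have "\<dots> = cmod (cinner (blinfun_apply T ?z) y)" by (simp add: cinner_adj_right[OF T])
    also have "\<dots> \<le> norm (blinfun_apply T ?z) * norm y" by (rule Cauchy_Schwarz_cinner)
    also have "\<dots> \<le> (norm T * norm ?z) * norm y" by (intro mult_right_mono norm_blinfun) auto
    finally show ?thesis using False by (simp add: mult.commute mult.left_commute)
  qed simp
qed simp

section \<open>Algebra and limits of operators\<close>

lemma op_scale_minus_one: "op_scale (- 1) T = - T"
  by (rule blinfun_eqI) (metis op_scale_apply uminus_blinfun.rep_eq scaleC_of_real of_real_1
      of_real_minus scaleR_minus1_left)

lemma op_scale_zero [simp]: "op_scale 0 T = 0" "op_scale c 0 = 0"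
  by (rule blinfun_eqI, simp add: op_scale_apply)+

lemma op_scale_of_real: "op_scale (complex_of_real r) T = r *\<^sub>R T"
  by (rule blinfun_eqI) (simp add: op_scale_apply scaleC_of_real scaleR_blinfun.rep_eq)

lemma norm_op_scale: "norm (op_scale c T) \<le> cmod c * norm T"
proof (rule norm_blinfun_bound)
  fix x
  have "cmod c * norm (blinfun_apply T x) \<le> cmod c * (norm T * norm x)"
    by (intro mult_left_mono norm_blinfun) auto
  then show "norm (blinfun_apply (op_scale c T) x) \<le> cmod c * norm T * norm x"
    by (simp add: op_scale_apply norm_scaleC)
qed simp

lemma op_scale_add_right: "op_scale c (S + T) = op_scale c S + op_scale c T"
  by (rule blinfun_eqI) (simp add: op_scale_apply blinfun.add_left scaleC_add_right)

lemma op_scale_add_left: "op_scale (c + d) T = op_scale c T + op_scale d T"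
  by (rule blinfun_eqI) (simp add: op_scale_apply blinfun.add_left scaleC_add_left)

lemma op_scale_op_scale: "op_scale c (op_scale d T) = op_scale (c * d) T"
  by (rule blinfun_eqI) (simp add: op_scale_apply scaleC_scaleC)

lemma op_scale_compose_left: "op_scale c S o\<^sub>L T = op_scale c (S o\<^sub>L T)"
  by (rule blinfun_eqI) (simp add: op_scale_apply)

text \<open>Complex linearity of \<open>S\<close> is essential: operators are only real-linear by
  type, so complex scalars do not pass through them automatically.\<close>

lemma op_scale_compose_right:
  "S \<in> bounded_ops UNIV \<Longrightarrow> S o\<^sub>L op_scale c T = op_scale c (S o\<^sub>L T)"
  by (rule blinfun_eqI) (simp add: op_scale_apply bounded_ops_UNIV)

lemma bounded_linear_op_scale: "bounded_linear (op_scale c)"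
proof (rule bounded_linear_intro[of _ "cmod c"])
  show "op_scale c (r *\<^sub>R T) = r *\<^sub>R op_scale c T" for r T
    by (simp add: op_scale_of_real[symmetric] op_scale_op_scale mult.commute)
qed (simp_all add: op_scale_add_right, metis norm_op_scale mult.commute)

lemma blinfun_compose_add_left: "(S + T) o\<^sub>L R = (S o\<^sub>L R) + (T o\<^sub>L R)"
  and blinfun_compose_add_right: "R o\<^sub>L (S + T) = (R o\<^sub>L S) + (R o\<^sub>L T)"
  by (rule blinfun_eqI, simp add: blinfun.add_left blinfun.add_right)+

lemma blinfun_compose_sum_left: "sum f F o\<^sub>L R = (\<Sum>i\<in>F. f i o\<^sub>L R)"
  and blinfun_compose_sum_right: "R o\<^sub>L sum f F = (\<Sum>i\<in>F. R o\<^sub>L f i)"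
  by (induction F rule: infinite_finite_induct)
     (simp_all add: blinfun_compose_add_left blinfun_compose_add_right)

lemma blinfun_compose_diff_left: "(S - T) o\<^sub>L R = (S o\<^sub>L R) - (T o\<^sub>L R)"
  and blinfun_compose_diff_right: "R o\<^sub>L (S - T) = (R o\<^sub>L S) - (R o\<^sub>L T)"
  by (rule blinfun_eqI, simp add: blinfun.diff_left blinfun.diff_right)+

lemmas tendsto_compose = bounded_bilinear.tendsto[OF bounded_bilinear_blinfun_compose]

lemma bounded_ops_diff:
  "S \<in> bounded_ops UNIV \<Longrightarrow> T \<in> bounded_ops UNIV \<Longrightarrow> S - T \<in> bounded_ops UNIV"
  using bounded_ops_add[of S "op_scale (- 1) T"] bounded_ops_scale[of T "- 1"]
  by (simp add: op_scale_minus_one)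

lemma adj_diff:
  "S \<in> bounded_ops UNIV \<Longrightarrow> T \<in> bounded_ops UNIV \<Longrightarrow> adj (S - T) = adj S - adj T"
  using adj_add[of S "op_scale (- 1) T"] bounded_ops_scale[of T "- 1"] adj_scale[of T "- 1"]
  by (simp add: op_scale_minus_one)

lemma tendsto_adj:
  assumes "(f \<longlongrightarrow> T) F" "\<And>n. f n \<in> bounded_ops UNIV" "T \<in> bounded_ops UNIV"
  shows "((\<lambda>n. adj (f n)) \<longlongrightarrow> adj T) F"
proof (rule metric_tendsto_imp_tendsto[OF assms(1) always_eventually], rule allI)
  show "dist (adj (f n)) (adj T) \<le> dist (f n) T" for n
    using norm_adj_le[of "f n - T"] assms by (simp add: dist_norm adj_diff bounded_ops_diff)
qed

lemma subspace_op_scale_iff: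
  "module.subspace op_scale V \<longleftrightarrow>
    0 \<in> V \<and> (\<forall>S\<in>V. \<forall>T\<in>V. S + T \<in> V) \<and> (\<forall>c. \<forall>T\<in>V. op_scale c T \<in> V)"
  by (rule module.subspace_def[OF vector_space_op_scale[folded module_iff_vector_space]])

lemma subspace_scaleC_iff:
  "module.subspace scaleC V \<longleftrightarrow>
    0 \<in> V \<and> (\<forall>x\<in>V. \<forall>y\<in>V. x + y \<in> V) \<and> (\<forall>c. \<forall>x\<in>V. c *\<^sub>C x \<in> (V :: 'h::chilbert_space set))"
  by (rule module.subspace_def[OF vector_space_scaleC[folded module_iff_vector_space]])

lemma closed_bounded_ops:
  fixes H :: "'h::chilbert_space set"
  assumes "closed H"
  shows "closed (bounded_ops H)"
  unfolding closed_sequential_limits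
proof (intro allI impI, elim conjE)
  fix f and T :: "'h \<Rightarrow>\<^sub>L 'h"
  assume f: "\<forall>n. f n \<in> bounded_ops H" and lim: "f \<longlonglongrightarrow> T"
  have ev: "(\<lambda>n. blinfun_apply (f n) x) \<longlonglongrightarrow> blinfun_apply T x" for x
    by (intro blinfun.tendsto lim tendsto_const)
  show "T \<in> bounded_ops H"
    unfolding bounded_ops_def
  proof (intro CollectI conjI allI impI)
    fix c x
    have "(\<lambda>n. blinfun_apply (f n) (c *\<^sub>C x)) \<longlonglongrightarrow> c *\<^sub>C blinfun_apply T x"
      using f bounded_linear.tendsto[OF bounded_linear_scaleC ev[of x], of c]
      by (simp add: bounded_ops_def)
    then show "blinfun_apply T (c *\<^sub>C x) = c *\<^sub>C blinfun_apply T x"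
      using LIMSEQ_unique ev by blast
  next
    fix x show "blinfun_apply T x \<in> H"
      by (rule closed_sequentially[OF assms _ ev]) (use f in \<open>auto simp: bounded_ops_def\<close>)
  next
    fix x assume "\<forall>y\<in>H. cinner x y = 0"
    then have "blinfun_apply (f n) x = 0" for n using f by (auto simp: bounded_ops_def)
    then show "blinfun_apply T x = 0" using ev[of x] LIMSEQ_unique[OF _ tendsto_const] by simp
  qed
qed

section \<open>Norm closures of algebras of operators, and contractivity of homomorphisms\<close>

lemma subspace_closure_op_scale:
  assumes "module.subspace op_scale V"
  shows "module.subspace op_scale (closure V)"
  unfolding subspace_op_scale_iff
proof (intro conjI ballI allI)
  show "0 \<in> closure V" using assms closure_subset by (auto simp: subspace_op_scale_iff)
  fix S T assume "S \<in> closure V" "T \<in> closure V"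
  then obtain f g where "\<And>n. f n \<in> V" "f \<longlonglongrightarrow> S" "\<And>n. g n \<in> V" "g \<longlonglongrightarrow> T"
    by (auto simp: closure_sequential)
  then show "S + T \<in> closure V"
    using assms unfolding closure_sequential subspace_op_scale_iff
    by (intro exI[of _ "\<lambda>n. f n + g n"]) (auto intro: tendsto_add)
next
  fix c S assume "S \<in> closure V"
  then obtain f where "\<And>n. f n \<in> V" "f \<longlonglongrightarrow> S" by (auto simp: closure_sequential)
  then show "op_scale c S \<in> closure V"
    using assms bounded_linear.tendsto[OF bounded_linear_op_scale]
    unfolding closure_sequential subspace_op_scale_iff
    by (intro exI[of _ "\<lambda>n. op_scale c (f n)"] conjI allI) simp_all
qed

lemma subspace_closure_scaleC:
  assumes "module.subspace scaleC V"
  shows "module.subspace scaleC (closure (V :: 'h::chilbert_space set))"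
  unfolding subspace_scaleC_iff
proof (intro conjI ballI allI)
  show "0 \<in> closure V" using assms closure_subset by (auto simp: subspace_scaleC_iff)
  fix S T assume "S \<in> closure V" "T \<in> closure V"
  then obtain f g where "\<And>n. f n \<in> V" "f \<longlonglongrightarrow> S" "\<And>n. g n \<in> V" "g \<longlonglongrightarrow> T"
    by (auto simp: closure_sequential)
  then show "S + T \<in> closure V"
    using assms unfolding closure_sequential subspace_scaleC_iff
    by (intro exI[of _ "\<lambda>n. f n + g n"]) (auto intro: tendsto_add)
next
  fix c S assume "S \<in> closure V"
  then obtain f where "\<And>n. f n \<in> V" "f \<longlonglongrightarrow> S" by (auto simp: closure_sequential)
  then show "c *\<^sub>C S \<in> closure V"
    using assms bounded_linear.tendsto[OF bounded_linear_scaleC]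
    unfolding closure_sequential subspace_scaleC_iff
    by (intro exI[of _ "\<lambda>n. c *\<^sub>C (f n)"] conjI allI) simp_all
qed

lemma cstar_algebra_closure:
  assumes V: "module.subspace op_scale V" and sub: "V \<subseteq> bounded_ops UNIV"
    and mult: "\<And>S T. S \<in> V \<Longrightarrow> T \<in> V \<Longrightarrow> S o\<^sub>L T \<in> V"
    and adj: "\<And>S. S \<in> V \<Longrightarrow> adj S \<in> V"
  shows "cstar_algebra (closure V)"
  unfolding cstar_algebra_def
proof (intro conjI ballI)
  show BU: "closure V \<subseteq> bounded_ops UNIV"
    by (intro closure_minimal sub closed_bounded_ops) simp
  show "module.subspace op_scale (closure V)" by (rule subspace_closure_op_scale[OF V])
  fix S T assume "S \<in> closure V" "T \<in> closure V"
  then obtain f g where "\<And>n. f n \<in> V" "f \<longlonglongrightarrow> S" "\<And>n. g n \<in> V" "g \<longlonglongrightarrow> T"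
    by (auto simp: closure_sequential)
  then show "S o\<^sub>L T \<in> closure V"
    using mult unfolding closure_sequential
    by (intro exI[of _ "\<lambda>n. f n o\<^sub>L g n"]) (auto intro: tendsto_compose)
next
  fix S assume S: "S \<in> closure V"
  then obtain f where f: "\<And>n. f n \<in> V" "f \<longlonglongrightarrow> S" by (auto simp: closure_sequential)
  have "(\<lambda>n. adj (f n)) \<longlonglongrightarrow> adj S"
  proof (rule tendsto_adj[OF f(2)])
    show "f n \<in> bounded_ops UNIV" for n using sub f(1) by blast
    have "closure V \<subseteq> bounded_ops UNIV"
      by (intro closure_minimal sub closed_bounded_ops) simp
    then show "S \<in> bounded_ops UNIV" using S by blast
  qed
  then show "adj S \<in> closure V"
    unfolding closure_sequential by (intro exI[of _ "\<lambda>n. adj (f n)"] conjI allI adj f)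
qed simp

text \<open>Since 2 Y - Y^2 = 1 - (1 - Y)^2, the difference of norm(x)^2 and norm(T x)^2 is norm(x -
  Y x)^2. The unit is eliminated from the hypothesis so that homomorphisms of algebras without unit
  can transport it.\<close>

lemma norm_le_one_if_sqrt:
  assumes T: "T \<in> bounded_ops UNIV" and Y: "Y \<in> bounded_ops UNIV" and sa: "adj Y = Y"
    and eq: "adj T o\<^sub>L T = Y + Y - (Y o\<^sub>L Y)"
  shows "norm T \<le> 1"
proof (rule norm_blinfun_bound)
  fix x
  let ?y = "blinfun_apply Y x"
  have "inner (blinfun_apply T x) (blinfun_apply T x) = Re (cinner (blinfun_apply (adj T o\<^sub>L T) x) x)"
    by (simp add: cinner_adj_left[OF T] Re_cinner)
  also have "\<dots> = 2 * inner ?y x - Re (cinner (blinfun_apply Y ?y) x)"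
    by (simp add: eq blinfun.diff_left blinfun.add_left cinner_diff_left cinner_add_left Re_cinner)
  also have "cinner (blinfun_apply Y ?y) x = cinner ?y ?y"
    by (metis Y sa cinner_adj_right)
  also have "2 * inner ?y x - Re (cinner ?y ?y) = inner x x - inner (x - ?y) (x - ?y)"
    by (simp add: Re_cinner inner_diff_left inner_diff_right inner_commute)
  also have "\<dots> \<le> inner x x" by simp
  finally show "norm (blinfun_apply T x) \<le> 1 * norm x" by (simp add: norm_eq_sqrt_inner)
qed simp

text \<open>If \<open>\<parallel>a\<parallel> < 1\<close>, then \<open>y = (a\<^sup>*a + y\<^sup>2) / 2\<close> has a self-adjoint solution by Banach's fixed point
  theorem; it satisfies \<open>1 - a\<^sup>*a = (1 - y)\<^sup>2\<close>, a relation that *-homomorphisms preserve.\<close>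

theorem star_hom_contractive:
  assumes \<A>: "cstar_algebra \<A>" and hom: "star_hom \<A> \<B> \<phi>" and \<B>: "\<B> \<subseteq> bounded_ops UNIV"
    and a: "a \<in> \<A>"
  shows "norm (\<phi> a) \<le> norm a"
proof -
  have BU: "x \<in> \<A> \<Longrightarrow> x \<in> bounded_ops UNIV" and cl: "closed \<A>"
    and add: "x \<in> \<A> \<Longrightarrow> y \<in> \<A> \<Longrightarrow> x + y \<in> \<A>" and scale: "x \<in> \<A> \<Longrightarrow> op_scale c x \<in> \<A>"
    and zero: "0 \<in> \<A>"
    and mult: "x \<in> \<A> \<Longrightarrow> y \<in> \<A> \<Longrightarrow> x o\<^sub>L y \<in> \<A>" and adjA: "x \<in> \<A> \<Longrightarrow> adj x \<in> \<A>" for x y c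
    using \<A> unfolding cstar_algebra_def subspace_op_scale_iff by blast+
  have strict: "norm (\<phi> a) \<le> 1" if a: "a \<in> \<A>" and less: "norm a < 1" for a
  proof -
    define x where "x = adj a o\<^sub>L a"
    define r where "r = norm a"
    have r: "0 \<le> r" "r < 1" using less by (auto simp: r_def)
    have x: "x \<in> \<A>" "adj x = x" using a by (auto simp: x_def mult adjA adj_compose adj_adj BU)
    have "norm x \<le> norm (adj a) * norm a" unfolding x_def by (rule norm_blinfun_compose)
    also have "\<dots> \<le> r * r" unfolding r_def by (intro mult_right_mono norm_adj_le BU a) simp
    also have "\<dots> \<le> r * 1" using r by (intro mult_left_mono) auto
    finally have nx: "norm x \<le> r" by simp
    \<comment> \<open>The radius \<open>r\<close> suits both requirements of the fixed point
      theorem: (r + r^2)/2 is at most \<open>r\<close>, and squaring has Lipschitz constant 2 r on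
      the ball, which \<open>f\<close> halves.\<close>
    define C where "C = {y \<in> \<A>. adj y = y \<and> norm y \<le> r}"
    define f where "f y = (1/2) *\<^sub>R (x + (y o\<^sub>L y))" for y
    have ncomp: "norm (y o\<^sub>L z) \<le> norm y * norm z" for y z :: "'a \<Rightarrow>\<^sub>L 'a" by (rule norm_blinfun_compose)
    have "\<exists>!y\<in>C. f y = y"
    proof (rule Banach_fix[OF _ _ r(1) r(2)])
      have "closed C" unfolding closed_sequential_limits
      proof (intro allI impI, elim conjE)
        fix g y assume g: "\<forall>n. g n \<in> C" and lim: "g \<longlonglongrightarrow> y"
        have y: "y \<in> \<A>" by (rule closed_sequentially[OF cl _ lim]) (use g in \<open>auto simp: C_def\<close>)
        have "(\<lambda>n. adj (g n)) \<longlonglongrightarrow> adj y"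
          by (rule tendsto_adj[OF lim]) (use g BU y in \<open>auto simp: C_def\<close>)
        moreover have "adj (g n) = g n" for n using g by (auto simp: C_def)
        ultimately have "adj y = y" using LIMSEQ_unique lim by auto
        moreover have "norm y \<le> r"
          by (rule LIMSEQ_le_const2[OF tendsto_norm[OF lim]]) (use g in \<open>auto simp: C_def\<close>)
        ultimately show "y \<in> C" using y by (simp add: C_def)
      qed
      then show "complete C" by (simp add: complete_eq_closed)
      have "0 \<in> C" using zero r by (simp add: C_def)
      then show "C \<noteq> {}" by blast
      show "f ` C \<subseteq> C"
      proof
        fix z assume "z \<in> f ` C"
        then obtain y where y: "y \<in> \<A>" "adj y = y" "norm y \<le> r" and z: "z = f y"
          by (auto simp: C_def)
        have "z = op_scale (complex_of_real (1/2)) (x + (y o\<^sub>L y))"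
          unfolding z f_def by (rule op_scale_of_real[symmetric])
        then have "z \<in> \<A>" "adj z = z"
          using x y by (simp_all add: scale add mult adj_scale bounded_ops_add bounded_ops_compose BU
              adj_add adj_compose)
        moreover have "norm z \<le> r"
        proof -
          have "norm (x + (y o\<^sub>L y)) \<le> norm x + norm y * norm y"
            using norm_triangle_ineq[of x "y o\<^sub>L y"] ncomp[of y y] by linarith
          also have "\<dots> \<le> r + r * 1" using nx y(3) r
            by (intro add_mono mult_mono) auto
          finally show ?thesis unfolding z f_def by simp
        qed
        ultimately show "z \<in> C" by (simp add: C_def)
      qed
      show "dist (f y) (f z) \<le> r * dist y z" if y: "y \<in> C" and z: "z \<in> C" for y z
      proof -
        have "(y o\<^sub>L y) - (z o\<^sub>L z) = (y o\<^sub>L (y - z)) + ((y - z) o\<^sub>L z)"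
          by (simp add: blinfun_compose_diff_left blinfun_compose_diff_right)
        then have "norm ((y o\<^sub>L y) - (z o\<^sub>L z)) \<le> norm y * norm (y - z) + norm (y - z) * norm z"
          using norm_triangle_ineq[of "y o\<^sub>L (y - z)" "(y - z) o\<^sub>L z"] ncomp[of y "y - z"]
            ncomp[of "y - z" z] by simp
        also have "\<dots> \<le> r * norm (y - z) + norm (y - z) * r"
          using y z by (intro add_mono mult_right_mono mult_left_mono) (auto simp: C_def)
        finally have "norm ((y o\<^sub>L y) - (z o\<^sub>L z)) \<le> 2 * (r * norm (y - z))" by simp
        moreover have "f y - f z = (1/2) *\<^sub>R ((y o\<^sub>L y) - (z o\<^sub>L z))"
          by (simp add: f_def algebra_simps)
        ultimately show "dist (f y) (f z) \<le> r * dist y z" by (simp add: dist_norm)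
      qed
    qed
    then obtain y where yC: "y \<in> C" and fy: "f y = y" by blast
    then have y: "y \<in> \<A>" "adj y = y" by (auto simp: C_def)
    have "x + (y o\<^sub>L y) = 2 *\<^sub>R y" using arg_cong[OF fy, of "\<lambda>z. 2 *\<^sub>R z"] by (simp add: f_def)
    then have eq: "x + (y o\<^sub>L y) = y + y" by (simp add: scaleR_2)
    have h: "\<phi> u + \<phi> v = \<phi> (u + v)" "\<phi> u o\<^sub>L \<phi> v = \<phi> (u o\<^sub>L v)" "adj (\<phi> u) = \<phi> (adj u)"
      "\<phi> u \<in> bounded_ops UNIV"
      if "u \<in> \<A>" "v \<in> \<A>" for u v using hom \<B> that unfolding star_hom_def by auto
    have "\<phi> x + (\<phi> y o\<^sub>L \<phi> y) = \<phi> y + \<phi> y"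
      using eq x y h mult by metis
    moreover have "\<phi> x = adj (\<phi> a) o\<^sub>L \<phi> a"
      unfolding x_def using h a adjA by metis
    ultimately have "adj (\<phi> a) o\<^sub>L \<phi> a = \<phi> y + \<phi> y - (\<phi> y o\<^sub>L \<phi> y)"
      by (metis add_diff_cancel_right')
    moreover have "adj (\<phi> y) = \<phi> y" using h y by metis
    ultimately show ?thesis using h a y by (intro norm_le_one_if_sqrt[of _ "\<phi> y"]) auto
  qed
  show ?thesis
  proof (rule field_le_epsilon)
    fix e :: real assume e: "e > 0"
    \<comment> \<open>The strict case is applied to \<open>a\<close> divided by slightly more than
      its norm; then \<open>e\<close> tends to 0.\<close>
    define c where "c = inverse (norm a + e)"
    have pos: "norm a + e > 0" using e by (simp add: add_nonneg_pos)
    have "norm (op_scale (complex_of_real c) a) < 1"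
      unfolding op_scale_of_real norm_scaleR using e pos by (simp add: c_def field_simps)
    then have "norm (\<phi> (op_scale (complex_of_real c) a)) \<le> 1"
      by (intro strict scale a)
    moreover have "\<phi> (op_scale (complex_of_real c) a) = c *\<^sub>R \<phi> a"
      using hom a unfolding star_hom_def op_scale_of_real[symmetric] by blast
    ultimately have "c * norm (\<phi> a) \<le> 1" using pos by (simp add: c_def)
    then show "norm (\<phi> a) \<le> norm a + e" using pos by (simp add: c_def field_simps)
  qed
qed


section \<open>Partial isometries and projections\<close>

lemma blinfun_compose_assoc: "(R o\<^sub>L S) o\<^sub>L T = R o\<^sub>L (S o\<^sub>L T)"
  by (rule blinfun_eqI) simp

text \<open>On z = x - p x, norm(a z)^2 equals the inner product of p z and z, hence 0. Applied to
  the generators it yields the absorption rules s q = s and u q = u.\<close>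

lemma isometry_source:
  assumes a: "a \<in> bounded_ops UNIV" and p: "p \<in> bounded_ops UNIV"
    and eq: "adj a o\<^sub>L a = p" and idem: "p o\<^sub>L p = p"
  shows "a o\<^sub>L p = a"
proof (rule blinfun_eqI)
  fix x
  let ?z = "x - blinfun_apply p x"
  have "blinfun_apply p ?z = 0"
    using arg_cong[OF idem, of "\<lambda>T. blinfun_apply T x"] by (simp add: blinfun.diff_right)
  then have "cinner (blinfun_apply a ?z) (blinfun_apply a ?z) = 0"
    using eq by (metis a blinfun_apply_blinfun_compose cinner_adj_left cinner_zero_left)
  then show "blinfun_apply (a o\<^sub>L p) x = blinfun_apply a x"
    by (simp add: blinfun.diff_right)
qed

lemma isometry_range:
  assumes a: "a \<in> bounded_ops UNIV" and p: "p \<in> bounded_ops UNIV"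
    and eq: "a o\<^sub>L adj a = p" and idem: "p o\<^sub>L p = p"
  shows "p o\<^sub>L a = a"
proof -
  have sa: "adj p = p" unfolding eq[symmetric] by (simp add: a bounded_ops_adj adj_compose adj_adj)
  have "adj a o\<^sub>L p = adj a"
    by (rule isometry_source) (use assms in \<open>auto simp: bounded_ops_adj adj_adj\<close>)
  from arg_cong[OF this, of adj] show ?thesis by (simp add: a p bounded_ops_adj adj_compose adj_adj sa)
qed

lemma norm_projection_apply:
  assumes p: "p \<in> bounded_ops UNIV" "is_projection p"
  shows "cinner (blinfun_apply p x) x = of_real ((norm (blinfun_apply p x))\<^sup>2)"
proof -
  have "cinner (blinfun_apply p x) x = cinner (blinfun_apply p (blinfun_apply p x)) x"
    using p(2) by (metis blinfun_apply_blinfun_compose is_projection_def)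
  also have "\<dots> = cinner (blinfun_apply p x) (blinfun_apply p x)"
    using p by (metis cinner_adj_right is_projection_def)
  finally show ?thesis by (simp add: cinner_self)
qed

lemma norm_projection_le:
  assumes p: "p \<in> bounded_ops UNIV" "is_projection p"
  shows "norm (blinfun_apply p x) \<le> norm x"
proof (cases "blinfun_apply p x = 0")
  case False
  have "(norm (blinfun_apply p x))\<^sup>2 = cmod (cinner (blinfun_apply p x) x)"
    unfolding norm_projection_apply[OF p] norm_of_real by simp
  also have "\<dots> \<le> norm (blinfun_apply p x) * norm x" by (rule Cauchy_Schwarz_cinner)
  finally show ?thesis using False by (simp add: power2_eq_square)
qed simp

text \<open>A vector \<open>y\<close> in the range of \<open>p l\<close> exhausts the bound: the
  squares of the norms of all \<open>p j\<close> at \<open>y\<close> sum to at most norm(y)^2, and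
  the summand for \<open>l\<close> alone is norm(y)^2. This extracts the orthogonality of edge
  ranges from relation (iii).\<close>

lemma orthogonal_if_sum_projection:
  assumes fin: "finite F" and p: "\<And>k. k \<in> F \<Longrightarrow> p k \<in> bounded_ops UNIV \<and> is_projection (p k)"
    and P: "is_projection (sum p F)" "sum p F \<in> bounded_ops UNIV"
    and kl: "k \<in> F" "l \<in> F" "k \<noteq> l"
  shows "p k o\<^sub>L p l = 0"
proof (rule blinfun_eqI)
  fix x
  define y where "y = blinfun_apply (p l) x"
  have y: "blinfun_apply (p l) y = y"
    unfolding y_def using p[OF kl(2)] by (metis blinfun_apply_blinfun_compose is_projection_def)
  have "(\<Sum>j\<in>F. (norm (blinfun_apply (p j) y))\<^sup>2) = Re (cinner (blinfun_apply (sum p F) y) y)"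
    using p by (simp add: blinfun.sum_left cinner_sum_left norm_projection_apply)
  also have "\<dots> = (norm (blinfun_apply (sum p F) y))\<^sup>2"
    by (simp add: norm_projection_apply[OF P(2,1)] flip: of_real_power)
  also have "\<dots> \<le> (norm y)\<^sup>2"
    by (intro power_mono norm_projection_le P) simp
  finally have le: "(\<Sum>j\<in>F. (norm (blinfun_apply (p j) y))\<^sup>2) \<le> (norm y)\<^sup>2" .
  have "(norm (blinfun_apply (p k) y))\<^sup>2 + (norm y)\<^sup>2 = (\<Sum>j\<in>{k,l}. (norm (blinfun_apply (p j) y))\<^sup>2)"
    using kl y by simp
  also have "\<dots> \<le> (\<Sum>j\<in>F. (norm (blinfun_apply (p j) y))\<^sup>2)"
    by (rule sum_mono2) (use fin kl in auto)
  also note le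
  finally have "(norm (blinfun_apply (p k) y))\<^sup>2 \<le> 0" by linarith
  then have "blinfun_apply (p k) y = 0" by simp
  then show "blinfun_apply (p k o\<^sub>L p l) x = blinfun_apply 0 x" by (simp add: y_def)
qed


section \<open>Spans and generated C*-algebras\<close>

interpretation ops: vector_space "op_scale :: complex \<Rightarrow> ('h::chilbert_space \<Rightarrow>\<^sub>L 'h) \<Rightarrow> _"
  by (rule vector_space_op_scale)

interpretation vec: vector_space "scaleC :: complex \<Rightarrow> 'h::chilbert_space \<Rightarrow> 'h"
  by (rule vector_space_scaleC)

lemma cstar_algebra_bounded_ops: "cstar_algebra (bounded_ops UNIV)"
  unfolding cstar_algebra_def subspace_op_scale_iff
  by (auto intro: closed_bounded_ops bounded_ops_add bounded_ops_scale bounded_ops_zero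
      bounded_ops_compose bounded_ops_adj)

lemma cstar_algebra_generated:
  assumes "G \<subseteq> bounded_ops UNIV"
  shows "cstar_algebra (cstar_generated G)"
proof -
  let ?T = "{t. cstar_algebra t \<and> G \<subseteq> t}"
  have T: "cstar_algebra t" if "t \<in> ?T" for t using that by blast
  \<comment> \<open>All closure properties pass to intersections; a member of the family is needed
    for the intersection to consist of complex-linear operators.\<close>
  have ne: "bounded_ops UNIV \<in> ?T" using assms cstar_algebra_bounded_ops by blast
  have "closed (\<Inter>?T)" using T by (intro closed_Inter) (auto simp: cstar_algebra_def)
  moreover have "\<Inter>?T \<subseteq> bounded_ops UNIV" using ne by blast
  ultimately show ?thesis
    using T unfolding cstar_generated_def hull_def cstar_algebra_def[of "\<Inter>?T"] subspace_op_scale_iff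
    by (auto simp: cstar_algebra_def subspace_op_scale_iff)
qed

lemma span_compose:
  assumes G: "G \<subseteq> bounded_ops UNIV" and mult: "\<And>a b. a \<in> G \<Longrightarrow> b \<in> G \<Longrightarrow> a o\<^sub>L b \<in> G"
    and "x \<in> ops.span G" "y \<in> ops.span G"
  shows "x o\<^sub>L y \<in> ops.span G"
proof -
  have *: "x o\<^sub>L y \<in> ops.span G" if x: "x \<in> G" for x
    using assms(4)
  proof (induction rule: ops.span_induct_alt)
    case (step c a b)
    have "x o\<^sub>L (op_scale c a + b) = op_scale c (x o\<^sub>L a) + (x o\<^sub>L b)"
      using x G by (simp add: blinfun_compose_add_right op_scale_compose_right subset_iff)
    then show ?case using step x mult
      by (simp add: ops.span_add ops.span_scale ops.span_base)
  qed (simp add: ops.span_zero)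
  from assms(3) show ?thesis
  proof (induction rule: ops.span_induct_alt)
    case (step c a b)
    have "(op_scale c a + b) o\<^sub>L y = op_scale c (a o\<^sub>L y) + (b o\<^sub>L y)"
      by (simp add: blinfun_compose_add_left op_scale_compose_left)
    then show ?case using step *
      by (simp add: ops.span_add ops.span_scale)
  qed (simp add: ops.span_zero)
qed

lemma span_bounded_ops: "G \<subseteq> bounded_ops UNIV \<Longrightarrow> ops.span G \<subseteq> bounded_ops UNIV"
  by (rule ops.span_minimal)
    (auto simp: subspace_op_scale_iff intro: bounded_ops_add bounded_ops_scale bounded_ops_zero)

lemma span_adj:
  assumes G: "G \<subseteq> bounded_ops UNIV" and adj: "\<And>a. a \<in> G \<Longrightarrow> adj a \<in> G" and "x \<in> ops.span G"
  shows "adj x \<in> ops.span G"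
proof -
  have "x \<in> ops.span G \<and> adj x \<in> ops.span G"
    using assms(3)
  proof (induction rule: ops.span_induct_alt)
    case (step c a b)
    then have "a \<in> bounded_ops UNIV" "b \<in> bounded_ops UNIV" using G span_bounded_ops[OF G] by blast+
    then have "adj (op_scale c a + b) = op_scale (cnj c) (adj a) + adj b"
      by (simp add: adj_add adj_scale bounded_ops_scale)
    then show ?case using step adj by (simp add: ops.span_add ops.span_scale ops.span_base)
  qed (simp add: ops.span_zero)
  then show ?thesis by blast
qed

lemma cstar_algebra_closure_span:
  assumes "G \<subseteq> bounded_ops UNIV" "\<And>a b. a \<in> G \<Longrightarrow> b \<in> G \<Longrightarrow> a o\<^sub>L b \<in> G" "\<And>a. a \<in> G \<Longrightarrow> adj a \<in> G"
  shows "cstar_algebra (closure (ops.span G))"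
  by (rule cstar_algebra_closure)
    (use assms span_bounded_ops span_compose span_adj in \<open>blast intro: ops.subspace_span\<close>)+


section \<open>Finite paths\<close>

definition edge_op :: "(nat \<Rightarrow> nat \<Rightarrow> int \<Rightarrow> ('h::chilbert_space \<Rightarrow>\<^sub>L 'h)) \<Rightarrow> edge \<Rightarrow> ('h \<Rightarrow>\<^sub>L 'h)" where
  "edge_op s e = s (src e) (tgt e) (snd (snd e))"

text \<open>The source of a path that ends at \<open>i\<close>; the vertex matters for the length-zero path only.\<close>

fun path_src :: "nat \<Rightarrow> edge list \<Rightarrow> nat" where
  "path_src i [] = i"
| "path_src i (e # es) = src e"

text \<open>Addition with carry along a finite path: each edge is a digit with its own base
  \<open>A i j\<close>, and the incoming carry is weighted by \<open>B i j\<close>.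
  \<open>carry_list\<close> is the carry that leaves the last edge.\<close>

fun act_list :: "(nat \<Rightarrow> nat \<Rightarrow> nat) \<Rightarrow> (nat \<Rightarrow> nat \<Rightarrow> int) \<Rightarrow> int \<Rightarrow> edge list \<Rightarrow> edge list" where
  "act_list A B t [] = []"
| "act_list A B t ((i, j, n) # es) =
     (i, j, (n + t * B i j - 1) mod int (A i j) + 1)
       # act_list A B ((n + t * B i j - 1) div int (A i j)) es"

fun carry_list :: "(nat \<Rightarrow> nat \<Rightarrow> nat) \<Rightarrow> (nat \<Rightarrow> nat \<Rightarrow> int) \<Rightarrow> int \<Rightarrow> edge list \<Rightarrow> int" where
  "carry_list A B t [] = t"
| "carry_list A B t ((i, j, n) # es) = carry_list A B ((n + t * B i j - 1) div int (A i j)) es"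

lemma edgesD:
  assumes "e \<in> edges N A"
  shows "src e \<in> vertices N" "tgt e \<in> vertices N" "(src e, tgt e) \<in> Omega N A"
  using assms by (auto simp: edges_def Omega_def)

text \<open>A uniform recursion in place of the three defining clauses: \<open>path_src\<close>
  returns the end vertex for an empty tail.\<close>

lemma path_ending_at_Cons:
  "path_ending_at N A i (e # es) \<longleftrightarrow> e \<in> edges N A \<and> tgt e = path_src i es \<and> path_ending_at N A i es"
  by (cases es) (auto dest: edgesD)

lemma path_ending_at_vertices: "path_ending_at N A i es \<Longrightarrow> i \<in> vertices N"
  by (induction es) (auto simp: path_ending_at_Cons)

lemma path_src_vertices: "path_ending_at N A i es \<Longrightarrow> path_src i es \<in> vertices N"
  by (cases es) (auto simp: path_ending_at_Cons dest: edgesD)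

lemma path_src_append [simp]: "path_src i (es @ es') = path_src (path_src i es') es"
  by (cases es) auto

lemma path_ending_at_append:
  "path_ending_at N A i (es @ es') \<longleftrightarrow>
    path_ending_at N A (path_src i es') es \<and> path_ending_at N A i es'"
  by (induction es) (auto simp: path_ending_at_Cons path_src_vertices)

lemma act_list_src [simp]: "path_src i (act_list A B t es) = path_src i es"
  by (cases "(A, B, t, es)" rule: act_list.cases) auto

lemma act_list_path: "path_ending_at N A i es \<Longrightarrow> path_ending_at N A i (act_list A B t es)"
proof (induction A B t es rule: act_list.induct)
  case (2 A B t k j n es)
  from 2(2) have "1 \<le> A k j" by (auto simp: path_ending_at_Cons edges_def Omega_def)
  moreover have "(n + t * B k j - 1) mod int (A k j) < int (A k j)"
    "0 \<le> (n + t * B k j - 1) mod int (A k j)"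
    using calculation by (intro pos_mod_bound pos_mod_sign; simp)+
  ultimately show ?case using 2 by (auto simp: path_ending_at_Cons edges_def)
qed auto


section \<open>Katsura families\<close>

text \<open>The path space depends on the matrices alone; keeping it free of operators lets the same
  space serve the universal family and its representations.\<close>

locale katsura_data =
  fixes N :: enat and A :: "nat \<Rightarrow> nat \<Rightarrow> nat" and B :: "nat \<Rightarrow> nat \<Rightarrow> int"
  assumes matrices: "katsura_matrices N A B"
begin

abbreviation "V \<equiv> vertices N"
abbreviation "fpath \<equiv> path_ending_at N A"

lemma finite_edges_from: "i \<in> V \<Longrightarrow> finite {e \<in> edges N A. src e = i}"
proof -
  assume i: "i \<in> V"
  have "finite {j \<in> V. A i j \<noteq> 0}" using matrices i by (auto simp: katsura_matrices_def)
  then have "finite (SIGMA j : {j \<in> V. A i j \<noteq> 0}. {1..int (A i j)})" by auto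
  then have "finite (Pair i ` (SIGMA j : {j \<in> V. A i j \<noteq> 0}. {1..int (A i j)}))" by (rule finite_imageI)
  then show ?thesis
    by (rule finite_subset[rotated]) (auto simp: edges_def Omega_def)
qed

text \<open>The double sum of relation (iii) runs over the edges leaving \<open>i\<close>; the form
  with edges is the one that fits paths.\<close>

lemma edge_sum:
  assumes i: "i \<in> V"
  shows "(\<Sum>j | (i, j) \<in> Omega N A. \<Sum>n\<in>{1..int (A i j)}. f (i, j, n)) = (\<Sum>e | e \<in> edges N A \<and> src e = i. f e)"
proof -
  have fin: "finite {j. (i, j) \<in> Omega N A}"
    by (rule finite_subset[of _ "{j \<in> V. A i j \<noteq> 0}"])
      (use matrices i in \<open>auto simp: katsura_matrices_def Omega_def\<close>)
  have "(\<Sum>j | (i, j) \<in> Omega N A. \<Sum>n\<in>{1..int (A i j)}. f (i, j, n))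
      = (\<Sum>(j, n)\<in>(SIGMA j : {j. (i, j) \<in> Omega N A}. {1..int (A i j)}). f (i, j, n))"
    by (rule sum.Sigma) (use fin in auto)
  also have "\<dots> = (\<Sum>e | e \<in> edges N A \<and> src e = i. f e)"
    by (rule sum.reindex_bij_witness[of _ snd "Pair i"]) (auto simp: edges_def)
  finally show ?thesis .
qed

end

locale katsura_fam = katsura_data N A B
  for N :: enat and A :: "nat \<Rightarrow> nat \<Rightarrow> nat" and B :: "nat \<Rightarrow> nat \<Rightarrow> int" +
  fixes q u :: "nat \<Rightarrow> ('h::chilbert_space \<Rightarrow>\<^sub>L 'h)" and s :: "nat \<Rightarrow> nat \<Rightarrow> int \<Rightarrow> ('h \<Rightarrow>\<^sub>L 'h)"
  assumes family: "katsura_family N A B q u s"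
begin

abbreviation "U \<equiv> u_pow q u"
abbreviation "SP \<equiv> path_op q s"
abbreviation "SE \<equiv> edge_op s"
abbreviation "form \<equiv> has_form N A q u s"
abbreviation "SG \<equiv> katsura_semigroup N A u s"
abbreviation "KA \<equiv> katsura_algebra N A q u s"

lemma fam:
  "\<forall>i\<in>V. q i \<in> bounded_ops UNIV \<and> u i \<in> bounded_ops UNIV"
  "\<forall>(i, j)\<in>Omega N A. \<forall>n. s i j n \<in> bounded_ops UNIV"
  "\<forall>i\<in>V. is_projection (q i)"
  "\<forall>i\<in>V. \<forall>j\<in>V. i \<noteq> j \<longrightarrow> q i o\<^sub>L q j = 0"
  "\<forall>i\<in>V. u i o\<^sub>L adj (u i) = q i \<and> adj (u i) o\<^sub>L u i = q i"
  "\<forall>(i, j)\<in>Omega N A. \<forall>n.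
        s i j n o\<^sub>L u j = s i j (n + int (A i j)) \<and> u i o\<^sub>L s i j n = s i j (n + B i j)"
  "\<forall>(i, j)\<in>Omega N A. \<forall>n. adj (s i j n) o\<^sub>L s i j n = q j"
  "\<forall>i\<in>V. q i = (\<Sum>j | (i, j) \<in> Omega N A. \<Sum>n\<in>{1..int (A i j)}. s i j n o\<^sub>L adj (s i j n))"
  using family unfolding katsura_family_def by - (elim conjE, assumption)+

lemma ops [simp]:
  "i \<in> V \<Longrightarrow> q i \<in> bounded_ops UNIV" "i \<in> V \<Longrightarrow> u i \<in> bounded_ops UNIV"
  "(i, j) \<in> Omega N A \<Longrightarrow> s i j n \<in> bounded_ops UNIV"
  using fam(1,2) by auto

lemma Omega_vertices: "(i, j) \<in> Omega N A \<Longrightarrow> i \<in> V \<and> j \<in> V"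
  by (auto simp: Omega_def)

lemma edge_op_ops [simp]: "e \<in> edges N A \<Longrightarrow> SE e \<in> bounded_ops UNIV"
  by (auto simp: edge_op_def dest: edgesD)

lemma q_proj: "i \<in> V \<Longrightarrow> is_projection (q i)"
  using fam(3) by blast

lemma q_adj [simp]: "i \<in> V \<Longrightarrow> adj (q i) = q i" and q_idem [simp]: "i \<in> V \<Longrightarrow> q i o\<^sub>L q i = q i"
  using q_proj unfolding is_projection_def by blast+

lemma q_orth: "i \<in> V \<Longrightarrow> j \<in> V \<Longrightarrow> i \<noteq> j \<Longrightarrow> q i o\<^sub>L q j = 0"
  using fam(4) by blast

lemma u_adj: "i \<in> V \<Longrightarrow> u i o\<^sub>L adj (u i) = q i" "i \<in> V \<Longrightarrow> adj (u i) o\<^sub>L u i = q i"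
  using fam(5) by blast+

lemma s_u: "(i, j) \<in> Omega N A \<Longrightarrow> s i j n o\<^sub>L u j = s i j (n + int (A i j))"
  and u_s: "(i, j) \<in> Omega N A \<Longrightarrow> u i o\<^sub>L s i j n = s i j (n + B i j)"
  and s_adj: "(i, j) \<in> Omega N A \<Longrightarrow> adj (s i j n) o\<^sub>L s i j n = q j"
  using fam(6,7) by auto

lemma q_sum:
  "i \<in> V \<Longrightarrow> q i = (\<Sum>j | (i, j) \<in> Omega N A. \<Sum>n\<in>{1..int (A i j)}. s i j n o\<^sub>L adj (s i j n))"
  by (rule bspec[OF fam(8)])

lemma u_q: "i \<in> V \<Longrightarrow> u i o\<^sub>L q i = u i" and q_u: "i \<in> V \<Longrightarrow> q i o\<^sub>L u i = u i"
  by (rule isometry_source isometry_range; simp add: u_adj)+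

lemma adj_u_q: "i \<in> V \<Longrightarrow> adj (u i) o\<^sub>L q i = adj (u i)" and q_adj_u: "i \<in> V \<Longrightarrow> q i o\<^sub>L adj (u i) = adj (u i)"
  by (rule isometry_source isometry_range; simp add: u_adj bounded_ops_adj adj_adj)+

lemma s_q: "(i, j) \<in> Omega N A \<Longrightarrow> s i j n o\<^sub>L q j = s i j n"
  by (rule isometry_source) (auto simp: s_adj Omega_vertices)

text \<open>Both follow from writing \<open>s i j n\<close> as \<open>u i\<close> composed with
  \<open>s i j (n - B i j)\<close>: \<open>q i\<close> fixes \<open>u i\<close> from the left, and
  the adjoint of \<open>u i\<close> cancels it.\<close>

lemma adj_u_s: "(i, j) \<in> Omega N A \<Longrightarrow> adj (u i) o\<^sub>L s i j n = s i j (n - B i j)"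
  and q_s: "(i, j) \<in> Omega N A \<Longrightarrow> q i o\<^sub>L s i j n = s i j n"
proof -
  show q_s: "q i o\<^sub>L s i j n = s i j n" if "(i, j) \<in> Omega N A" for n
    using u_s[OF that, of "n - B i j"] q_u[of i] Omega_vertices[OF that]
    by (metis blinfun_compose_assoc diff_add_cancel)
  show "adj (u i) o\<^sub>L s i j n = s i j (n - B i j)" if "(i, j) \<in> Omega N A"
    using u_s[OF that, of "n - B i j"] u_adj(2)[of i] Omega_vertices[OF that] q_s[OF that]
    by (metis blinfun_compose_assoc diff_add_cancel)
qed

lemma s_adj_u: "(i, j) \<in> Omega N A \<Longrightarrow> s i j n o\<^sub>L adj (u j) = s i j (n - int (A i j))"
  using s_u[of i j "n - int (A i j)"] u_adj(1)[of j] Omega_vertices s_q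
  by (metis blinfun_compose_assoc diff_add_cancel)

lemma edge_op_simps:
  assumes "e \<in> edges N A"
  shows "adj (SE e) o\<^sub>L SE e = q (tgt e)" "SE e o\<^sub>L q (tgt e) = SE e" "q (src e) o\<^sub>L SE e = SE e"
  using edgesD(3)[OF assms] by (auto simp: edge_op_def s_adj s_q q_s)

section \<open>Integer powers of the partial unitaries\<close>

lemma U_0 [simp]: "U i 0 = q i"
  by (simp add: u_pow_def)

lemma U_ops [simp]: "i \<in> V \<Longrightarrow> U i t \<in> bounded_ops UNIV"
proof -
  assume i: "i \<in> V"
  have "((o\<^sub>L) a ^^ n) (q i) \<in> bounded_ops UNIV" if "a \<in> bounded_ops UNIV" for a n
    by (induction n) (auto simp: i that bounded_ops_compose)
  then show ?thesis using i by (simp add: u_pow_def bounded_ops_adj)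
qed

lemma q_U: "i \<in> V \<Longrightarrow> q i o\<^sub>L U i t = U i t"
proof -
  assume i: "i \<in> V"
  have "q i o\<^sub>L ((o\<^sub>L) a ^^ n) (q i) = ((o\<^sub>L) a ^^ n) (q i)" if "q i o\<^sub>L a = a" for a n
    by (cases n) (auto simp: i that blinfun_compose_assoc[symmetric])
  then show ?thesis using i by (simp add: u_pow_def q_u q_adj_u)
qed

lemma U_Suc: 
  assumes i: "i \<in> V"
  shows "u i o\<^sub>L U i t = U i (t + 1)"
proof (cases "t \<ge> 0")
  case True
  then show ?thesis by (simp add: u_pow_def nat_add_distrib)
next
  case False
  then obtain n where n: "nat (- t) = Suc n" by (metis neg_0_less_iff_less not_le zero_less_nat_eq gr0_conv_Suc)
  \<comment> \<open>The exponent -1 moves to 0, where \<open>u_pow\<close> changes its branch; both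
    branches give \<open>q i\<close> there.\<close>
  have *: "U i (t + 1) = ((o\<^sub>L) (adj (u i)) ^^ n) (q i)"
  proof (cases "n = 0")
    case True
    then have "t + 1 = 0" using n by linarith
    then show ?thesis using True by simp
  next
    case n0: False
    then have "\<not> t + 1 \<ge> 0" "nat (- (t + 1)) = n" using n by linarith+
    then show ?thesis by (simp add: u_pow_def)
  qed
  have "u i o\<^sub>L U i t = (u i o\<^sub>L adj (u i)) o\<^sub>L U i (t + 1)"
    unfolding * using False n by (simp add: u_pow_def blinfun_compose_assoc)
  then show ?thesis by (simp add: i u_adj q_U)
qed

lemma U_pred:
  assumes i: "i \<in> V"
  shows "adj (u i) o\<^sub>L U i t = U i (t - 1)"
  using U_Suc[OF i, of "t - 1"] u_adj(2)[OF i] q_U[OF i, of "t - 1"]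
  by (metis blinfun_compose_assoc diff_add_cancel)

lemma U_1: "i \<in> V \<Longrightarrow> U i 1 = u i" and U_minus_1: "i \<in> V \<Longrightarrow> U i (- 1) = adj (u i)"
proof -
  show "U i 1 = u i" if "i \<in> V" using U_Suc[OF that, of 0] that by (simp add: u_q)
  show "U i (- 1) = adj (u i)" if "i \<in> V" using U_pred[OF that, of 0] that by (simp add: adj_u_q)
qed

lemma U_add: 
  assumes i: "i \<in> V"
  shows "U i t o\<^sub>L U i r = U i (t + r)"
proof (induction t rule: int_induct[where k = 0])
  case base
  show ?case by (simp add: i q_U)
next
  case (step1 t)
  have "U i (t + 1) o\<^sub>L U i r = u i o\<^sub>L (U i t o\<^sub>L U i r)"
    by (simp add: U_Suc[OF i, symmetric] blinfun_compose_assoc)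
  then show ?case by (simp add: step1 U_Suc i ac_simps)
next
  case (step2 t)
  have "U i (t - 1) o\<^sub>L U i r = adj (u i) o\<^sub>L (U i t o\<^sub>L U i r)"
    by (simp add: U_pred[OF i, symmetric] blinfun_compose_assoc)
  then show ?case by (simp add: step2 U_pred i algebra_simps)
qed

lemma U_adj: 
  assumes i: "i \<in> V"
  shows "adj (U i t) = U i (- t)"
proof (induction t rule: int_induct[where k = 0])
  case base
  show ?case by (simp add: i)
next
  case (step1 t)
  have "adj (U i (t + 1)) = adj (U i t) o\<^sub>L adj (u i)"
    by (simp add: U_Suc[OF i, symmetric] i adj_compose)
  then show ?case by (simp add: step1 U_minus_1[OF i, symmetric] U_add i)
next
  case (step2 t)
  have "adj (U i (t - 1)) = adj (U i t) o\<^sub>L u i"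
    by (simp add: U_pred[OF i, symmetric] i adj_compose bounded_ops_adj adj_adj)
  then show ?case by (simp add: step2 U_1[OF i, symmetric] U_add i)
qed

lemma U_q: "i \<in> V \<Longrightarrow> U i t o\<^sub>L q i = U i t"
  using U_add[of i t 0] by simp

lemma U_s: 
  assumes ij: "(i, j) \<in> Omega N A"
  shows "U i t o\<^sub>L s i j n = s i j (n + t * B i j)"
proof (induction t rule: int_induct[where k = 0])
  case base
  show ?case by (simp add: ij q_s)
next
  case (step1 t)
  have "U i (t + 1) o\<^sub>L s i j n = u i o\<^sub>L (U i t o\<^sub>L s i j n)"
    using Omega_vertices[OF ij] by (simp add: U_Suc[symmetric] blinfun_compose_assoc)
  then show ?case by (simp add: step1 ij u_s algebra_simps)
next
  case (step2 t)
  have "U i (t - 1) o\<^sub>L s i j n = adj (u i) o\<^sub>L (U i t o\<^sub>L s i j n)"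
    using Omega_vertices[OF ij] by (simp add: U_pred[symmetric] blinfun_compose_assoc)
  then show ?case by (simp add: step2 ij adj_u_s algebra_simps)
qed

lemma s_U: 
  assumes ij: "(i, j) \<in> Omega N A"
  shows "s i j n o\<^sub>L U j t = s i j (n + t * int (A i j))"
proof (induction t arbitrary: n rule: int_induct[where k = 0])
  case base
  show ?case by (simp add: ij s_q)
next
  case (step1 t)
  \<comment> \<open>The factor split off stands next to \<open>s i j n\<close> and is absorbed into
    its index, so the hypothesis is used at another \<open>n\<close>.\<close>
  have "s i j n o\<^sub>L U j (t + 1) = s i j (n + int (A i j)) o\<^sub>L U j t"
    using Omega_vertices[OF ij] by (simp add: U_Suc[symmetric] blinfun_compose_assoc[symmetric] s_u ij)
  then show ?case by (simp add: step1 algebra_simps)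
next
  case (step2 t)
  have "s i j n o\<^sub>L U j (t - 1) = s i j (n - int (A i j)) o\<^sub>L U j t"
    using Omega_vertices[OF ij] by (simp add: U_pred[symmetric] blinfun_compose_assoc[symmetric] s_adj_u ij)
  then show ?case by (simp add: step2 algebra_simps)
qed

text \<open>The clause for a single edge omits the final projection; s q = s makes the recursion
  uniform.\<close>

lemma path_op_Cons: 
  assumes "fpath i (e # es)"
  shows "SP i (e # es) = SE e o\<^sub>L SP i es"
  using assms edge_op_simps(2)[of e]
  by (cases e; cases es) (auto simp: edge_op_def)

lemma path_op_ops [simp]: "fpath i es \<Longrightarrow> SP i es \<in> bounded_ops UNIV"
proof (induction es)
  case (Cons e es)
  then show ?case using path_op_Cons[OF Cons(2)] by (auto simp: path_ending_at_Cons bounded_ops_compose)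
qed simp

lemma q_path_op: "fpath i es \<Longrightarrow> q (path_src i es) o\<^sub>L SP i es = SP i es"
proof (cases es)
  case (Cons e es')
  assume "fpath i es"
  with Cons show ?thesis
    using path_op_Cons[of i e es'] by (simp add: path_ending_at_Cons blinfun_compose_assoc[symmetric] edge_op_simps)
qed auto

lemma path_op_q: "fpath i es \<Longrightarrow> SP i es o\<^sub>L q i = SP i es"
proof (induction es)
  case (Cons e es)
  then show ?case
    using path_op_Cons[OF Cons(2)] by (simp add: path_ending_at_Cons blinfun_compose_assoc)
qed auto

lemma path_op_adj: "fpath i es \<Longrightarrow> adj (SP i es) o\<^sub>L SP i es = q i"
proof (induction es)
  case (Cons e es)
  then have e: "e \<in> edges N A" "tgt e = path_src i es" "fpath i es" by (auto simp: path_ending_at_Cons)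
  have "adj (SP i (e # es)) o\<^sub>L SP i (e # es) = adj (SP i es) o\<^sub>L ((adj (SE e) o\<^sub>L SE e) o\<^sub>L SP i es)"
    using e by (simp add: path_op_Cons[OF Cons(2)] adj_compose blinfun_compose_assoc)
  also have "\<dots> = adj (SP i es) o\<^sub>L SP i es" using e by (simp add: edge_op_simps q_path_op)
  finally show ?case using Cons e by simp
qed auto

lemma path_op_append: "fpath i (es @ es') \<Longrightarrow> SP i (es @ es') = SP (path_src i es') es o\<^sub>L SP i es'"
proof (induction es)
  case Nil
  then show ?case by (simp add: q_path_op)
next
  case (Cons e es)
  then show ?case
    using path_op_Cons[of i e "es @ es'"] path_op_Cons[of "path_src i es'" e es]
    by (simp add: path_ending_at_Cons path_ending_at_append blinfun_compose_assoc)
qed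

lemma q_edge_sum:
  assumes i: "i \<in> V"
  shows "q i = (\<Sum>e | e \<in> edges N A \<and> src e = i. SE e o\<^sub>L adj (SE e))"
  unfolding q_sum[OF i] edge_sum[OF i, symmetric, of "\<lambda>e. SE e o\<^sub>L adj (SE e)"]
  by (simp add: edge_op_def)

lemma edge_proj: "e \<in> edges N A \<Longrightarrow> is_projection (SE e o\<^sub>L adj (SE e))"
  unfolding is_projection_def
  by (simp add: adj_compose bounded_ops_adj adj_adj)
    (metis blinfun_compose_assoc edge_op_simps(1,2))

text \<open>The range projections of edges with a common source add up to the projection
  \<open>q\<close> of that source, so they are orthogonal; different sources are separated by
  orthogonal projections.\<close>

lemma edge_orth:
  assumes e: "e \<in> edges N A" and f: "f \<in> edges N A" and ne: "e \<noteq> f"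
  shows "adj (SE e) o\<^sub>L SE f = 0"
proof (cases "src e = src f")
  case True
  let ?F = "{e \<in> edges N A. src e = src f}"
  have i: "src f \<in> V" using f by (rule edgesD)
  have "(SE e o\<^sub>L adj (SE e)) o\<^sub>L (SE f o\<^sub>L adj (SE f)) = 0"
  proof (rule orthogonal_if_sum_projection[where F = ?F and p = "\<lambda>e. SE e o\<^sub>L adj (SE e)"])
    show "is_projection (\<Sum>e\<in>?F. SE e o\<^sub>L adj (SE e))"
      "(\<Sum>e\<in>?F. SE e o\<^sub>L adj (SE e)) \<in> bounded_ops UNIV"
      unfolding q_edge_sum[OF i, symmetric] by (simp_all add: q_proj i)
  qed (use True e f ne i in \<open>auto simp: finite_edges_from edge_proj bounded_ops_compose bounded_ops_adj\<close>)
  \<comment> \<open>Compressing by the two edges turns the outer factors into source projections,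
    which the middle factor absorbs.\<close>
  then have "(adj (SE e) o\<^sub>L SE e) o\<^sub>L (adj (SE e) o\<^sub>L SE f) o\<^sub>L (adj (SE f) o\<^sub>L SE f) = 0"
    by (metis blinfun_compose_assoc blinfun_compose_zero)
  moreover have "q (tgt e) o\<^sub>L adj (SE e) = adj (SE e)"
    using e edge_op_simps(2)[OF e] edgesD(2)[OF e]
    by (metis adj_compose edge_op_ops ops(1) q_adj)
  moreover have "adj (SE f) o\<^sub>L SE f = q (tgt f)" "adj (SE e) o\<^sub>L SE e = q (tgt e)"
    by (simp_all add: edge_op_simps e f)
  ultimately show ?thesis
    by (metis blinfun_compose_assoc edge_op_simps(2) f)
next
  case False
  have "adj (SE e) o\<^sub>L SE f = adj (q (src e) o\<^sub>L SE e) o\<^sub>L (q (src f) o\<^sub>L SE f)"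
    by (simp add: edge_op_simps e f)
  also have "\<dots> = adj (SE e) o\<^sub>L ((q (src e) o\<^sub>L q (src f)) o\<^sub>L SE f)"
    using e edgesD(1)[OF e] by (simp add: adj_compose blinfun_compose_assoc)
  finally show ?thesis using False e f by (simp add: q_orth edgesD)
qed

text \<open>Compared edge by edge, equal first edges cancel to a projection and distinct ones
  annihilate each other, so a nonzero product means that one path runs out while following the
  other.\<close>

lemma path_op_comparable:
  assumes "fpath i I" "fpath j J" "adj (SP i I) o\<^sub>L SP j J \<noteq> 0"
  shows "(\<exists>K. J = I @ K \<and> path_src j K = i) \<or> (\<exists>K. I = J @ K \<and> path_src i K = j)"
  using assms
proof (induction I arbitrary: J)
  case Nil
  have "i = path_src j J"
  proof (rule ccontr)
    assume "i \<noteq> path_src j J"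
    then have "q i o\<^sub>L (q (path_src j J) o\<^sub>L SP j J) = 0"
      using Nil by (metis blinfun_compose_assoc blinfun_compose_zero(1) path_ending_at_vertices path_src_vertices q_orth)
    then show False using Nil by (simp add: q_path_op)
  qed
  then show ?case by simp
next
  case (Cons e I)
  show ?case
  proof (cases J)
    case Nil
    have "j = src e"
    proof (rule ccontr)
      assume "j \<noteq> src e"
      then have "adj (q (src e) o\<^sub>L SP i (e # I)) o\<^sub>L q j = 0"
        using path_op_ops[OF Cons.prems(1)] path_ending_at_vertices[OF Cons.prems(2)]
          path_src_vertices[OF Cons.prems(1)]
        by (simp add: adj_compose blinfun_compose_assoc q_orth)
      then show False using Cons.prems Nil q_path_op[OF Cons.prems(1)] by simp
    qed
    then show ?thesis using Nil by simp
  next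
    case J: (Cons f J')
    have e: "e \<in> edges N A" "fpath i I" "tgt e = path_src i I" and f: "f \<in> edges N A" "fpath j J'" "tgt f = path_src j J'"
      using Cons.prems J by (auto simp: path_ending_at_Cons)
    have eq: "adj (SP i (e # I)) o\<^sub>L SP j J = adj (SP i I) o\<^sub>L ((adj (SE e) o\<^sub>L SE f) o\<^sub>L SP j J')"
      using Cons.prems e J by (simp add: path_op_Cons adj_compose blinfun_compose_assoc)
    then have ef: "e = f" using Cons.prems(3) edge_orth[OF e(1) f(1)] by force
    have "adj (SP i I) o\<^sub>L SP j J' \<noteq> 0"
      using eq Cons.prems(3) ef e f by (simp add: edge_op_simps q_path_op)
    from Cons.IH[OF e(2) f(2) this] show ?thesis using ef J by auto
  qed
qed

lemma path_op_cancel: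
  assumes "fpath j (I @ K)"
  shows "adj (SP (path_src j K) I) o\<^sub>L SP j (I @ K) = SP j K"
  using assms by (simp add: path_op_append path_ending_at_append blinfun_compose_assoc[symmetric]
      path_op_adj q_path_op)

lemma path_op_cancel':
  assumes "fpath j (I @ K)"
  shows "adj (SP j (I @ K)) o\<^sub>L SP (path_src j K) I = adj (SP j K)"
  using arg_cong[OF path_op_cancel[OF assms], of adj] assms
  by (simp add: adj_compose adj_adj bounded_ops_adj path_ending_at_append)

text \<open>Division with remainder on one edge, n + t B = m + k A, turns u^t s_n into s_m u^k; the
  carry \<open>k\<close> is then pushed through the rest of the path. This is the operator
  counterpart of the recursion on infinite paths.\<close>

lemma U_path_op:
  assumes "fpath i I"
  shows "U (path_src i I) t o\<^sub>L SP i I = SP i (act_list A B t I) o\<^sub>L U i (carry_list A B t I)"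
  using assms
proof (induction I arbitrary: t)
  case Nil
  then show ?case by (simp add: q_U U_q)
next
  case (Cons e I)
  obtain k j n where e: "e = (k, j, n)" by (cases e)
  define z where "z = n + t * B k j - 1"
  have kj: "(k, j) \<in> Omega N A" and j: "j = path_src i I" and I: "fpath i I"
    using Cons.prems by (auto simp: e path_ending_at_Cons edges_def)
  have "n + t * B k j = (z mod int (A k j) + 1) + z div int (A k j) * int (A k j)"
    by (simp add: z_def)
  then have *: "U k t o\<^sub>L s k j n = s k j (z mod int (A k j) + 1) o\<^sub>L U j (z div int (A k j))"
    by (simp only: U_s[OF kj] s_U[OF kj])
  have "U k t o\<^sub>L SP i (e # I) = (U k t o\<^sub>L s k j n) o\<^sub>L SP i I"
    using path_op_Cons[OF Cons.prems] by (simp add: e edge_op_def blinfun_compose_assoc)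
  also have "\<dots> = s k j (z mod int (A k j) + 1) o\<^sub>L (U j (z div int (A k j)) o\<^sub>L SP i I)"
    by (simp add: * blinfun_compose_assoc)
  also have "\<dots> = (s k j (z mod int (A k j) + 1) o\<^sub>L SP i (act_list A B (z div int (A k j)) I))
      o\<^sub>L U i (carry_list A B (z div int (A k j)) I)"
    using Cons.IH[OF I] by (simp add: j blinfun_compose_assoc)
  also have "s k j (z mod int (A k j) + 1) o\<^sub>L SP i (act_list A B (z div int (A k j)) I)
      = SP i (act_list A B t (e # I))"
    using path_op_Cons[of i] act_list_path[OF Cons.prems, of B t]
    by (simp add: e edge_op_def z_def)
  finally show ?case by (simp add: e z_def)
qed

section \<open>Normal forms of semigroup elements\<close>

lemma form_adj:
  assumes "form a I i t J"
  shows "form (adj a) J i (- t) I"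
  using assms path_ending_at_vertices[of N A i I]
  by (auto simp: has_form_def adj_compose bounded_ops_compose bounded_ops_adj adj_adj U_adj
      blinfun_compose_assoc)

lemma form_ops: "form a I i t J \<Longrightarrow> a \<in> bounded_ops UNIV"
  by (auto simp: has_form_def intro!: bounded_ops_compose bounded_ops_adj dest: path_ending_at_vertices)

text \<open>In the middle stand two paths of which one extends the other, or the product is 0. What
  remains of the longer path is moved outward past the power of the unitary by
  \<open>U_path_op\<close>.\<close>

lemma form_compose:
  assumes a: "form a I i t J" and b: "form b K k r L" and nz: "a o\<^sub>L b \<noteq> 0"
  shows "\<exists>I' i' t' J'. form (a o\<^sub>L b) I' i' t' J'"
proof -
  have I: "fpath i I" and J: "fpath i J" and K: "fpath k K" and L: "fpath k L"
    and ae: "a = SP i I o\<^sub>L U i t o\<^sub>L adj (SP i J)" and be: "b = SP k K o\<^sub>L U k r o\<^sub>L adj (SP k L)"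
    using a b by (auto simp: has_form_def)
  note i = path_ending_at_vertices[OF I] and k = path_ending_at_vertices[OF K]
  have ab: "a o\<^sub>L b = SP i I o\<^sub>L (U i t o\<^sub>L ((adj (SP i J) o\<^sub>L SP k K) o\<^sub>L (U k r o\<^sub>L adj (SP k L))))"
    by (simp add: ae be blinfun_compose_assoc)
  then have "adj (SP i J) o\<^sub>L SP k K \<noteq> 0" using nz by force
  from path_op_comparable[OF J K this]
  consider (1) K' where "K = J @ K'" "path_src k K' = i" | (2) K' where "J = K @ K'" "path_src i K' = k"
    by blast
  then show ?thesis
  proof cases
    case 1
    have K': "fpath k K'" using K 1 by (simp add: path_ending_at_append)
    have "adj (SP i J) o\<^sub>L SP k K = SP k K'" using path_op_cancel[of k J K'] K 1 by simp
    then have "a o\<^sub>L b = SP i I o\<^sub>L ((U i t o\<^sub>L SP k K') o\<^sub>L (U k r o\<^sub>L adj (SP k L)))"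
      by (simp add: ab blinfun_compose_assoc)
    also have "U i t o\<^sub>L SP k K' = SP k (act_list A B t K') o\<^sub>L U k (carry_list A B t K')"
      using U_path_op[OF K', of t] 1 by simp
    also have "SP i I o\<^sub>L ((SP k (act_list A B t K') o\<^sub>L U k (carry_list A B t K')) o\<^sub>L (U k r o\<^sub>L adj (SP k L)))
      = SP k (I @ act_list A B t K') o\<^sub>L (U k (carry_list A B t K') o\<^sub>L U k r) o\<^sub>L adj (SP k L)"
      using path_op_append[of k I "act_list A B t K'"] I 1 act_list_path[OF K']
      by (simp add: blinfun_compose_assoc path_ending_at_append)
    finally have "form (a o\<^sub>L b) (I @ act_list A B t K') k (carry_list A B t K' + r) L"
      using I L K' 1 act_list_path[OF K'] by (simp add: has_form_def path_ending_at_append U_add k)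
    then show ?thesis by blast
  next
    case 2
    have K': "fpath i K'" using J 2 by (simp add: path_ending_at_append)
    \<comment> \<open>Here the rest of the path is an adjoint to the left of the power; taking
      adjoints turns the exponent \<open>r\<close> into its negative, so the carry enters with a
      minus sign.\<close>
    let ?c = "carry_list A B (- r) K'"
    have "adj (SP i J) o\<^sub>L SP k K = adj (SP i K')" using path_op_cancel'[of i K K'] J 2 by simp
    then have "a o\<^sub>L b = SP i I o\<^sub>L (U i t o\<^sub>L ((adj (SP i K') o\<^sub>L U k r) o\<^sub>L adj (SP k L)))"
      by (simp add: ab blinfun_compose_assoc)
    also have "adj (SP i K') o\<^sub>L U k r = adj (U k (- r) o\<^sub>L SP i K')"
      using K' by (simp add: adj_compose k U_adj)
    also have "U k (- r) o\<^sub>L SP i K' = SP i (act_list A B (- r) K') o\<^sub>L U i ?c"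
      using U_path_op[OF K', of "- r"] 2 by simp
    also have "adj (SP i (act_list A B (- r) K') o\<^sub>L U i ?c)
        = U i (- ?c) o\<^sub>L adj (SP i (act_list A B (- r) K'))"
      using act_list_path[OF K'] by (simp add: adj_compose i U_adj)
    also have "SP i I o\<^sub>L (U i t o\<^sub>L ((U i (- ?c) o\<^sub>L adj (SP i (act_list A B (- r) K'))) o\<^sub>L adj (SP k L)))
       = SP i I o\<^sub>L (U i t o\<^sub>L U i (- ?c)) o\<^sub>L adj (SP i (L @ act_list A B (- r) K'))"
      using path_op_append[of i L "act_list A B (- r) K'"] L 2 act_list_path[OF K']
      by (simp add: blinfun_compose_assoc path_ending_at_append adj_compose)
    finally have "form (a o\<^sub>L b) I i (t - ?c) (L @ act_list A B (- r) K')"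
      using I L K' 2 act_list_path[OF K'] by (simp add: has_form_def path_ending_at_append U_add i)
    then show ?thesis by blast
  qed
qed

lemma form_u: "i \<in> V \<Longrightarrow> form (u i) [] i 1 []"
  by (simp add: has_form_def U_1 u_q q_u)

text \<open>The generators are indexed by all integers; division with remainder brings the index
  into the range of an edge and leaves a power of \<open>u j\<close>. The shift by 1 occurs because
  digits start at 1.\<close>

lemma form_s:
  assumes ij: "(i, j) \<in> Omega N A"
  shows "form (s i j n) [(i, j, (n - 1) mod int (A i j) + 1)] j ((n - 1) div int (A i j)) []"
proof -
  have pos: "int (A i j) > 0" and j: "j \<in> V" using ij by (auto simp: Omega_def)
  have "n = ((n - 1) mod int (A i j) + 1) + (n - 1) div int (A i j) * int (A i j)" by simp
  then have "s i j n = s i j ((n - 1) mod int (A i j) + 1) o\<^sub>L U j ((n - 1) div int (A i j))"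
    by (simp only: s_U[OF ij])
  then show ?thesis
    using pos_mod_bound[OF pos, of "n - 1"] pos_mod_sign[OF pos, of "n - 1"] ij j
    by (simp add: has_form_def edges_def blinfun_compose_assoc U_q)
qed

lemma semigroup_forms: "a \<in> SG \<Longrightarrow> a = 0 \<or> (\<exists>I i t J. form a I i t J)"
  unfolding katsura_semigroup_def
proof (induction rule: semigroup_generated.induct)
  case (gen a)
  then show ?case using form_u form_s form_adj by blast
next
  case (mult a b)
  then show ?case using form_compose by (metis blinfun_compose_zero)
qed

lemma semigroup_ops: "a \<in> SG \<Longrightarrow> a \<in> bounded_ops UNIV"
  using semigroup_forms form_ops bounded_ops_zero by blast

lemma semigroup_mult: "a \<in> SG \<Longrightarrow> b \<in> SG \<Longrightarrow> a o\<^sub>L b \<in> SG"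
  unfolding katsura_semigroup_def by (rule semigroup_generated.mult)

lemma semigroup_gens:
  "i \<in> V \<Longrightarrow> u i \<in> SG" "i \<in> V \<Longrightarrow> adj (u i) \<in> SG"
  "(i, j) \<in> Omega N A \<Longrightarrow> s i j n \<in> SG" "(i, j) \<in> Omega N A \<Longrightarrow> adj (s i j n) \<in> SG"
  unfolding katsura_semigroup_def by (rule semigroup_generated.gen; blast)+

lemma semigroup_adj: "a \<in> SG \<Longrightarrow> adj a \<in> SG"
proof -
  have "a \<in> SG \<and> adj a \<in> SG" if "a \<in> SG"
    using that unfolding katsura_semigroup_def
  proof (induction rule: semigroup_generated.induct)
    case (gen a)
    then show ?case
      using semigroup_gens[unfolded katsura_semigroup_def] by (auto simp: adj_adj)
  next
    case (mult a b)
    then have "a \<in> bounded_ops UNIV" "b \<in> bounded_ops UNIV"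
      using semigroup_ops unfolding katsura_semigroup_def by blast+
    then show ?case using mult by (auto simp: adj_compose intro: semigroup_generated.mult)
  qed
  then show "a \<in> SG \<Longrightarrow> adj a \<in> SG" by blast
qed

lemma semigroup_q: "i \<in> V \<Longrightarrow> q i \<in> SG"
  using semigroup_mult[OF semigroup_gens(1) semigroup_gens(2), of i i] by (simp add: u_adj)

lemma semigroup_edge: "e \<in> edges N A \<Longrightarrow> SE e \<in> SG"
  by (simp add: edge_op_def edgesD semigroup_gens)

lemma semigroup_path_op: "fpath i I \<Longrightarrow> SP i I \<in> SG"
proof (induction I)
  case (Cons e I)
  then show ?case
    by (simp add: path_op_Cons[OF Cons(2)] path_ending_at_Cons semigroup_mult semigroup_edge)
qed (simp add: semigroup_q)

section \<open>The Katsura algebra as a closed span\<close>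

lemma algebra_cstar: "cstar_algebra KA"
  unfolding katsura_algebra_def by (rule cstar_algebra_generated) auto

lemma algebra_gens:
  "i \<in> V \<Longrightarrow> q i \<in> KA" "i \<in> V \<Longrightarrow> u i \<in> KA" "(i, j) \<in> Omega N A \<Longrightarrow> s i j n \<in> KA"
  unfolding katsura_algebra_def cstar_generated_def by (rule hull_inc; blast)+

lemma semigroup_subset_algebra: "SG \<subseteq> KA"
proof
  fix a assume "a \<in> SG"
  then show "a \<in> KA"
    unfolding katsura_semigroup_def
    by (induction rule: semigroup_generated.induct)
      (use algebra_cstar algebra_gens in \<open>auto simp: cstar_algebra_def\<close>)
qed

text \<open>The semigroup is closed under products and adjoints, so its span is already a *-algebra.
  Identities on the algebra can thus be checked on the semigroup and extended by continuity.\<close>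

lemma algebra_eq_closure_span: "KA = closure (ops.span SG)"
proof
  have "u ` V \<union> {s i j n |i j n. (i, j) \<in> Omega N A} \<union> q ` V \<subseteq> ops.span SG"
    using semigroup_gens semigroup_q ops.span_base by blast
  also have "\<dots> \<subseteq> closure (ops.span SG)" by (rule closure_subset)
  finally show "KA \<subseteq> closure (ops.span SG)"
    unfolding katsura_algebra_def cstar_generated_def
    by (intro hull_minimal cstar_algebra_closure_span)
      (use semigroup_ops semigroup_mult semigroup_adj in auto)
  have "closed KA" "ops.subspace KA" using algebra_cstar by (auto simp: cstar_algebra_def)
  then show "closure (ops.span SG) \<subseteq> KA"
    by (intro closure_minimal ops.span_minimal semigroup_subset_algebra)
qed

end


section \<open>The path space\<close>

text \<open>In contrast to \<open>cylinder\<close>, the vertex after \<open>J\<close> is prescribed,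
  so that length-zero paths at different vertices have different sets. These sets are the domains of
  the action.\<close>

definition path_cyl :: "enat \<Rightarrow> (nat \<Rightarrow> nat \<Rightarrow> nat) \<Rightarrow> nat \<Rightarrow> edge list \<Rightarrow> (nat \<Rightarrow> edge) set" where
  "path_cyl N A i J = {prepend J \<gamma> |\<gamma>. \<gamma> \<in> infinite_paths N A \<and> src (\<gamma> 0) = i}"

definition shift :: "nat \<Rightarrow> (nat \<Rightarrow> 'a) \<Rightarrow> (nat \<Rightarrow> 'a)" where
  "shift n \<gamma> = (\<lambda>k. \<gamma> (k + n))"

lemma prepend_Nil [simp]: "prepend [] \<gamma> = \<gamma>"
  by (simp add: prepend_def)

lemma prepend_Cons_0 [simp]: "prepend (e # es) \<gamma> 0 = e"
  and prepend_Cons_Suc [simp]: "prepend (e # es) \<gamma> (Suc k) = prepend es \<gamma> k"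
  by (simp_all add: prepend_def)

lemma prepend_append: "prepend (I @ J) \<gamma> = prepend I (prepend J \<gamma>)"
  by (rule ext) (auto simp: prepend_def nth_append)

lemma prepend_inject [simp]: "prepend J \<gamma> = prepend J \<delta> \<longleftrightarrow> \<gamma> = \<delta>"
proof
  assume eq: "prepend J \<gamma> = prepend J \<delta>"
  show "\<gamma> = \<delta>"
  proof
    fix k show "\<gamma> k = \<delta> k" using fun_cong[OF eq, of "k + length J"] by (simp add: prepend_def)
  qed
qed simp

lemma prepend_shift [simp]: "prepend (map \<gamma> [0..<n]) (shift n \<gamma>) = \<gamma>"
  by (auto simp: prepend_def shift_def)

lemma shift_prepend [simp]: "shift (length J) (prepend J \<gamma>) = \<gamma>"
  by (auto simp: prepend_def shift_def)

lemma shift_shift: "shift m (shift n \<gamma>) = shift (m + n) \<gamma>"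
  by (simp add: shift_def add.assoc)

lemma shift_0 [simp]: "shift 0 \<gamma> = \<gamma>" and shift_apply [simp]: "shift n \<gamma> k = \<gamma> (k + n)"
  by (simp_all add: shift_def)

lemma map_prepend [simp]: "map (prepend J \<gamma>) [0..<length J] = J"
  by (rule nth_equalityI) (auto simp: prepend_def)

lemma map_upt_eq_iff: "map \<gamma> [0..<n] = map \<delta> [0..<n] \<longleftrightarrow> (\<forall>k<n. \<gamma> k = \<delta> k)"
  by auto

subsection \<open>The action on infinite paths\<close>

text \<open>The recursion remembers nothing but the current carry, so it can be restarted at any
  position.\<close>

lemma carry_shift: "carry A B t \<gamma> (r + k) = carry A B (carry A B t \<gamma> k) (shift k \<gamma>) r"
  by (induction r) (auto split: prod.split)

lemma u_act_shift: "shift k (u_act A B t \<gamma>) = u_act A B (carry A B t \<gamma> k) (shift k \<gamma>)"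
  by (simp add: fun_eq_iff u_act_def carry_shift)

lemma u_act_prepend: "u_act A B t (prepend J \<gamma>) = prepend (act_list A B t J) (u_act A B (carry_list A B t J) \<gamma>)"
proof (induction J arbitrary: t)
  case (Cons e J)
  obtain i j n where e: "e = (i, j, n)" by (cases e)
  define t' where "t' = (n + t * B i j - 1) div int (A i j)"
  have s: "shift 1 (prepend (e # J) \<gamma>) = prepend J \<gamma>" by (simp add: fun_eq_iff)
  have c: "carry A B t (prepend (e # J) \<gamma>) 1 = t'" by (simp add: e t'_def)
  have "shift 1 (u_act A B t (prepend (e # J) \<gamma>)) = u_act A B t' (prepend J \<gamma>)"
    unfolding u_act_shift s c ..
  also have "\<dots> = prepend (act_list A B t' J) (u_act A B (carry_list A B t' J) \<gamma>)" by (rule Cons)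
  finally have *: "u_act A B t (prepend (e # J) \<gamma>) (Suc k)
      = prepend (act_list A B t' J) (u_act A B (carry_list A B t' J) \<gamma>) k" for k
    by (metis Suc_eq_plus1 shift_apply)
  show ?case
  proof
    fix k show "u_act A B t (prepend (e # J) \<gamma>) k =
        prepend (act_list A B t (e # J)) (u_act A B (carry_list A B t (e # J)) \<gamma>) k"
      by (cases k) (simp_all only: *, simp_all add: e u_act_def t'_def)
  qed
qed simp

text \<open>Carries travel to later positions only. This causality is the continuity of the
  action.\<close>

lemma u_act_agree:
  assumes "\<forall>k<n. \<gamma> k = \<delta> k"
  shows "\<forall>k<n. u_act A B t \<gamma> k = u_act A B t \<delta> k"
proof -
  have "carry A B t \<gamma> k = carry A B t \<delta> k" if "k \<le> n" for k
    using that assms by (induction k) auto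
  then show ?thesis using assms by (auto simp: u_act_def)
qed

lemma u_act_src [simp]: "src (u_act A B t \<gamma> k) = src (\<gamma> k)"
  and u_act_tgt [simp]: "tgt (u_act A B t \<gamma> k) = tgt (\<gamma> k)"
  by (simp_all add: u_act_def split: prod.split)

lemma u_act_paths:
  assumes "\<gamma> \<in> infinite_paths N A"
  shows "u_act A B t \<gamma> \<in> infinite_paths N A"
proof -
  have "u_act A B t \<gamma> k \<in> edges N A" for k
  proof -
    obtain i j n where e: "\<gamma> k = (i, j, n)" by (cases "\<gamma> k")
    then have "(i, j, n) \<in> edges N A" using assms by (metis (mono_tags, lifting) infinite_paths_def mem_Collect_eq)
    then have ij: "(i, j) \<in> Omega N A" by (auto simp: edges_def)
    then have "int (A i j) > 0" by (auto simp: Omega_def)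
    then show ?thesis using ij pos_mod_bound pos_mod_sign
      by (simp add: e u_act_def edges_def add_increasing2 zless_imp_add1_zle)
  qed
  then show ?thesis using assms by (simp add: infinite_paths_def)
qed

text \<open>A cocycle identity, from performing one division in two stages: the quotients of the
  stages add up.\<close>

lemma carry_u_act: 
  assumes "\<gamma> \<in> infinite_paths N A"
  shows "carry A B t (u_act A B r \<gamma>) k + carry A B r \<gamma> k = carry A B (t + r) \<gamma> k"
proof (induction k)
  case (Suc k)
  obtain i j n where e: "\<gamma> k = (i, j, n)" by (cases "\<gamma> k")
  then have "(i, j, n) \<in> edges N A" using assms by (metis (mono_tags, lifting) infinite_paths_def mem_Collect_eq)
  then have a: "int (A i j) \<noteq> 0" by (auto simp: edges_def Omega_def)
  define z where "z = n + carry A B r \<gamma> k * B i j - 1"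
  define c where "c = carry A B t (u_act A B r \<gamma>) k"
  \<comment> \<open>The second stage starts from the remainder of the first, whose quotient is put
    back as a multiple of the divisor.\<close>
  have "(z mod int (A i j) + c * B i j) div int (A i j) + z div int (A i j)
      = (z mod int (A i j) + c * B i j + z div int (A i j) * int (A i j)) div int (A i j)"
    by (subst div_mult_self1[OF a]) (rule add.commute)
  also have "z mod int (A i j) + c * B i j + z div int (A i j) * int (A i j) = z + c * B i j"
    by (simp add: algebra_simps)
  also have "z + c * B i j = n + carry A B (t + r) \<gamma> k * B i j - 1"
    unfolding Suc[symmetric] z_def c_def by (simp add: algebra_simps)
  finally show ?case by (simp add: e u_act_def z_def c_def algebra_simps)
qed simp

lemma u_act_add:
  assumes "\<gamma> \<in> infinite_paths N A"
  shows "u_act A B t (u_act A B r \<gamma>) = u_act A B (t + r) \<gamma>"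
proof
  fix k
  obtain i j n where e: "\<gamma> k = (i, j, n)" by (cases "\<gamma> k")
  define z where "z = n + carry A B r \<gamma> k * B i j - 1"
  define c where "c = carry A B t (u_act A B r \<gamma>) k"
  have "(z mod int (A i j) + c * B i j) mod int (A i j) = (z + c * B i j) mod int (A i j)"
    by (simp add: mod_add_left_eq)
  also have "z + c * B i j = n + carry A B (t + r) \<gamma> k * B i j - 1"
    unfolding carry_u_act[OF assms, symmetric] z_def c_def by (simp add: algebra_simps)
  finally show "u_act A B t (u_act A B r \<gamma>) k = u_act A B (t + r) \<gamma> k"
    by (simp add: e u_act_def z_def c_def algebra_simps)
qed

text \<open>A digit between 1 and its base reproduces itself with quotient 0, so no carry ever
  arises.\<close>

lemma u_act_0:
  assumes "\<gamma> \<in> infinite_paths N A"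
  shows "u_act A B 0 \<gamma> = \<gamma>"
proof -
  have e: "\<gamma> k \<in> edges N A" for k using assms by (auto simp: infinite_paths_def)
  have "carry A B 0 \<gamma> k = 0" for k
  proof (induction k)
    case (Suc k)
    then show ?case using e[of k] by (auto simp: edges_def)
  qed simp
  moreover have "\<gamma> k = (i, j, n) \<Longrightarrow> (n - 1) mod int (A i j) + 1 = n" for i j n k
    using e[of k] by (auto simp: edges_def)
  ultimately show ?thesis by (auto simp: fun_eq_iff u_act_def split: prod.split)
qed

context katsura_data
begin

abbreviation "X \<equiv> infinite_paths N A"
abbreviation "XT \<equiv> path_space N A"
abbreviation "cyl \<equiv> path_cyl N A"

lemma X_edges: "\<gamma> \<in> X \<Longrightarrow> \<gamma> k \<in> edges N A"
  and X_tgt: "\<gamma> \<in> X \<Longrightarrow> tgt (\<gamma> k) = src (\<gamma> (Suc k))"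
  by (simp_all add: infinite_paths_def)

lemma X_src: "\<gamma> \<in> X \<Longrightarrow> src (\<gamma> k) \<in> V"
  using X_edges edgesD by blast

lemma shift_X: "\<gamma> \<in> X \<Longrightarrow> shift n \<gamma> \<in> X"
  by (simp add: infinite_paths_def)

lemma prepend_X:
  assumes "fpath i J" "\<gamma> \<in> X" "src (\<gamma> 0) = i"
  shows "prepend J \<gamma> \<in> X" "src (prepend J \<gamma> 0) = path_src i J"
proof -
  have "prepend J \<gamma> \<in> X \<and> src (prepend J \<gamma> 0) = path_src i J"
    using assms(1)
  proof (induction J)
    case (Cons e J)
    then show ?case
      by (auto simp: infinite_paths_def path_ending_at_Cons) (metis not0_implies_Suc prepend_Cons_0 prepend_Cons_Suc)+
  qed (use assms in auto)
  then show "prepend J \<gamma> \<in> X" "src (prepend J \<gamma> 0) = path_src i J" by auto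
qed

lemma X_prefix_path:
  assumes "\<gamma> \<in> X"
  shows "fpath (src (\<gamma> n)) (map \<gamma> [0..<n])"
proof -
  \<comment> \<open>The prefix is generalized to a window starting at \<open>m\<close>, because
    lists are split at their first edge.\<close>
  have "fpath (src (\<gamma> (m + n))) (map \<gamma> [m..<m + n])" for m
  proof (induction n arbitrary: m)
    case 0
    then show ?case using X_src[OF assms] by simp
  next
    case (Suc n)
    have eq: "map \<gamma> [m..<m + Suc n] = \<gamma> m # map \<gamma> [Suc m..<Suc m + n]"
      by (simp add: upt_rec)
    have "tgt (\<gamma> m) = path_src (src (\<gamma> (Suc m + n))) (map \<gamma> [Suc m..<Suc m + n])"
      using X_tgt[OF assms, of m] by (cases n) (auto simp: upt_rec)
    then show ?case unfolding eq path_ending_at_Cons using Suc[of "Suc m"] X_edges[OF assms] by simp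
  qed
  from this[of 0] show ?thesis by simp
qed

lemma cyl_subset: "fpath i J \<Longrightarrow> cyl i J \<subseteq> X"
  by (auto simp: path_cyl_def prepend_X)

lemma cyl_iff:
  assumes "fpath i J"
  shows "\<gamma> \<in> cyl i J \<longleftrightarrow> \<gamma> \<in> X \<and> (\<forall>k<length J. \<gamma> k = J ! k) \<and> src (\<gamma> (length J)) = i"
proof
  assume "\<gamma> \<in> cyl i J"
  then show "\<gamma> \<in> X \<and> (\<forall>k<length J. \<gamma> k = J ! k) \<and> src (\<gamma> (length J)) = i"
    using assms by (auto simp: path_cyl_def prepend_X) (auto simp: prepend_def)
next
  assume *: "\<gamma> \<in> X \<and> (\<forall>k<length J. \<gamma> k = J ! k) \<and> src (\<gamma> (length J)) = i"
  then have "map \<gamma> [0..<length J] = J" by (intro nth_equalityI) auto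
  then have "\<gamma> = prepend J (shift (length J) \<gamma>)" by (metis prepend_shift)
  then show "\<gamma> \<in> cyl i J" unfolding path_cyl_def using * shift_X by fastforce
qed

lemma ex_path_from:
  assumes "i \<in> V"
  shows "\<exists>\<gamma>\<in>X. src (\<gamma> 0) = i"
proof -
  have next_edge: "\<exists>e'. e' \<in> edges N A \<and> src e' = j" if "j \<in> V" for j
  proof -
    have "\<exists>k. (j, k) \<in> Omega N A" using matrices that by (simp add: katsura_matrices_def)
    then obtain k where "(j, k) \<in> Omega N A" by blast
    then have "(j, k, 1) \<in> edges N A" by (auto simp: edges_def Omega_def)
    then show ?thesis by force
  qed
  have "\<exists>f. \<forall>n. (f n \<in> edges N A \<and> (n = 0 \<longrightarrow> src (f n) = i)) \<and> tgt (f n) = src (f (Suc n))"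
    by (rule dependent_nat_choice) (use assms next_edge edgesD(2) in \<open>blast, metis nat.distinct(1)\<close>)
  then show ?thesis by (auto simp: infinite_paths_def)
qed

text \<open>Every vertex emits an edge, so every finite path extends. This supplies sample points
  and shows later that elements with a form are nonzero.\<close>

lemma cyl_nonempty: "fpath i J \<Longrightarrow> cyl i J \<noteq> {}"
  using ex_path_from path_ending_at_vertices by (fastforce simp: path_cyl_def)

subsection \<open>Topology\<close>

lemma topspace_path_space [simp]: "topspace XT = X"
proof -
  have "cylinder N A [] = X" by (auto simp: cylinder_def)
  then show ?thesis by (auto simp: path_space_def cylinder_def) (metis prepend_Nil)
qed

text \<open>A countable base of neighbourhoods at \<open>\<gamma>\<close>; openness becomes a matter
  of prefix lengths.\<close>

definition prefix_nbhd :: "(nat \<Rightarrow> edge) \<Rightarrow> nat \<Rightarrow> (nat \<Rightarrow> edge) set" where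
  "prefix_nbhd \<gamma> n = {\<delta> \<in> X. \<forall>k<n. \<delta> k = \<gamma> k}"

lemma prefix_nbhd_eq: "prefix_nbhd \<gamma> n = cylinder N A (map \<gamma> [0..<n])"
proof -
  have "\<delta> \<in> cylinder N A (map \<gamma> [0..<n])" if d: "\<delta> \<in> prefix_nbhd \<gamma> n" for \<delta>
  proof -
    have "map \<delta> [0..<n] = map \<gamma> [0..<n]" using d by (simp add: prefix_nbhd_def)
    then have "\<delta> = prepend (map \<gamma> [0..<n]) (shift n \<delta>)" by (metis prepend_shift)
    moreover have "\<delta> \<in> X" using d by (simp add: prefix_nbhd_def)
    ultimately show ?thesis unfolding cylinder_def by blast
  qed
  moreover have "\<delta> \<in> prefix_nbhd \<gamma> n" if d: "\<delta> \<in> cylinder N A (map \<gamma> [0..<n])" for \<delta>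
  proof -
    obtain \<gamma>' where "\<delta> \<in> X" "\<delta> = prepend (map \<gamma> [0..<n]) \<gamma>'" using d unfolding cylinder_def by blast
    then show ?thesis by (simp add: prefix_nbhd_def prepend_def)
  qed
  ultimately show ?thesis by blast
qed

lemma openin_prefix_nbhd: "openin XT (prefix_nbhd \<gamma> n)"
  unfolding path_space_def prefix_nbhd_eq by (rule topology_generated_by_Basis) blast

text \<open>A cylinder containing \<open>\<gamma>\<close> is given by the prefix of
  \<open>\<gamma>\<close> of its own length. The cylinders around a point are therefore nested, and
  finite intersections stay among them.\<close>

lemma openin_path_space:
  "openin XT S \<longleftrightarrow> S \<subseteq> X \<and> (\<forall>\<gamma>\<in>S. \<exists>n. prefix_nbhd \<gamma> n \<subseteq> S)"
proof
  assume S: "openin XT S"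
  then have "S \<subseteq> X" using openin_subset by fastforce
  moreover from S have "generate_topology_on (range (cylinder N A)) S"
    by (simp add: path_space_def openin_topology_generated_by_iff)
  then have "\<forall>\<gamma>\<in>S. \<exists>n. prefix_nbhd \<gamma> n \<subseteq> S"
  proof (induction rule: generate_topology_on.induct)
    case (Int a b)
    show ?case
    proof
      fix \<gamma> assume "\<gamma> \<in> a \<inter> b"
      then obtain m n where "prefix_nbhd \<gamma> m \<subseteq> a" "prefix_nbhd \<gamma> n \<subseteq> b" using Int by blast
      then have "prefix_nbhd \<gamma> (max m n) \<subseteq> a \<inter> b" by (auto simp: prefix_nbhd_def)
      then show "\<exists>n. prefix_nbhd \<gamma> n \<subseteq> a \<inter> b" by blast
    qed
  next
    case (UN K)
    then show ?case by (meson Sup_upper Union_iff subset_trans)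
  next
    case (Basis a)
    then obtain es where a: "a = cylinder N A es" by blast
    show ?case
    proof
      fix \<gamma> assume g: "\<gamma> \<in> a"
      then have "map \<gamma> [0..<length es] = es" unfolding a cylinder_def using map_prepend by auto
      then show "\<exists>n. prefix_nbhd \<gamma> n \<subseteq> a" unfolding prefix_nbhd_eq a by (metis order_refl)
    qed
  qed auto
  ultimately show "S \<subseteq> X \<and> (\<forall>\<gamma>\<in>S. \<exists>n. prefix_nbhd \<gamma> n \<subseteq> S)" by blast
next
  assume S: "S \<subseteq> X \<and> (\<forall>\<gamma>\<in>S. \<exists>n. prefix_nbhd \<gamma> n \<subseteq> S)"
  show "openin XT S"
  proof (subst openin_subopen, intro ballI)
    fix \<gamma> assume "\<gamma> \<in> S"
    then obtain n where "prefix_nbhd \<gamma> n \<subseteq> S" using S by blast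
    moreover have "\<gamma> \<in> prefix_nbhd \<gamma> n" using S \<open>\<gamma> \<in> S\<close> by (auto simp: prefix_nbhd_def)
    ultimately show "\<exists>T. openin XT T \<and> \<gamma> \<in> T \<and> T \<subseteq> S" using openin_prefix_nbhd by blast
  qed
qed

text \<open>If no finite subfamily of an open cover suffices, Koenig's lemma produces a path all of whose
  prefixes are bad, although one of its neighbourhoods lies in a single member of the cover.\<close>

lemma compactin_bounded_src: "compactin XT {\<gamma> \<in> X. src (\<gamma> 0) \<le> m}"
  unfolding compactin_def
proof (intro conjI allI impI)
  show "{\<gamma> \<in> X. src (\<gamma> 0) \<le> m} \<subseteq> topspace XT" by auto
  fix \<U> assume U: "Ball \<U> (openin XT) \<and> {\<gamma> \<in> X. src (\<gamma> 0) \<le> m} \<subseteq> \<Union>\<U>"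
  define C where "C J = {\<gamma> \<in> X. src (\<gamma> 0) \<le> m \<and> map \<gamma> [0..<length J] = J}" for J
  define bad where "bad J \<longleftrightarrow> \<not> (\<exists>\<F>. finite \<F> \<and> \<F> \<subseteq> \<U> \<and> C J \<subseteq> \<Union>\<F>)" for J
  show "\<exists>\<F>. finite \<F> \<and> \<F> \<subseteq> \<U> \<and> {\<gamma> \<in> X. src (\<gamma> 0) \<le> m} \<subseteq> \<Union>\<F>"
  proof (rule ccontr)
    assume no: "\<not> ?thesis"
    have "bad []" using no by (simp add: bad_def C_def)
    moreover have "\<exists>e. bad (J @ [e])" if J: "bad J" for J
    proof (rule ccontr)
      assume good: "\<nexists>e. bad (J @ [e])"
      \<comment> \<open>The edges that can continue \<open>J\<close>: finitely many by
        row-finiteness, and for empty \<open>J\<close> by the bound \<open>m\<close> on the source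
        as well.\<close>
      define E where "E = (if J = [] then {e \<in> edges N A. src e \<le> m} else {e \<in> edges N A. src e = tgt (last J)})"
      have f1: "finite (\<Union>i\<in>{i\<in>V. i \<le> m}. {e \<in> edges N A. src e = i})"
        by (rule finite_UN_I) (auto simp: finite_edges_from intro: finite_subset[of _ "{..m}"])
      have f2: "finite {e \<in> edges N A. src e = tgt (last J)}"
        using finite_edges_from[of "tgt (last J)"] edgesD(1)
        by (metis (mono_tags, lifting) Collect_empty_eq finite.emptyI)
      have f3: "{e \<in> edges N A. src e \<le> m} \<subseteq> (\<Union>i\<in>{i\<in>V. i \<le> m}. {e \<in> edges N A. src e = i})"
        using edgesD(1) by auto
      have E: "finite E" using f2 finite_subset[OF f3 f1] by (simp add: E_def)
      obtain F where F: "\<And>e. finite (F e)" "\<And>e. F e \<subseteq> \<U>" "\<And>e. C (J @ [e]) \<subseteq> \<Union>(F e)"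
        using good unfolding bad_def by metis
      have "C J \<subseteq> (\<Union>e\<in>E. C (J @ [e]))"
      proof
        fix \<gamma> assume g: "\<gamma> \<in> C J"
        then have gX: "\<gamma> \<in> X" and gJ: "map \<gamma> [0..<length J] = J" by (auto simp: C_def)
        have "\<gamma> (length J) \<in> E"
        proof (cases J rule: rev_cases)
          case Nil
          then show ?thesis using g X_edges by (auto simp: E_def C_def)
        next
          case (snoc J' e)
          have "\<gamma> (length J') = e" using gJ snoc by simp
          then show ?thesis using X_tgt[OF gX, of "length J'"] X_edges[OF gX] snoc
            by (auto simp: E_def)
        qed
        moreover have "\<gamma> \<in> C (J @ [\<gamma> (length J)])" using g by (auto simp: C_def)
        ultimately show "\<gamma> \<in> (\<Union>e\<in>E. C (J @ [e]))" by blast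
      qed
      also have "\<dots> \<subseteq> \<Union>(\<Union>e\<in>E. F e)"
        by (intro UN_least order_trans[OF F(3)] Union_mono UN_upper)
      finally have "C J \<subseteq> \<Union>(\<Union>e\<in>E. F e)" .
      moreover have "finite (\<Union>e\<in>E. F e)" by (rule finite_UN_I[OF E F(1)])
      moreover have "(\<Union>e\<in>E. F e) \<subseteq> \<U>" by (rule UN_least[OF F(2)])
      ultimately have "\<exists>\<F>. finite \<F> \<and> \<F> \<subseteq> \<U> \<and> C J \<subseteq> \<Union>\<F>"
        by (intro exI[of _ "\<Union>e\<in>E. F e"] conjI)
      then show False using J unfolding bad_def by (rule notE[rotated])
    qed
    ultimately have "\<exists>f. \<forall>n. (bad (f n) \<and> length (f n) = n) \<and> (\<exists>e. f (Suc n) = f n @ [e])"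
      by (intro dependent_nat_choice) (auto, metis length_append_singleton)
    then obtain f where f: "\<And>n. bad (f n)" "\<And>n. length (f n) = n" "\<And>n. \<exists>e. f (Suc n) = f n @ [e]"
      by blast
    define \<gamma> where "\<gamma> k = f (Suc k) ! k" for k
    have fg: "f n = map \<gamma> [0..<n]" for n
    proof (induction n)
      case (Suc n)
      obtain e where "f (Suc n) = f n @ [e]" using f(3) by blast
      then show ?case using Suc f(2)[of n] by (simp add: \<gamma>_def nth_append)
    qed (use f(2)[of 0] in simp)
    have ex: "\<exists>\<delta>\<in>X. src (\<delta> 0) \<le> m \<and> (\<forall>k<n. \<delta> k = \<gamma> k)" for n
    proof -
      have "C (f n) \<noteq> {}" using f(1)[of n] unfolding bad_def by (metis empty_subsetI finite.emptyI)
      then show ?thesis by (auto simp: C_def fg map_upt_eq_iff)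
    qed
    have "\<gamma> \<in> X" unfolding infinite_paths_def
    proof (intro CollectI allI)
      fix k
      obtain \<delta> where d: "\<delta> \<in> X" "\<forall>j<Suc (Suc k). \<delta> j = \<gamma> j" using ex by blast
      then have "\<delta> k = \<gamma> k" "\<delta> (Suc k) = \<gamma> (Suc k)" by auto
      then show "\<gamma> k \<in> edges N A \<and> tgt (\<gamma> k) = src (\<gamma> (Suc k))" using X_edges[OF d(1), of k] X_tgt[OF d(1), of k] by simp
    qed
    moreover have "src (\<gamma> 0) \<le> m" using ex[of 1] by auto
    ultimately obtain S where S: "S \<in> \<U>" "\<gamma> \<in> S" using U by blast
    then have "openin XT S" using U by blast
    then obtain n where n: "prefix_nbhd \<gamma> n \<subseteq> S" using S(2) unfolding openin_path_space by blast
    have "C (f n) \<subseteq> prefix_nbhd \<gamma> n" by (auto simp: C_def fg prefix_nbhd_def map_upt_eq_iff)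
    then have "finite {S} \<and> {S} \<subseteq> \<U> \<and> C (f n) \<subseteq> \<Union>{S}" using n S by auto
    then show False using f(1)[of n] unfolding bad_def by blast
  qed
qed

subsection \<open>Continuous functions vanishing at infinity\<close>

text \<open>One index serves two conditions: small oscillation on cylinders of length
  \<open>n\<close>, and small size outside the compact set of paths that start at a vertex up to
  \<open>n\<close>. For functions vanishing off the path space, such an \<open>n\<close> for every
  \<epsilon> characterizes membership in \<open>C0\<close>.\<close>

definition level_approx :: "((nat \<Rightarrow> edge) \<Rightarrow> complex) \<Rightarrow> nat \<Rightarrow> real \<Rightarrow> bool" where
  "level_approx f n \<epsilon> \<longleftrightarrow>
     (\<forall>\<gamma>\<in>X. \<forall>\<delta>\<in>X. (\<forall>k<n. \<gamma> k = \<delta> k) \<longrightarrow> cmod (f \<gamma> - f \<delta>) < \<epsilon>) \<and>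
     (\<forall>\<gamma>\<in>X. src (\<gamma> 0) > n \<longrightarrow> cmod (f \<gamma>) < \<epsilon>)"

lemma level_approx_mono: "level_approx f m \<epsilon> \<Longrightarrow> m \<le> n \<Longrightarrow> level_approx f n \<epsilon>"
  unfolding level_approx_def by (meson le_less_trans less_le_trans)

text \<open>Finitely many prefix neighbourhoods cover a compact set outside of which the function is
  small; a common bound of their lengths and sources serves.\<close>

lemma C0_level_approx:
  assumes f: "f \<in> C0 XT" and \<epsilon>: "\<epsilon> > 0"
  shows "\<exists>n. level_approx f n \<epsilon>"
proof -
  have cont: "continuous_map XT euclidean f" using f by (simp add: C0_def)
  obtain K where K: "compactin XT K" "\<forall>\<gamma>\<in>X - K. cmod (f \<gamma>) < \<epsilon> / 2"
    using f \<epsilon> half_gt_zero[OF \<epsilon>] unfolding C0_def topspace_path_space by blast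
  have KX: "K \<subseteq> X" using compactin_subset_topspace[OF K(1)] by simp
  \<comment> \<open>A positive length makes the neighbourhood fix the first edge, hence the source;
    the estimate at infinity relies on it.\<close>
  have "\<exists>n>0. \<forall>\<delta>\<in>prefix_nbhd \<gamma> n. cmod (f \<delta> - f \<gamma>) < \<epsilon> / 2" if "\<gamma> \<in> K" for \<gamma>
  proof -
    have "openin XT {\<delta> \<in> X. f \<delta> \<in> ball (f \<gamma>) (\<epsilon> / 2)}"
      using openin_continuous_map_preimage[OF cont, of "ball (f \<gamma>) (\<epsilon> / 2)"] by simp
    moreover have "\<gamma> \<in> {\<delta> \<in> X. f \<delta> \<in> ball (f \<gamma>) (\<epsilon> / 2)}" using that KX \<epsilon> by auto
    ultimately obtain n where "prefix_nbhd \<gamma> n \<subseteq> {\<delta> \<in> X. f \<delta> \<in> ball (f \<gamma>) (\<epsilon> / 2)}"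
      using openin_path_space by blast
    moreover have "prefix_nbhd \<gamma> (Suc n) \<subseteq> prefix_nbhd \<gamma> n" by (auto simp: prefix_nbhd_def)
    ultimately have "\<forall>\<delta>\<in>prefix_nbhd \<gamma> (Suc n). cmod (f \<delta> - f \<gamma>) < \<epsilon> / 2"
      by (auto simp: dist_norm norm_minus_commute)
    then show ?thesis by blast
  qed
  then obtain l where l: "\<And>\<gamma>. \<gamma> \<in> K \<Longrightarrow> l \<gamma> > 0 \<and> (\<forall>\<delta>\<in>prefix_nbhd \<gamma> (l \<gamma>). cmod (f \<delta> - f \<gamma>) < \<epsilon> / 2)"
    by metis
  have "\<exists>\<F>. finite \<F> \<and> \<F> \<subseteq> (\<lambda>\<gamma>. prefix_nbhd \<gamma> (l \<gamma>)) ` K \<and> K \<subseteq> \<Union>\<F>"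
  proof (rule compactinD[OF K(1)])
    show "openin XT U" if "U \<in> (\<lambda>\<gamma>. prefix_nbhd \<gamma> (l \<gamma>)) ` K" for U
      using that openin_prefix_nbhd by blast
    show "K \<subseteq> \<Union>((\<lambda>\<gamma>. prefix_nbhd \<gamma> (l \<gamma>)) ` K)" using KX by (auto simp: prefix_nbhd_def)
  qed
  then obtain F where F: "finite F" "F \<subseteq> K" "K \<subseteq> (\<Union>\<gamma>\<in>F. prefix_nbhd \<gamma> (l \<gamma>))"
    by (metis (no_types, lifting) finite_subset_image)
  \<comment> \<open>A sum bounds all terms even when \<open>F\<close> is empty, where a maximum
    would not exist.\<close>
  obtain n where n: "\<And>\<gamma>. \<gamma> \<in> F \<Longrightarrow> l \<gamma> \<le> n \<and> src (\<gamma> 0) \<le> n"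
  proof
    fix \<gamma> assume "\<gamma> \<in> F"
    then have "l \<gamma> \<le> (\<Sum>\<gamma>\<in>F. l \<gamma> + src (\<gamma> 0)) \<and> src (\<gamma> 0) \<le> (\<Sum>\<gamma>\<in>F. l \<gamma> + src (\<gamma> 0))"
      using member_le_sum[of \<gamma> F "\<lambda>\<gamma>. l \<gamma> + src (\<gamma> 0)"] F(1) by fastforce
    then show "l \<gamma> \<le> (\<Sum>\<gamma>\<in>F. l \<gamma> + src (\<gamma> 0)) \<and> src (\<gamma> 0) \<le> (\<Sum>\<gamma>\<in>F. l \<gamma> + src (\<gamma> 0))" .
  qed
  have near: "cmod (f \<gamma> - f \<delta>) < \<epsilon>" if gK: "\<gamma> \<in> K" and ag: "\<delta> \<in> X" "\<forall>k<n. \<gamma> k = \<delta> k" for \<gamma> \<delta>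
  proof -
    obtain \<gamma>' where g: "\<gamma>' \<in> F" "\<gamma> \<in> prefix_nbhd \<gamma>' (l \<gamma>')" using F(3) gK by auto
    then have "\<delta> \<in> prefix_nbhd \<gamma>' (l \<gamma>')" using n[OF g(1)] ag by (auto simp: prefix_nbhd_def)
    then have "cmod (f \<delta> - f \<gamma>') < \<epsilon> / 2" "cmod (f \<gamma> - f \<gamma>') < \<epsilon> / 2" using l g F by blast+
    then show ?thesis using norm_triangle_ineq4[of "f \<gamma> - f \<gamma>'" "f \<delta> - f \<gamma>'"] by simp
  qed
  have "level_approx f n \<epsilon>" unfolding level_approx_def
  proof (intro conjI ballI impI)
    fix \<gamma> \<delta> assume *: "\<gamma> \<in> X" "\<delta> \<in> X" "\<forall>k<n. \<gamma> k = \<delta> k"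
    show "cmod (f \<gamma> - f \<delta>) < \<epsilon>"
    proof (cases "\<gamma> \<in> K \<or> \<delta> \<in> K")
      case True
      then show ?thesis using near[of \<gamma> \<delta>] near[of \<delta> \<gamma>] * by (auto simp: norm_minus_commute)
    next
      case False
      then have "cmod (f \<gamma>) < \<epsilon> / 2" "cmod (f \<delta>) < \<epsilon> / 2" using K * by auto
      then show ?thesis using norm_triangle_ineq4[of "f \<gamma>" "f \<delta>"] by simp
    qed
  next
    fix \<gamma> assume *: "\<gamma> \<in> X" "n < src (\<gamma> 0)"
    have "\<gamma> \<notin> K"
    proof
      assume "\<gamma> \<in> K"
      then obtain \<gamma>' where g: "\<gamma>' \<in> F" "\<gamma> \<in> prefix_nbhd \<gamma>' (l \<gamma>')" using F(3) by auto
      then have "\<gamma> 0 = \<gamma>' 0" using l F by (auto simp: prefix_nbhd_def)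
      then show False using n[OF g(1)] * by simp
    qed
    then show "cmod (f \<gamma>) < \<epsilon>" using K * \<epsilon> by force
  qed
  then show ?thesis by blast
qed

lemma C0_zero_outside: "f \<in> C0 XT \<Longrightarrow> \<gamma> \<notin> X \<Longrightarrow> f \<gamma> = 0"
  by (simp add: C0_def)

text \<open>The paths with source at most \<open>n\<close> form a compact set, and this is the set
  required for vanishing at infinity.\<close>

lemma C0_I:
  assumes out: "\<And>\<gamma>. \<gamma> \<notin> X \<Longrightarrow> f \<gamma> = 0" and approx: "\<And>\<epsilon>. \<epsilon> > 0 \<Longrightarrow> \<exists>n. level_approx f n \<epsilon>"
  shows "f \<in> C0 XT"
  unfolding C0_def
proof (intro CollectI conjI allI impI)
  show "continuous_map XT euclidean f"
    unfolding continuous_map_def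
  proof (intro conjI allI impI)
    fix U :: "complex set" assume "openin euclidean U"
    then have U: "open U" by simp
    show "openin XT {\<gamma> \<in> topspace XT. f \<gamma> \<in> U}"
      unfolding openin_path_space topspace_path_space
    proof (intro conjI ballI)
      fix \<gamma> assume g: "\<gamma> \<in> {\<gamma> \<in> X. f \<gamma> \<in> U}"
      then obtain e where e: "e > 0" "ball (f \<gamma>) e \<subseteq> U" using U openE by blast
      then obtain n where n: "level_approx f n e" using approx by blast
      have "prefix_nbhd \<gamma> n \<subseteq> {\<gamma> \<in> X. f \<gamma> \<in> U}"
      proof
        fix \<delta> assume "\<delta> \<in> prefix_nbhd \<gamma> n"
        then have "\<delta> \<in> X" "cmod (f \<gamma> - f \<delta>) < e"
          using n g by (auto simp: prefix_nbhd_def level_approx_def)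
        then show "\<delta> \<in> {\<gamma> \<in> X. f \<gamma> \<in> U}" using e by (auto simp: dist_norm)
      qed
      then show "\<exists>n. prefix_nbhd \<gamma> n \<subseteq> {\<gamma> \<in> X. f \<gamma> \<in> U}" by blast
    qed auto
  qed auto
next
  fix \<epsilon> :: real assume "\<epsilon> > 0"
  then obtain n where "level_approx f n \<epsilon>" using approx by blast
  then have "\<forall>\<gamma>\<in>X - {\<gamma> \<in> X. src (\<gamma> 0) \<le> n}. cmod (f \<gamma>) < \<epsilon>" by (auto simp: level_approx_def)
  then show "\<exists>K. compactin XT K \<and> (\<forall>\<gamma>\<in>topspace XT - K. cmod (f \<gamma>) < \<epsilon>)"
    by (intro exI[of _ "{\<gamma> \<in> X. src (\<gamma> 0) \<le> n}"]) (simp add: compactin_bounded_src)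
qed (simp add: out)

lemma C0_add:
  assumes "f \<in> C0 XT" "g \<in> C0 XT"
  shows "(\<lambda>\<gamma>. f \<gamma> + g \<gamma>) \<in> C0 XT"
proof (rule C0_I)
  fix \<epsilon> :: real assume "\<epsilon> > 0"
  then obtain m n where "level_approx f m (\<epsilon> / 2)" "level_approx g n (\<epsilon> / 2)"
    using C0_level_approx assms by (meson half_gt_zero)
  then have a: "level_approx f (max m n) (\<epsilon> / 2)" "level_approx g (max m n) (\<epsilon> / 2)"
    by (auto elim: level_approx_mono)
  have "cmod (f \<gamma> + g \<gamma> - (f \<delta> + g \<delta>)) \<le> cmod (f \<gamma> - f \<delta>) + cmod (g \<gamma> - g \<delta>)" for \<gamma> \<delta>
    using norm_triangle_ineq[of "f \<gamma> - f \<delta>" "g \<gamma> - g \<delta>"] by (simp add: algebra_simps)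
  moreover have "cmod (f \<gamma> + g \<gamma>) \<le> cmod (f \<gamma>) + cmod (g \<gamma>)" for \<gamma> by (rule norm_triangle_ineq)
  ultimately have "level_approx (\<lambda>\<gamma>. f \<gamma> + g \<gamma>) (max m n) \<epsilon>"
    using a unfolding level_approx_def by (smt (verit, best) field_sum_of_halves)
  then show "\<exists>n. level_approx (\<lambda>\<gamma>. f \<gamma> + g \<gamma>) n \<epsilon>" by blast
qed (simp add: assms C0_zero_outside)

text \<open>Functional calculus; h 0 = 0 preserves decay. It supplies multiples, conjugates and the
  square root with which norms of representations are bounded.\<close>

lemma C0_compose:
  assumes f: "f \<in> C0 XT" and h: "continuous_on UNIV h" "h 0 = 0"
  shows "(\<lambda>\<gamma>. h (f \<gamma>)) \<in> C0 XT"
  unfolding C0_def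
proof (intro CollectI conjI allI impI)
  have "continuous_map XT euclidean (h \<circ> f)"
    using f h by (intro continuous_map_compose[where X' = euclidean]) (auto simp: C0_def)
  then show "continuous_map XT euclidean (\<lambda>\<gamma>. h (f \<gamma>))" by (simp add: o_def)
  fix \<epsilon> :: real assume "\<epsilon> > 0"
  then obtain d where d: "d > 0" "\<And>z. dist z 0 < d \<Longrightarrow> dist (h z) (h 0) < \<epsilon>"
    using h(1) unfolding continuous_on_iff by blast
  then obtain K where K: "compactin XT K" "\<forall>\<gamma>\<in>topspace XT - K. cmod (f \<gamma>) < d"
    using f unfolding C0_def by blast
  then have "\<forall>\<gamma>\<in>topspace XT - K. cmod (h (f \<gamma>)) < \<epsilon>" using d(2) h(2) by simp
  then show "\<exists>K. compactin XT K \<and> (\<forall>\<gamma>\<in>topspace XT - K. cmod (h (f \<gamma>)) < \<epsilon>)"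
    using K by blast
qed (simp add: f h C0_zero_outside)

lemma C0_scale: "f \<in> C0 XT \<Longrightarrow> (\<lambda>\<gamma>. c * f \<gamma>) \<in> C0 XT"
  by (rule C0_compose[where h = "\<lambda>z. c * z"]) (auto intro: continuous_intros)

lemma C0_zero: "(\<lambda>_. 0) \<in> C0 XT"
  by (rule C0_I) (auto simp: level_approx_def)

abbreviation C0_on :: "(nat \<Rightarrow> edge) set \<Rightarrow> ((nat \<Rightarrow> edge) \<Rightarrow> complex) set" where
  "C0_on W \<equiv> {f \<in> C0 XT. \<forall>\<gamma>. \<gamma> \<notin> W \<longrightarrow> f \<gamma> = 0}"

text \<open>A set decided by the first \<open>n\<close> edges is open and closed, so extension by 0
  stays continuous and intersecting with it keeps compactness. Functions on the domain of a
  semigroup element may then be treated as functions on the whole space.\<close>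

lemma C0_subtopology:
  assumes W: "W \<subseteq> X" and det: "\<And>\<gamma> \<delta>. \<gamma> \<in> X \<Longrightarrow> \<delta> \<in> X \<Longrightarrow> \<forall>k<n. \<gamma> k = \<delta> k \<Longrightarrow> \<gamma> \<in> W \<Longrightarrow> \<delta> \<in> W"
  shows "C0 (subtopology XT W) = C0_on W"
proof (intro equalityI subsetI)
  have top: "topspace (subtopology XT W) = W" using W by auto
  fix f assume f: "f \<in> C0 (subtopology XT W)"
  have out: "f \<gamma> = 0" if "\<gamma> \<notin> W" for \<gamma> using f that unfolding C0_def top by blast
  have cont: "continuous_map (subtopology XT W) euclidean f" using f by (simp add: C0_def)
  have "f \<in> C0 XT" unfolding C0_def topspace_path_space
  proof (intro CollectI conjI allI impI)
    show "continuous_map XT euclidean f" unfolding continuous_map_def topspace_path_space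
    proof (intro conjI allI impI)
      fix U :: "complex set" assume U: "openin euclidean U"
      show "openin XT {\<gamma> \<in> X. f \<gamma> \<in> U}" unfolding openin_path_space
      proof (intro conjI ballI)
        fix \<gamma> assume g: "\<gamma> \<in> {\<gamma> \<in> X. f \<gamma> \<in> U}"
        show "\<exists>n. prefix_nbhd \<gamma> n \<subseteq> {\<gamma> \<in> X. f \<gamma> \<in> U}"
        proof (cases "\<gamma> \<in> W")
          case True
          have "openin (subtopology XT W) {\<gamma> \<in> W. f \<gamma> \<in> U}"
            using openin_continuous_map_preimage[OF cont U] by (simp only: top)
          then obtain S where S: "openin XT S" "{\<gamma> \<in> W. f \<gamma> \<in> U} = S \<inter> W"
            unfolding openin_subtopology by blast
          then obtain m where m: "prefix_nbhd \<gamma> m \<subseteq> S"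
            using g True openin_path_space by blast
          have "prefix_nbhd \<gamma> (max m n) \<subseteq> S \<inter> W"
            using m det[of \<gamma>] g True by (fastforce simp: prefix_nbhd_def)
          then show ?thesis using S W by blast
        next
          case False
          have "prefix_nbhd \<gamma> n \<subseteq> {\<gamma> \<in> X. f \<gamma> \<in> U}"
          proof
            fix \<delta> assume d: "\<delta> \<in> prefix_nbhd \<gamma> n"
            then have "\<delta> \<notin> W" using False g det[of \<delta> \<gamma>] by (auto simp: prefix_nbhd_def)
            then have "f \<delta> = f \<gamma>" using out False by simp
            then show "\<delta> \<in> {\<gamma> \<in> X. f \<gamma> \<in> U}" using g d by (simp add: prefix_nbhd_def)
          qed
          then show ?thesis by blast
        qed
      qed auto
    qed auto
    fix \<epsilon> :: real assume e: "\<epsilon> > 0"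
    then obtain K where "compactin (subtopology XT W) K" "\<forall>\<gamma>\<in>W - K. cmod (f \<gamma>) < \<epsilon>"
      using f unfolding C0_def top by blast
    then show "\<exists>K. compactin XT K \<and> (\<forall>\<gamma>\<in>X - K. cmod (f \<gamma>) < \<epsilon>)"
      using out e by (metis Diff_iff compactin_subtopology norm_zero)
  next
    fix \<gamma> assume "\<gamma> \<notin> X" then show "f \<gamma> = 0" using out W by blast
  qed
  then show "f \<in> C0_on W" using out by blast
next
  have top: "topspace (subtopology XT W) = W" using W by auto
  fix f assume "f \<in> C0_on W"
  then have f: "f \<in> C0 XT" and out: "\<And>\<gamma>. \<gamma> \<notin> W \<Longrightarrow> f \<gamma> = 0" by auto
  have "openin XT (X - W)" unfolding openin_path_space
    using det by (auto simp: prefix_nbhd_def)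
  then have W_closed: "closedin XT W" using W by (simp add: closedin_def)
  show "f \<in> C0 (subtopology XT W)" unfolding C0_def top
  proof (intro CollectI conjI allI impI)
    show "continuous_map (subtopology XT W) euclidean f"
      using f by (auto simp: C0_def continuous_map_from_subtopology)
    fix \<epsilon> :: real assume "\<epsilon> > 0"
    then obtain K where K: "compactin XT K" "\<forall>\<gamma>\<in>X - K. cmod (f \<gamma>) < \<epsilon>"
      using f unfolding C0_def topspace_path_space by blast
    have "compactin (subtopology XT W) (W \<inter> K)"
      unfolding compactin_subtopology using closed_Int_compactin[OF W_closed K(1)] by auto
    then show "\<exists>K. compactin (subtopology XT W) K \<and> (\<forall>\<gamma>\<in>W - K. cmod (f \<gamma>) < \<epsilon>)"
      using K W by blast
  qed (rule out)
qed

text \<open>One edge beyond \<open>J\<close> has to be read, since its source is the vertex that the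
  set prescribes.\<close>

lemma cyl_determined:
  assumes J: "fpath i J" and g: "\<gamma> \<in> X" "\<delta> \<in> X" "\<forall>k<Suc (length J). \<gamma> k = \<delta> k" "\<gamma> \<in> cyl i J"
  shows "\<delta> \<in> cyl i J"
  using g unfolding cyl_iff[OF J] by (metis less_Suc_eq)

lemma C0_cyl:
  assumes "fpath i J"
  shows "C0 (subtopology XT (cyl i J)) = C0_on (cyl i J)"
proof (rule C0_subtopology[where n = "Suc (length J)"])
  show "cyl i J \<subseteq> X" by (rule cyl_subset[OF assms])
  show "\<delta> \<in> cyl i J" if "\<gamma> \<in> X" "\<delta> \<in> X" "\<forall>k<Suc (length J). \<gamma> k = \<delta> k" "\<gamma> \<in> cyl i J" for \<gamma> \<delta>
    by (rule cyl_determined[OF assms that])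
qed

definition ind :: "(nat \<Rightarrow> edge) set \<Rightarrow> (nat \<Rightarrow> edge) \<Rightarrow> complex" where
  "ind W \<gamma> = (if \<gamma> \<in> W then 1 else 0)"

lemma ind_C0:
  assumes W: "W \<subseteq> X" and det: "\<And>\<gamma> \<delta>. \<gamma> \<in> X \<Longrightarrow> \<delta> \<in> X \<Longrightarrow> \<forall>k<n. \<gamma> k = \<delta> k \<Longrightarrow> \<gamma> \<in> W \<Longrightarrow> \<delta> \<in> W"
    and bd: "\<And>\<gamma>. \<gamma> \<in> W \<Longrightarrow> src (\<gamma> 0) \<le> m"
  shows "ind W \<in> C0 XT"
proof (rule C0_I)
  have same: "ind W \<gamma> = ind W \<delta>" if "\<gamma> \<in> X" "\<delta> \<in> X" "\<forall>k<n. \<gamma> k = \<delta> k" for \<gamma> \<delta>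
    using det[of \<gamma> \<delta>] det[of \<delta> \<gamma>] that by (auto simp: ind_def)
  fix \<epsilon> :: real assume e: "\<epsilon> > 0"
  have "level_approx (ind W) (max m n) \<epsilon>"
    unfolding level_approx_def
  proof (intro conjI ballI impI)
    show "cmod (ind W \<gamma> - ind W \<delta>) < \<epsilon>" if "\<gamma> \<in> X" "\<delta> \<in> X" "\<forall>k<max m n. \<gamma> k = \<delta> k" for \<gamma> \<delta>
      using same[of \<gamma> \<delta>] that e by simp
    show "cmod (ind W \<gamma>) < \<epsilon>" if "\<gamma> \<in> X" "max m n < src (\<gamma> 0)" for \<gamma>
      using bd[of \<gamma>] that e by (auto simp: ind_def)
  qed
  then show "\<exists>n. level_approx (ind W) n \<epsilon>" by blast
qed (use W in \<open>auto simp: ind_def\<close>)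

lemma cyl_src: "fpath i J \<Longrightarrow> \<gamma> \<in> cyl i J \<Longrightarrow> src (\<gamma> 0) = path_src i J"
  by (auto simp: path_cyl_def prepend_X)

lemma ind_cyl_C0:
  assumes "fpath i J"
  shows "ind (cyl i J) \<in> C0 XT"
proof (rule ind_C0[where n = "Suc (length J)" and m = "path_src i J"])
  show "cyl i J \<subseteq> X" by (rule cyl_subset[OF assms])
  show "\<delta> \<in> cyl i J" if "\<gamma> \<in> X" "\<delta> \<in> X" "\<forall>k<Suc (length J). \<gamma> k = \<delta> k" "\<gamma> \<in> cyl i J" for \<gamma> \<delta>
    by (rule cyl_determined[OF assms that])
  show "src (\<gamma> 0) \<le> path_src i J" if "\<gamma> \<in> cyl i J" for \<gamma>
    by (simp add: cyl_src[OF assms that])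
qed

end


section \<open>Representations of function algebras\<close>

text \<open>The function analogue of the argument for \<open>star_hom_contractive\<close>, with the explicit solution
  \<open>g = 1 - sqrt (1 - \<bar>f\<bar>\<^sup>2)\<close>.\<close>

lemma star_rep_contractive:
  fixes \<pi> :: "('x \<Rightarrow> complex) \<Rightarrow> ('h::chilbert_space \<Rightarrow>\<^sub>L 'h)"
  assumes ops: "\<And>f. f \<in> F \<Longrightarrow> \<pi> f \<in> bounded_ops UNIV"
    and add: "\<And>f g. f \<in> F \<Longrightarrow> g \<in> F \<Longrightarrow> \<pi> (\<lambda>x. f x + g x) = \<pi> f + \<pi> g"
    and mult: "\<And>f g. f \<in> F \<Longrightarrow> g \<in> F \<Longrightarrow> \<pi> (\<lambda>x. f x * g x) = \<pi> f o\<^sub>L \<pi> g"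
    and scale: "\<And>f c. f \<in> F \<Longrightarrow> \<pi> (\<lambda>x. c * f x) = op_scale c (\<pi> f)"
    and adj: "\<And>f. f \<in> F \<Longrightarrow> \<pi> (\<lambda>x. cnj (f x)) = adj (\<pi> f)"
    and comp: "\<And>f h. f \<in> F \<Longrightarrow> continuous_on UNIV h \<Longrightarrow> h 0 = 0 \<Longrightarrow> (\<lambda>x. h (f x)) \<in> F"
    and add_closed: "\<And>f g. f \<in> F \<Longrightarrow> g \<in> F \<Longrightarrow> (\<lambda>x. f x + g x) \<in> F"
    and f: "f \<in> F" "\<And>x. cmod (f x) \<le> M" and M: "M \<ge> 0"
  shows "norm (\<pi> f) \<le> M"
proof -
  have one: "norm (\<pi> f) \<le> 1" if f: "f \<in> F" and le: "\<And>x. cmod (f x) \<le> 1" for f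
  proof -
    define g where "g x = complex_of_real (1 - sqrt (1 - (cmod (f x))\<^sup>2))" for x
    have g: "g \<in> F" unfolding g_def
      by (rule comp[where h = "\<lambda>z. complex_of_real (1 - sqrt (1 - (cmod z)\<^sup>2))", OF f])
        (auto intro!: continuous_intros)
    have cf: "(\<lambda>x. cnj (f x)) \<in> F" by (rule comp[OF f]) (auto intro!: continuous_intros)
    have gg: "(\<lambda>x. g x * g x) \<in> F" by (rule comp[where h = "\<lambda>z. z * z", OF g]) (auto intro!: continuous_intros)
    have ngg: "(\<lambda>x. (- 1) * (g x * g x)) \<in> F"
      by (rule comp[where h = "\<lambda>z. (- 1) * z", OF gg]) (auto intro!: continuous_intros)
    have eq: "cnj (f x) * f x = (g x + g x) + (- 1) * (g x * g x)" for x
    proof -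
      define r where "r = sqrt (1 - (cmod (f x))\<^sup>2)"
      have "(cmod (f x))\<^sup>2 \<le> 1" using le[of x] by (simp add: power_le_one)
      then have r: "r * r = 1 - (cmod (f x))\<^sup>2" by (simp add: r_def)
      have "cnj (f x) * f x = complex_of_real ((cmod (f x))\<^sup>2)"
        by (metis complex_norm_square mult.commute)
      also have "(cmod (f x))\<^sup>2 = 2 * (1 - r) - (1 - r) * (1 - r)" using r by (simp add: algebra_simps)
      finally show ?thesis by (simp add: g_def r_def[symmetric] algebra_simps)
    qed
    have "adj (\<pi> f) o\<^sub>L \<pi> f = \<pi> (\<lambda>x. cnj (f x) * f x)" by (simp add: mult cf f adj)
    also have "\<dots> = \<pi> g + \<pi> g + op_scale (- 1) (\<pi> g o\<^sub>L \<pi> g)"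
      unfolding eq by (simp only: add add_closed g gg ngg scale mult)
    also have "\<dots> = \<pi> g + \<pi> g - (\<pi> g o\<^sub>L \<pi> g)" by (simp only: op_scale_minus_one diff_conv_add_uminus)
    finally have eq2: "adj (\<pi> f) o\<^sub>L \<pi> f = \<pi> g + \<pi> g - (\<pi> g o\<^sub>L \<pi> g)" .
    have "(\<lambda>x. cnj (g x)) = g" by (rule ext) (simp add: g_def)
    then have "adj (\<pi> g) = \<pi> g" using adj[OF g] by simp
    then show ?thesis by (intro norm_le_one_if_sqrt[OF ops[OF f] ops[OF g] _ eq2])
  qed
  show ?thesis
  proof (rule field_le_epsilon)
    fix e :: real assume e: "e > 0"
    define c where "c = complex_of_real (inverse (M + e))"
    have c: "cmod c = inverse (M + e)" using e M unfolding c_def norm_of_real by simp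
    have "norm (\<pi> (\<lambda>x. c * f x)) \<le> 1"
    proof (rule one)
      show "(\<lambda>x. c * f x) \<in> F" by (rule comp[OF f(1)]) (auto intro!: continuous_intros)
      have "cmod (f x) \<le> M + e" for x using f(2)[of x] e by linarith
      then show "cmod (c * f x) \<le> 1" for x using e M by (simp add: norm_mult c field_simps)
    qed
    then have "norm (inverse (M + e) *\<^sub>R \<pi> f) \<le> 1"
      by (simp only: scale[OF f(1)] c_def op_scale_of_real)
    then show "norm (\<pi> f) \<le> M + e" using e M by (simp add: field_simps)
  qed
qed

section \<open>Step functions\<close>

declare upt_Suc [simp del]

lemma fpath_last:
  assumes "path_ending_at N A i K" "K \<noteq> []"
  shows "i = tgt (last K)"
  using assms
proof (induction K)
  case (Cons e K)
  then show ?case by (cases K) (auto simp: path_ending_at_Cons)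
qed simp

context katsura_data
begin

text \<open>A path with at least one edge knows its end vertex, so none has to be recorded; the
  bound \<open>m\<close> on the source keeps the level finite even for infinitely many
  vertices.\<close>

definition level_paths :: "nat \<Rightarrow> nat \<Rightarrow> edge list set" where
  "level_paths m n = {K. length K = Suc n \<and> fpath (tgt (last K)) K \<and> src (hd K) \<le> m}"

abbreviation lcyl :: "edge list \<Rightarrow> (nat \<Rightarrow> edge) set" where
  "lcyl K \<equiv> cyl (tgt (last K)) K"

definition rep :: "edge list \<Rightarrow> (nat \<Rightarrow> edge)" where
  "rep K = (SOME \<gamma>. \<gamma> \<in> lcyl K)"

lemma level_pathsD:
  assumes "K \<in> level_paths m n"
  shows "K \<noteq> []" "length K = Suc n" "fpath (tgt (last K)) K" "path_src i K = src (hd K)" "src (hd K) \<le> m"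
  using assms by (auto simp: level_paths_def) (metis list.sel(1) path_src.elims length_0_conv nat.distinct(1))

text \<open>The last edge dictates the following vertex, so only prefixes have to be
  compared.\<close>

lemma lcyl_iff:
  assumes "K \<in> level_paths m n"
  shows "\<gamma> \<in> lcyl K \<longleftrightarrow> \<gamma> \<in> X \<and> map \<gamma> [0..<Suc n] = K"
proof -
  note K = level_pathsD[OF assms]
  have "\<gamma> \<in> lcyl K \<longleftrightarrow> \<gamma> \<in> X \<and> map \<gamma> [0..<Suc n] = K \<and> src (\<gamma> (Suc n)) = tgt (last K)"
    unfolding cyl_iff[OF K(3)] K(2) list_eq_iff_nth_eq using K(2) by auto
  moreover have "src (\<gamma> (Suc n)) = tgt (last K)" if "\<gamma> \<in> X" "map \<gamma> [0..<Suc n] = K"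
    using X_tgt[OF that(1), of n] that(2)[symmetric] by (simp add: upt_Suc)
  ultimately show ?thesis by blast
qed

lemma rep_lcyl: "K \<in> level_paths m n \<Longrightarrow> rep K \<in> lcyl K"
  unfolding rep_def using cyl_nonempty[OF level_pathsD(3)] by (metis ex_in_conv someI_ex)

lemma rep_X: "K \<in> level_paths m n \<Longrightarrow> rep K \<in> X"
  and rep_prefix: "K \<in> level_paths m n \<Longrightarrow> map (rep K) [0..<Suc n] = K"
  using rep_lcyl lcyl_iff by blast+

lemma rep_src: "K \<in> level_paths m n \<Longrightarrow> src (rep K 0) = src (hd K)"
  using rep_prefix[of K m n] by (metis hd_map hd_upt upt_eq_Nil_conv not_less_eq_eq not_one_le_zero
      list.map_disc_iff zero_less_Suc level_pathsD(1))

lemma prefix_level_path: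
  assumes "\<gamma> \<in> X" "src (\<gamma> 0) \<le> m"
  shows "map \<gamma> [0..<Suc n] \<in> level_paths m n"
proof -
  have l: "last (map \<gamma> [0..<Suc n]) = \<gamma> n" by (simp add: upt_Suc)
  have h: "hd (map \<gamma> [0..<Suc n]) = \<gamma> 0" by (simp add: upt_rec)
  show ?thesis
    using X_prefix_path[OF assms(1), of "Suc n"] X_tgt[OF assms(1), of n] assms(2)
    unfolding level_paths_def mem_Collect_eq l h by simp
qed

text \<open>The passage from one level to the next, for finiteness by induction and for refining
  sums over a level.\<close>

lemma level_paths_Suc:
  "bij_betw (\<lambda>(K, e). K @ [e]) (SIGMA K : level_paths m n. {e \<in> edges N A. src e = tgt (last K)})
    (level_paths m (Suc n))"
  unfolding bij_betw_def
proof (intro conjI equalityI subsetI)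
  show "inj_on (\<lambda>(K, e). K @ [e]) (SIGMA K:level_paths m n. {e \<in> edges N A. src e = tgt (last K)})"
    by (auto simp: inj_on_def)
  fix L assume "L \<in> (\<lambda>(K, e). K @ [e]) ` (SIGMA K:level_paths m n. {e \<in> edges N A. src e = tgt (last K)})"
  then obtain K e where L: "L = K @ [e]" "K \<in> level_paths m n" "e \<in> edges N A" "src e = tgt (last K)"
    by auto
  then show "L \<in> level_paths m (Suc n)"
    using level_pathsD[OF L(2)] edgesD(2)[OF L(3)] by (auto simp: level_paths_def path_ending_at_append)
next
  fix L assume L: "L \<in> level_paths m (Suc n)"
  note D = level_pathsD[OF L]
  obtain K e where Ke: "L = K @ [e]" using D(1) by (metis rev_exhaust)
  then have "K \<noteq> []" "length K = Suc n" "fpath (src e) K" "e \<in> edges N A"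
    using D by (auto simp: path_ending_at_append)
  moreover from this have "src e = tgt (last K)" using fpath_last by blast
  ultimately have "K \<in> level_paths m n" "src e = tgt (last K)" "e \<in> edges N A"
    using D(5) Ke by (auto simp: level_paths_def)
  then show "L \<in> (\<lambda>(K, e). K @ [e]) ` (SIGMA K:level_paths m n. {e \<in> edges N A. src e = tgt (last K)})"
    using Ke by force
qed

lemma finite_level_paths: "finite (level_paths m n)"
proof (induction n)
  case 0
  have "level_paths m 0 \<subseteq> (\<lambda>e. [e]) ` (\<Union>i\<in>{i\<in>V. i \<le> m}. {e \<in> edges N A. src e = i})"
  proof
    fix K assume K: "K \<in> level_paths m 0"
    then obtain e where "K = [e]" using level_pathsD(2)[OF K] by (auto simp: length_Suc_conv)
    then show "K \<in> (\<lambda>e. [e]) ` (\<Union>i\<in>{i\<in>V. i \<le> m}. {e \<in> edges N A. src e = i})"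
      using level_pathsD[OF K] edgesD(1) by auto
  qed
  moreover have "finite (\<Union>i\<in>{i\<in>V. i \<le> m}. {e \<in> edges N A. src e = i})"
    by (rule finite_UN_I) (auto simp: finite_edges_from intro: finite_subset[of _ "{..m}"])
  ultimately show ?case by (meson finite_imageI finite_subset)
next
  case (Suc n)
  have "finite {e \<in> edges N A. src e = tgt (last K)}" if "K \<in> level_paths m n" for K
    using finite_edges_from path_ending_at_vertices level_pathsD(3)[OF that] by blast
  then show ?case
    using bij_betw_finite[OF level_paths_Suc[of m n]] Suc by (meson finite_SigmaI)
qed

definition step_fun :: "nat \<Rightarrow> ((nat \<Rightarrow> edge) \<Rightarrow> complex) \<Rightarrow> (nat \<Rightarrow> edge) \<Rightarrow> complex" where
  "step_fun n f \<gamma> = (if \<gamma> \<in> X \<and> src (\<gamma> 0) \<le> n then f (rep (map \<gamma> [0..<Suc n])) else 0)"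

text \<open>The cylinders of a level are disjoint, so only the term of the prefix of
  \<open>\<gamma>\<close> survives.\<close>

lemma step_fun_sum:
  "step_fun n f \<gamma> = (\<Sum>K\<in>level_paths n n. f (rep K) * ind (lcyl K) \<gamma>)"
proof (cases "\<gamma> \<in> X \<and> src (\<gamma> 0) \<le> n")
  case True
  let ?K = "map \<gamma> [0..<Suc n]"
  have K: "?K \<in> level_paths n n" using prefix_level_path True by blast
  have "f (rep K) * ind (lcyl K) \<gamma> = (if K = ?K then f (rep ?K) else 0)" if "K \<in> level_paths n n" for K
    using lcyl_iff[OF that, of \<gamma>] True by (auto simp: ind_def)
  then have "(\<Sum>K\<in>level_paths n n. f (rep K) * ind (lcyl K) \<gamma>) =
      (\<Sum>K\<in>level_paths n n. if K = ?K then f (rep ?K) else 0)" by (rule sum.cong[OF refl])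
  also have "\<dots> = f (rep ?K)" using K finite_level_paths by simp
  finally show ?thesis using True by (simp add: step_fun_def)
next
  case False
  have "ind (lcyl K) \<gamma> = 0" if "K \<in> level_paths n n" for K
    using cyl_subset[OF level_pathsD(3)[OF that]] cyl_src[OF level_pathsD(3)[OF that], of \<gamma>]
      level_pathsD(4,5)[OF that] False by (auto simp: ind_def)
  then show ?thesis using False by (auto simp: step_fun_def)
qed

lemma step_fun_near:
  assumes f: "\<And>\<gamma>. \<gamma> \<notin> X \<Longrightarrow> f \<gamma> = 0" and la: "level_approx f n \<epsilon>" and e: "\<epsilon> > 0"
  shows "cmod (f \<gamma> + (- 1) * step_fun n f \<gamma>) \<le> \<epsilon>"
proof (cases "\<gamma> \<in> X")
  case X: True
  show ?thesis
  proof (cases "src (\<gamma> 0) \<le> n")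
    case True
    let ?K = "map \<gamma> [0..<Suc n]"
    have K: "?K \<in> level_paths n n" using prefix_level_path True X by blast
    have "map \<gamma> [0..<Suc n] = map (rep ?K) [0..<Suc n]" by (rule rep_prefix[OF K, symmetric])
    then have "\<forall>k<n. \<gamma> k = rep ?K k" unfolding map_upt_eq_iff by simp
    then have "cmod (f \<gamma> - f (rep ?K)) < \<epsilon>"
      using la X rep_X[OF K] by (simp add: level_approx_def)
    then show ?thesis using X True by (simp add: step_fun_def)
  next
    case False
    then show ?thesis using la X by (simp add: step_fun_def level_approx_def less_imp_le)
  qed
qed (use f e in \<open>simp add: step_fun_def\<close>)

text \<open>Two such maps agree as soon as they agree on indicators. The restriction to
  \<open>W\<close> is there because covariance is claimed only for functions on the domain of the
  semigroup element.\<close>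

definition contractive_linear :: "(nat \<Rightarrow> edge) set \<Rightarrow> (((nat \<Rightarrow> edge) \<Rightarrow> complex) \<Rightarrow> ('h::chilbert_space \<Rightarrow>\<^sub>L 'h)) \<Rightarrow> bool" where
  "contractive_linear W \<Phi> \<longleftrightarrow>
     (\<forall>f\<in>C0_on W. \<forall>g\<in>C0_on W.
        \<Phi> (\<lambda>\<gamma>. f \<gamma> + g \<gamma>) = \<Phi> f + \<Phi> g) \<and>
     (\<forall>f\<in>C0_on W. \<forall>c. \<Phi> (\<lambda>\<gamma>. c * f \<gamma>) = op_scale c (\<Phi> f)) \<and>
     (\<forall>f\<in>C0_on W. \<forall>M\<ge>0. (\<forall>\<gamma>. cmod (f \<gamma>) \<le> M) \<longrightarrow> norm (\<Phi> f) \<le> M)"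

lemma contractive_linearD:
  assumes "contractive_linear W \<Phi>"
  shows "f \<in> C0_on W \<Longrightarrow> g \<in> C0_on W \<Longrightarrow>
      \<Phi> (\<lambda>\<gamma>. f \<gamma> + g \<gamma>) = \<Phi> f + \<Phi> g"
    and "f \<in> C0_on W \<Longrightarrow> \<Phi> (\<lambda>\<gamma>. c * f \<gamma>) = op_scale c (\<Phi> f)"
    and "f \<in> C0_on W \<Longrightarrow> M \<ge> 0 \<Longrightarrow> (\<And>\<gamma>. cmod (f \<gamma>) \<le> M) \<Longrightarrow> norm (\<Phi> f) \<le> M"
  using assms unfolding contractive_linear_def by blast+

lemma contractive_linear_sum:
  assumes \<Phi>: "contractive_linear W \<Phi>" and "finite F"
    and g: "\<And>k. k \<in> F \<Longrightarrow> g k \<in> C0_on W"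
  shows "(\<lambda>\<gamma>. \<Sum>k\<in>F. c k * g k \<gamma>) \<in> C0_on W \<and>
    \<Phi> (\<lambda>\<gamma>. \<Sum>k\<in>F. c k * g k \<gamma>) = (\<Sum>k\<in>F. op_scale (c k) (\<Phi> (g k)))"
  using assms(2) g
proof (induction F)
  case empty
  have z: "(\<lambda>_. 0) \<in> C0_on W" using C0_zero by simp
  \<comment> \<open>The norm bound with M = 0 sends the zero function to 0.\<close>
  then have "norm (\<Phi> (\<lambda>_. 0)) \<le> 0" using contractive_linearD(3)[OF \<Phi>, of "\<lambda>_. 0" 0] by simp
  then show ?case using z by simp
next
  case (insert k F)
  have 1: "(\<lambda>\<gamma>. c k * g k \<gamma>) \<in> C0_on W"
    using insert.prems[of k] C0_scale by auto
  have IH: "(\<lambda>\<gamma>. \<Sum>k\<in>F. c k * g k \<gamma>) \<in> C0_on W"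
    "\<Phi> (\<lambda>\<gamma>. \<Sum>k\<in>F. c k * g k \<gamma>) = (\<Sum>k\<in>F. op_scale (c k) (\<Phi> (g k)))" using insert by auto
  have "\<Phi> (\<lambda>\<gamma>. c k * g k \<gamma> + (\<Sum>k\<in>F. c k * g k \<gamma>)) = op_scale (c k) (\<Phi> (g k)) + (\<Sum>k\<in>F. op_scale (c k) (\<Phi> (g k)))"
    using contractive_linearD(1)[OF \<Phi> 1 IH(1)] contractive_linearD(2)[OF \<Phi>, of "g k" "c k"]
      IH(2) insert.prems[of k] by simp
  moreover have "(\<lambda>\<gamma>. c k * g k \<gamma> + (\<Sum>k\<in>F. c k * g k \<gamma>)) \<in> C0_on W"
    using 1 IH(1) C0_add by auto
  ultimately show ?case using insert by simp
qed

text \<open>Step functions approximate uniformly, and contractivity transfers this to the values. By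
  \<open>det\<close>, the set \<open>W\<close> is a union of cylinders of length \<open>l\<close>,
  so step functions supported in \<open>W\<close> suffice.\<close>

lemma contractive_linear_eqI:
  fixes \<Phi> \<Psi> :: "((nat \<Rightarrow> edge) \<Rightarrow> complex) \<Rightarrow> ('h::chilbert_space \<Rightarrow>\<^sub>L 'h)"
  assumes \<Phi>: "contractive_linear W \<Phi>" and \<Psi>: "contractive_linear W \<Psi>"
    and det: "\<And>\<gamma> \<delta>. \<gamma> \<in> X \<Longrightarrow> \<delta> \<in> X \<Longrightarrow> \<forall>k<l. \<gamma> k = \<delta> k \<Longrightarrow> \<gamma> \<in> W \<Longrightarrow> \<delta> \<in> W"
    and eq: "\<And>K m n. K \<in> level_paths m n \<Longrightarrow> l \<le> n \<Longrightarrow> lcyl K \<subseteq> W \<Longrightarrow> \<Phi> (ind (lcyl K)) = \<Psi> (ind (lcyl K))"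
    and f: "f \<in> C0 XT" "\<And>\<gamma>. \<gamma> \<notin> W \<Longrightarrow> f \<gamma> = 0"
  shows "\<Phi> f = \<Psi> f"
proof -
  let ?D = "C0_on W"
  have "norm (\<Phi> f - \<Psi> f) \<le> e" if e: "e > 0" for e
  proof -
    obtain n0 where "level_approx f n0 (e / 2)" using C0_level_approx[OF f(1), of "e / 2"] e by auto
    then obtain n where la: "level_approx f n (e / 2)" and n: "l \<le> n"
      by (meson level_approx_mono max.cobounded1 max.cobounded2)
    define g where "g = step_fun n f"
    \<comment> \<open>Representatives outside \<open>W\<close> contribute nothing, as
      \<open>f\<close> vanishes there; for the others the whole cylinder lies in
      \<open>W\<close>.\<close>
    define F where "F = {K \<in> level_paths n n. rep K \<in> W}"
    have fin: "finite F" unfolding F_def using finite_level_paths by simp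
    have sub: "lcyl K \<subseteq> W" if "K \<in> F" for K
    proof
      fix \<gamma> assume g: "\<gamma> \<in> lcyl K"
      have K: "K \<in> level_paths n n" "rep K \<in> W" using that by (auto simp: F_def)
      have gX: "\<gamma> \<in> X" and "map (rep K) [0..<Suc n] = map \<gamma> [0..<Suc n]"
        using g rep_prefix[OF K(1)] by (auto simp: lcyl_iff[OF K(1)])
      then have "\<forall>k<Suc n. rep K k = \<gamma> k" unfolding map_upt_eq_iff by blast
      then show "\<gamma> \<in> W" using det[OF rep_X[OF K(1)] gX _ K(2)] n by simp
    qed
    have g_eq: "g = (\<lambda>\<gamma>. \<Sum>K\<in>F. f (rep K) * ind (lcyl K) \<gamma>)"
    proof
      fix \<gamma> show "g \<gamma> = (\<Sum>K\<in>F. f (rep K) * ind (lcyl K) \<gamma>)"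
        unfolding g_def step_fun_sum F_def
        by (rule sum.mono_neutral_right) (use finite_level_paths f(2) in auto)
    qed
    have ind: "ind (lcyl K) \<in> ?D" if "K \<in> F" for K
      using ind_cyl_C0 level_pathsD(3) that sub[OF that] by (auto simp: F_def ind_def)
    have gD: "g \<in> ?D" and g\<Phi>: "\<Phi> g = (\<Sum>K\<in>F. op_scale (f (rep K)) (\<Phi> (ind (lcyl K))))"
      unfolding g_eq using contractive_linear_sum[OF \<Phi> fin ind] by auto
    have "\<Psi> g = (\<Sum>K\<in>F. op_scale (f (rep K)) (\<Psi> (ind (lcyl K))))"
      unfolding g_eq using contractive_linear_sum[OF \<Psi> fin ind] by auto
    also have "\<dots> = \<Phi> g" unfolding g\<Phi>
      by (rule sum.cong) (use eq n sub in \<open>auto simp: F_def\<close>)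
    finally have same: "\<Psi> g = \<Phi> g" .
    have ng: "(\<lambda>\<gamma>. (- 1) * g \<gamma>) \<in> ?D" using gD C0_scale[of g "- 1"] by simp
    have fD: "f \<in> ?D" using f by auto
    have dD: "(\<lambda>\<gamma>. f \<gamma> + (- 1) * g \<gamma>) \<in> ?D" using C0_add[of f "\<lambda>\<gamma>. (- 1) * g \<gamma>"] ng fD by simp
    have small: "\<forall>\<gamma>. cmod (f \<gamma> + (- 1) * g \<gamma>) \<le> e / 2"
      using step_fun_near[OF _ la] C0_zero_outside[OF f(1)] e by (simp add: g_def)
    have diff: "norm (\<Theta> f - \<Theta> g) \<le> e / 2" if \<Theta>: "contractive_linear W \<Theta>" for \<Theta> :: "_ \<Rightarrow> ('h \<Rightarrow>\<^sub>L 'h)"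
    proof -
      have "\<Theta> (\<lambda>\<gamma>. f \<gamma> + (- 1) * g \<gamma>) = \<Theta> f + op_scale (- 1) (\<Theta> g)"
        by (simp only: contractive_linearD(1)[OF \<Theta> fD ng] contractive_linearD(2)[OF \<Theta> gD])
      also have "\<dots> = \<Theta> f - \<Theta> g" by (simp add: op_scale_minus_one)
      finally have *: "\<Theta> (\<lambda>\<gamma>. f \<gamma> + (- 1) * g \<gamma>) = \<Theta> f - \<Theta> g" .
      have "norm (\<Theta> (\<lambda>\<gamma>. f \<gamma> + (- 1) * g \<gamma>)) \<le> e / 2"
        by (rule contractive_linearD(3)[OF \<Theta> dD]) (use small e in auto)
      then show ?thesis unfolding * .
    qed
    have "norm (\<Phi> f - \<Psi> f) \<le> norm (\<Phi> f - \<Phi> g) + norm (\<Psi> f - \<Psi> g)"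
      using norm_triangle_ineq4[of "\<Phi> f - \<Phi> g" "\<Psi> f - \<Psi> g"] by (simp add: same)
    then show ?thesis using diff[OF \<Phi>] diff[OF \<Psi>] by linarith
  qed
  then have "norm (\<Phi> f - \<Psi> f) \<le> 0" using dense_ge by blast
  then show ?thesis by simp
qed

text \<open>Relation (iii) for functions: every path from \<open>i\<close> has exactly one first
  edge. The factor 1 gives the sum the form expected by
  \<open>contractive_linear_sum\<close>.\<close>

lemma ind_vertex:
  assumes i: "i \<in> V"
  shows "ind (cyl i []) = (\<lambda>\<gamma>. \<Sum>e | e \<in> edges N A \<and> src e = i. 1 * ind (cyl (tgt e) [e]) \<gamma>)"
proof
  fix \<gamma>
  let ?E = "{e \<in> edges N A. src e = i}"
  have e: "fpath (tgt e) [e]" if "e \<in> ?E" for e using that edgesD(2) by simp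
  have J: "fpath i []" using i by simp
  have "1 * ind (cyl (tgt e) [e]) \<gamma> = (if e = \<gamma> 0 then ind (cyl i []) \<gamma> else 0)" if "e \<in> ?E" for e
    using that unfolding ind_def cyl_iff[OF e[OF that]] cyl_iff[OF J]
    using X_tgt[of \<gamma> 0] by auto
  then have "(\<Sum>e\<in>?E. 1 * ind (cyl (tgt e) [e]) \<gamma>) = (\<Sum>e\<in>?E. if e = \<gamma> 0 then ind (cyl i []) \<gamma> else 0)"
    by (rule sum.cong[OF refl])
  also have "\<dots> = (if \<gamma> 0 \<in> ?E then ind (cyl i []) \<gamma> else 0)" using finite_edges_from[OF i] by simp
  also have "\<dots> = ind (cyl i []) \<gamma>"
    unfolding ind_def cyl_iff[OF J] using X_edges[of \<gamma> 0] by auto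
  finally show "ind (cyl i []) \<gamma> = (\<Sum>e\<in>?E. 1 * ind (cyl (tgt e) [e]) \<gamma>)" ..
qed

end

context katsura_fam
begin

section \<open>The representation of the functions on the path space\<close>

definition pp :: "nat \<Rightarrow> edge list \<Rightarrow> ('h \<Rightarrow>\<^sub>L 'h)" where
  "pp i K = SP i K o\<^sub>L adj (SP i K)"

abbreviation "lpp K \<equiv> pp (tgt (last K)) K"

lemma pp_ops [simp]: "fpath i K \<Longrightarrow> pp i K \<in> bounded_ops UNIV"
  by (simp add: pp_def bounded_ops_compose bounded_ops_adj)

lemma pp_form: "fpath i K \<Longrightarrow> form (pp i K) K i 0 K"
  using path_op_q[of i K] by (simp add: has_form_def pp_def)

lemma pp_semigroup: "fpath i K \<Longrightarrow> pp i K \<in> SG"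
  by (simp add: pp_def semigroup_path_op semigroup_adj semigroup_mult)

lemma pp_adj [simp]: "fpath i K \<Longrightarrow> adj (pp i K) = pp i K"
  by (simp add: pp_def adj_compose bounded_ops_adj adj_adj)

lemma pp_idem [simp]: "fpath i K \<Longrightarrow> pp i K o\<^sub>L pp i K = pp i K"
  unfolding pp_def by (metis blinfun_compose_assoc path_op_adj path_op_q)

text \<open>Different paths of equal length are not comparable.\<close>

lemma pp_orth:
  assumes K: "K \<in> level_paths m n" and L: "L \<in> level_paths m n" and ne: "K \<noteq> L"
  shows "lpp K o\<^sub>L lpp L = 0"
proof -
  note K = level_pathsD[OF K] and L = level_pathsD[OF L]
  have "adj (SP (tgt (last K)) K) o\<^sub>L SP (tgt (last L)) L = 0"
    using path_op_comparable[OF K(3) L(3)] K(2) L(2) ne by force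
  then show ?thesis unfolding pp_def by (metis blinfun_compose_assoc blinfun_compose_zero)
qed

text \<open>Relation (iii), inserted at the end of the path.\<close>

lemma pp_split:
  assumes K: "fpath i K"
  shows "pp i K = (\<Sum>e | e \<in> edges N A \<and> src e = i. pp (tgt e) (K @ [e]))"
proof -
  have i: "i \<in> V" using path_ending_at_vertices[OF K] .
  have "pp i K = SP i K o\<^sub>L q i o\<^sub>L adj (SP i K)" by (simp add: pp_def K path_op_q)
  also have "\<dots> = (\<Sum>e | e \<in> edges N A \<and> src e = i. SP i K o\<^sub>L (SE e o\<^sub>L adj (SE e)) o\<^sub>L adj (SP i K))"
    by (subst q_edge_sum[OF i]) (simp add: blinfun_compose_sum_left blinfun_compose_sum_right)
  also have "\<dots> = (\<Sum>e | e \<in> edges N A \<and> src e = i. pp (tgt e) (K @ [e]))"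
  proof (rule sum.cong[OF refl])
    fix e assume "e \<in> {e \<in> edges N A. src e = i}"
    then have e: "e \<in> edges N A" "src e = i" by auto
    have "SP (tgt e) (K @ [e]) = SP i K o\<^sub>L SE e"
      using path_op_append[of "tgt e" K "[e]"] e K path_op_Cons[of "tgt e" e "[]"] edge_op_simps(2)[OF e(1)] edgesD(2)[OF e(1)]
      by (simp add: path_ending_at_append)
    then show "SP i K o\<^sub>L (SE e o\<^sub>L adj (SE e)) o\<^sub>L adj (SP i K) = pp (tgt e) (K @ [e])"
      using e K by (simp add: pp_def adj_compose blinfun_compose_assoc)
  qed
  finally show ?thesis .
qed

text \<open>Integration of sampled values against the projection-valued measure of the family. As
  the projections of a level are orthogonal, this is a *-homomorphism on all functions, continuous
  or not.\<close>

definition step_rep :: "nat \<Rightarrow> nat \<Rightarrow> ((nat \<Rightarrow> edge) \<Rightarrow> complex) \<Rightarrow> ('h \<Rightarrow>\<^sub>L 'h)" where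
  "step_rep m n f = (\<Sum>K\<in>level_paths m n. op_scale (f (rep K)) (lpp K))"

lemma bounded_ops_sum: "(\<And>k. k \<in> F \<Longrightarrow> f k \<in> bounded_ops UNIV) \<Longrightarrow> sum f F \<in> bounded_ops UNIV"
  by (induction F rule: infinite_finite_induct) (auto intro: bounded_ops_add bounded_ops_zero)

lemma adj_sum: "(\<And>k. k \<in> F \<Longrightarrow> f k \<in> bounded_ops UNIV) \<Longrightarrow> adj (sum f F) = (\<Sum>k\<in>F. adj (f k))"
  by (induction F rule: infinite_finite_induct) (auto simp: adj_add bounded_ops_sum)

lemma lpp_ops: "K \<in> level_paths m n \<Longrightarrow> op_scale c (lpp K) \<in> bounded_ops UNIV"
  using level_pathsD(3) by (intro bounded_ops_scale pp_ops)

lemma step_rep_ops: "step_rep m n f \<in> bounded_ops UNIV"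
  unfolding step_rep_def by (intro bounded_ops_sum lpp_ops)

lemma step_rep_add: "step_rep m n (\<lambda>\<gamma>. f \<gamma> + g \<gamma>) = step_rep m n f + step_rep m n g"
  by (simp add: step_rep_def op_scale_add_left sum.distrib)

lemma step_rep_scale: "step_rep m n (\<lambda>\<gamma>. c * f \<gamma>) = op_scale c (step_rep m n f)"
  by (simp add: step_rep_def ops.scale_sum_right op_scale_op_scale)

lemma step_rep_adj: "step_rep m n (\<lambda>\<gamma>. cnj (f \<gamma>)) = adj (step_rep m n f)"
  unfolding step_rep_def
  by (subst adj_sum) (auto simp: lpp_ops adj_scale level_pathsD(3) intro!: sum.cong)

lemma step_rep_mult: "step_rep m n (\<lambda>\<gamma>. f \<gamma> * g \<gamma>) = step_rep m n f o\<^sub>L step_rep m n g"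
proof -
  have *: "op_scale (f (rep K)) (lpp K) o\<^sub>L op_scale (g (rep L)) (lpp L)
      = (if L = K then op_scale (f (rep K) * g (rep K)) (lpp K) else 0)"
    if "K \<in> level_paths m n" "L \<in> level_paths m n" for K L
    using pp_orth[OF that] level_pathsD(3)[OF that(1)] level_pathsD(3)[OF that(2)]
    by (auto simp: op_scale_compose_left op_scale_compose_right op_scale_op_scale)
  have "step_rep m n f o\<^sub>L step_rep m n g
      = (\<Sum>K\<in>level_paths m n. \<Sum>L\<in>level_paths m n. op_scale (f (rep K)) (lpp K) o\<^sub>L op_scale (g (rep L)) (lpp L))"
    by (simp only: step_rep_def blinfun_compose_sum_left) (simp only: blinfun_compose_sum_right)
  also have "\<dots> = (\<Sum>K\<in>level_paths m n. op_scale (f (rep K) * g (rep K)) (lpp K))"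
    using finite_level_paths by (simp add: * cong: sum.cong)
  finally show ?thesis by (simp add: step_rep_def)
qed

text \<open>The general norm estimate applies with all functions as the algebra, since no topology
  enters at a fixed level.\<close>

lemma step_rep_contractive:
  assumes "\<And>\<gamma>. cmod (f \<gamma>) \<le> M" "M \<ge> 0"
  shows "norm (step_rep m n f) \<le> M"
  by (rule star_rep_contractive[where F = UNIV and \<pi> = "step_rep m n" and f = f])
    (rule step_rep_ops step_rep_add step_rep_mult step_rep_scale step_rep_adj UNIV_I assms)+

text \<open>Subdividing a cylinder splits its projection accordingly, and a function of the earlier
  edges takes the old value at every new representative.\<close>

lemma step_rep_refine:
  assumes det: "\<And>\<gamma> \<delta>. \<gamma> \<in> X \<Longrightarrow> \<delta> \<in> X \<Longrightarrow> \<forall>k<Suc n. \<gamma> k = \<delta> k \<Longrightarrow> g \<gamma> = g \<delta>"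
  shows "step_rep m (Suc n) g = step_rep m n g"
proof -
  have "step_rep m (Suc n) g = (\<Sum>(K, e)\<in>(SIGMA K : level_paths m n. {e \<in> edges N A. src e = tgt (last K)}).
      op_scale (g (rep (K @ [e]))) (pp (tgt e) (K @ [e])))"
    unfolding step_rep_def
    by (subst sum.reindex_bij_betw[OF level_paths_Suc, symmetric]) (simp add: case_prod_unfold)
  also have "\<dots> = (\<Sum>(K, e)\<in>(SIGMA K : level_paths m n. {e \<in> edges N A. src e = tgt (last K)}).
      op_scale (g (rep K)) (pp (tgt e) (K @ [e])))"
  proof (rule sum.cong[OF refl])
    fix x assume "x \<in> (SIGMA K : level_paths m n. {e \<in> edges N A. src e = tgt (last K)})"
    then obtain K e where x: "x = (K, e)" and K: "K \<in> level_paths m n"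
      and e: "e \<in> edges N A" "src e = tgt (last K)" by (cases x) auto
    then have Ke: "K @ [e] \<in> level_paths m (Suc n)"
      using bij_betw_apply[OF level_paths_Suc[of m n], of "(K, e)"] by simp
    have "map (rep (K @ [e])) [0..<Suc n] = map (rep K) [0..<Suc n]"
      using rep_prefix[OF Ke, unfolded upt_Suc[of 0 "Suc n"]] rep_prefix[OF K] by simp
    then have "\<forall>k<Suc n. rep (K @ [e]) k = rep K k" unfolding map_upt_eq_iff .
    then have "g (rep (K @ [e])) = g (rep K)" using det rep_X[OF K] rep_X[OF Ke] by blast
    then show "(case x of (K, e) \<Rightarrow> op_scale (g (rep (K @ [e]))) (pp (tgt e) (K @ [e])))
        = (case x of (K, e) \<Rightarrow> op_scale (g (rep K)) (pp (tgt e) (K @ [e])))"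
      by (simp add: x)
  qed
  also have "\<dots> = (\<Sum>K\<in>level_paths m n. \<Sum>e\<in>{e \<in> edges N A. src e = tgt (last K)}. op_scale (g (rep K)) (pp (tgt e) (K @ [e])))"
  proof (rule sum.Sigma[symmetric])
    show "\<forall>K\<in>level_paths m n. finite {e \<in> edges N A. src e = tgt (last K)}"
      using finite_edges_from path_ending_at_vertices level_pathsD(3) by blast
  qed (rule finite_level_paths)
  also have "\<dots> = step_rep m n g"
    unfolding step_rep_def
    by (rule sum.cong[OF refl]) (simp add: pp_split[OF level_pathsD(3)] ops.scale_sum_right)
  finally show ?thesis .
qed

lemma step_rep_enlarge:
  assumes zero: "\<And>\<gamma>. \<gamma> \<in> X \<Longrightarrow> src (\<gamma> 0) > m \<Longrightarrow> g \<gamma> = 0"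
  shows "step_rep (Suc m) n g = step_rep m n g"
  unfolding step_rep_def
proof (rule sum.mono_neutral_right)
  show "level_paths m n \<subseteq> level_paths (Suc m) n" by (auto simp: level_paths_def)
  show "\<forall>K\<in>level_paths (Suc m) n - level_paths m n. op_scale (g (rep K)) (lpp K) = 0"
  proof
    fix K assume K: "K \<in> level_paths (Suc m) n - level_paths m n"
    then have "src (rep K 0) > m" using rep_src[of K "Suc m" n] by (auto simp: level_paths_def)
    then show "op_scale (g (rep K)) (lpp K) = 0" using zero rep_X[of K "Suc m" n] K by simp
  qed
qed (rule finite_level_paths)

lemma step_rep_stable:
  assumes det: "\<And>\<gamma> \<delta>. \<gamma> \<in> X \<Longrightarrow> \<delta> \<in> X \<Longrightarrow> \<forall>k<Suc n. \<gamma> k = \<delta> k \<Longrightarrow> g \<gamma> = g \<delta>"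
    and zero: "\<And>\<gamma>. \<gamma> \<in> X \<Longrightarrow> src (\<gamma> 0) > m \<Longrightarrow> g \<gamma> = 0" and le: "m \<le> m'" "n \<le> n'"
  shows "step_rep m' n' g = step_rep m n g"
proof -
  have "step_rep m n' g = step_rep m n g"
    using le(2)
  proof (induction rule: dec_induct)
    case (step k)
    have "step_rep m (Suc k) g = step_rep m k g"
    proof (rule step_rep_refine)
      fix \<gamma> \<delta> assume g: "\<gamma> \<in> X" "\<delta> \<in> X" and ag: "\<forall>j<Suc k. \<gamma> j = \<delta> j"
      have "\<forall>j<Suc n. \<gamma> j = \<delta> j" using ag step(1) by simp
      then show "g \<gamma> = g \<delta>" by (rule det[OF g])
    qed
    then show ?case using step(3) by (rule trans)
  qed simp
  moreover have "step_rep m' n' g = step_rep m n' g"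
    using le(1)
  proof (induction rule: dec_induct)
    case (step k)
    have "step_rep (Suc k) n' g = step_rep k n' g"
      by (rule step_rep_enlarge) (rule zero, use step(1) in auto)
    then show ?case using step(3) by (rule trans)
  qed simp
  ultimately show ?thesis by simp
qed

text \<open>A step function is constant on the cylinders of its level, and at their representatives
  it has the values of \<open>f\<close>.\<close>

lemma step_rep_step_fun:
  assumes "n \<le> m"
  shows "step_rep m m (step_fun n f) = step_rep n n f"
proof -
  have "step_rep m m (step_fun n f) = step_rep n n (step_fun n f)"
  proof (rule step_rep_stable)
    fix \<gamma> \<delta> assume g: "\<gamma> \<in> X" "\<delta> \<in> X" and ag: "\<forall>k<Suc n. \<gamma> k = \<delta> k"
    have m: "map \<gamma> [0..<Suc n] = map \<delta> [0..<Suc n]" unfolding map_upt_eq_iff by (rule ag)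
    have "\<gamma> 0 = \<delta> 0" using ag by simp
    then show "step_fun n f \<gamma> = step_fun n f \<delta>" by (simp only: step_fun_def m g)
  qed (use assms in \<open>auto simp: step_fun_def\<close>)
  also have "\<dots> = step_rep n n f" unfolding step_rep_def
  proof (rule sum.cong[OF refl])
    fix K assume K: "K \<in> level_paths n n"
    have "step_fun n f (rep K) = f (rep K)"
      unfolding step_fun_def rep_prefix[OF K] using rep_X[OF K] rep_src[OF K] level_pathsD(5)[OF K] by simp
    then show "op_scale (step_fun n f (rep K)) (lpp K) = op_scale (f (rep K)) (lpp K)" by simp
  qed
  finally show ?thesis .
qed

definition fun_rep :: "((nat \<Rightarrow> edge) \<Rightarrow> complex) \<Rightarrow> ('h \<Rightarrow>\<^sub>L 'h)" where
  "fun_rep f = lim (\<lambda>n. step_rep n n f)"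

lemma fun_rep_tendsto:
  assumes f: "f \<in> C0 XT"
  shows "(\<lambda>n. step_rep n n f) \<longlonglongrightarrow> fun_rep f"
proof -
  have "Cauchy (\<lambda>n. step_rep n n f)"
  proof (rule metric_CauchyI)
    fix e :: real assume e: "e > 0"
    then obtain n where la: "level_approx f n (e / 3)" using C0_level_approx[OF f, of "e / 3"] by auto
    \<comment> \<open>Both terms are samples at level \<open>m\<close>, of \<open>f\<close> and of
      its step function, so uniform closeness bounds their difference.\<close>
    have near: "norm (step_rep m m f - step_rep n n f) \<le> e / 3" if "n \<le> m" for m
    proof -
      have "step_rep m m (\<lambda>\<gamma>. f \<gamma> + (- 1) * step_fun n f \<gamma>) = step_rep m m f - step_rep n n f"
        using step_rep_step_fun[OF that, of f]
        by (simp only: step_rep_add step_rep_scale op_scale_minus_one) simp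
      moreover have "norm (step_rep m m (\<lambda>\<gamma>. f \<gamma> + (- 1) * step_fun n f \<gamma>)) \<le> e / 3"
        using step_fun_near[OF C0_zero_outside[OF f] la] e by (intro step_rep_contractive) auto
      ultimately show ?thesis by simp
    qed
    have "dist (step_rep k k f) (step_rep m m f) < e" if "n \<le> k" "n \<le> m" for k m
    proof -
      have "norm (step_rep k k f - step_rep m m f) \<le> norm (step_rep k k f - step_rep n n f) + norm (step_rep m m f - step_rep n n f)"
        using norm_triangle_ineq4[of "step_rep k k f - step_rep n n f" "step_rep m m f - step_rep n n f"] by simp
      then show ?thesis using near[OF that(1)] near[OF that(2)] e by (simp add: dist_norm)
    qed
    then show "\<exists>M. \<forall>m\<ge>M. \<forall>n\<ge>M. dist (step_rep m m f) (step_rep n n f) < e" by blast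
  qed
  then show ?thesis unfolding fun_rep_def using Cauchy_convergent convergent_LIMSEQ_iff by blast
qed

lemma fun_rep_closed:
  assumes "f \<in> C0 XT" "closed S" "\<And>n. step_rep n n f \<in> S"
  shows "fun_rep f \<in> S"
  by (rule closed_sequentially[OF assms(2,3) fun_rep_tendsto[OF assms(1)]])

lemma fun_rep_ops: "f \<in> C0 XT \<Longrightarrow> fun_rep f \<in> bounded_ops UNIV"
  by (rule fun_rep_closed) (auto intro: closed_bounded_ops step_rep_ops)

lemma fun_rep_unique:
  assumes "(\<lambda>n. step_rep n n f) \<longlonglongrightarrow> T"
  shows "fun_rep f = T"
  unfolding fun_rep_def by (rule limI[OF assms])

lemma fun_rep_add: "f \<in> C0 XT \<Longrightarrow> g \<in> C0 XT \<Longrightarrow> fun_rep (\<lambda>\<gamma>. f \<gamma> + g \<gamma>) = fun_rep f + fun_rep g"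
  by (rule fun_rep_unique) (simp add: step_rep_add tendsto_add fun_rep_tendsto)

lemma fun_rep_mult: "f \<in> C0 XT \<Longrightarrow> g \<in> C0 XT \<Longrightarrow> fun_rep (\<lambda>\<gamma>. f \<gamma> * g \<gamma>) = fun_rep f o\<^sub>L fun_rep g"
  by (rule fun_rep_unique) (simp add: step_rep_mult tendsto_compose fun_rep_tendsto)

lemma fun_rep_scale: "f \<in> C0 XT \<Longrightarrow> fun_rep (\<lambda>\<gamma>. c * f \<gamma>) = op_scale c (fun_rep f)"
  by (rule fun_rep_unique)
    (simp add: step_rep_scale bounded_linear.tendsto[OF bounded_linear_op_scale] fun_rep_tendsto)

lemma fun_rep_adj: "f \<in> C0 XT \<Longrightarrow> fun_rep (\<lambda>\<gamma>. cnj (f \<gamma>)) = adj (fun_rep f)"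
  by (rule fun_rep_unique)
    (simp add: step_rep_adj tendsto_adj fun_rep_tendsto step_rep_ops fun_rep_ops)

lemma fun_rep_contractive:
  assumes "f \<in> C0 XT" "\<And>\<gamma>. cmod (f \<gamma>) \<le> M" "M \<ge> 0"
  shows "norm (fun_rep f) \<le> M"
  by (rule LIMSEQ_le_const2[OF tendsto_norm[OF fun_rep_tendsto[OF assms(1)]]])
    (use assms step_rep_contractive in auto)

lemma fun_rep_contractive_linear: "contractive_linear W fun_rep"
  unfolding contractive_linear_def
  by (auto simp: fun_rep_add fun_rep_scale fun_rep_contractive)

lemma fun_rep_ind_nonempty:
  assumes J: "fpath i J" "J \<noteq> []"
  shows "fun_rep (ind (cyl i J)) = pp i J"
proof -
  have i: "i = tgt (last J)" using J fpath_last by blast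
  obtain n where n: "length J = Suc n" using J(2) by (cases J) auto
  \<comment> \<open>Large enough for \<open>J\<close> to belong to the level and for all later
    diagonal levels to lie beyond it; from there on the sequence is constant.\<close>
  define m where "m = max n (src (hd J))"
  have JL: "J \<in> level_paths m n" using J n i by (simp add: level_paths_def m_def)
  have "step_rep m n (ind (cyl i J)) = (\<Sum>K\<in>level_paths m n. if K = J then pp i J else 0)"
    unfolding step_rep_def
  proof (rule sum.cong[OF refl])
    fix K assume K: "K \<in> level_paths m n"
    have "rep K \<in> cyl i J \<longleftrightarrow> K = J"
      unfolding i lcyl_iff[OF JL] rep_prefix[OF K] using rep_X[OF K] by auto
    then show "op_scale (ind (cyl i J) (rep K)) (lpp K) = (if K = J then pp i J else 0)"
      by (simp add: ind_def i)
  qed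
  also have "\<dots> = pp i J" using JL finite_level_paths by simp
  finally have base: "step_rep m n (ind (cyl i J)) = pp i J" .
  have "step_rep k k (ind (cyl i J)) = pp i J" if "k \<ge> m" for k
    unfolding base[symmetric]
  proof (rule step_rep_stable)
    fix \<gamma> \<delta> assume g: "\<gamma> \<in> X" "\<delta> \<in> X" and ag: "\<forall>k<Suc n. \<gamma> k = \<delta> k"
    have m: "map \<gamma> [0..<Suc n] = map \<delta> [0..<Suc n]" unfolding map_upt_eq_iff by (rule ag)
    show "ind (cyl i J) \<gamma> = ind (cyl i J) \<delta>"
      by (simp only: ind_def i lcyl_iff[OF JL] g m)
  next
    fix \<gamma> assume "\<gamma> \<in> X" "m < src (\<gamma> 0)"
    then show "ind (cyl i J) \<gamma> = 0"
      using cyl_src[OF J(1), of \<gamma>] level_pathsD(4)[OF JL] by (auto simp: ind_def m_def)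
  qed (use that in \<open>auto simp: m_def\<close>)
  then have "(\<lambda>k. step_rep k k (ind (cyl i J))) \<longlonglongrightarrow> pp i J"
    by (intro tendsto_eventually eventually_sequentiallyI)
  then show ?thesis by (rule fun_rep_unique)
qed

text \<open>Levels contain no path of length zero, so a vertex is first split into its edges, on the
  function side and on the operator side.\<close>

lemma fun_rep_ind:
  assumes J: "fpath i J"
  shows "fun_rep (ind (cyl i J)) = pp i J"
proof (cases "J = []")
  case False
  then show ?thesis using J fun_rep_ind_nonempty by blast
next
  case True
  have i: "i \<in> V" using path_ending_at_vertices[OF J] .
  let ?E = "{e \<in> edges N A. src e = i}"
  have fin: "finite ?E" by (rule finite_edges_from[OF i])
  have e: "fpath (tgt e) [e]" if "e \<in> ?E" for e using that edgesD(2) by simp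
  have D: "ind (cyl (tgt e) [e]) \<in> C0_on UNIV" if "e \<in> ?E" for e
    using ind_cyl_C0[OF e[OF that]] by simp
  have "fun_rep (ind (cyl i J)) = (\<Sum>e\<in>?E. op_scale 1 (fun_rep (ind (cyl (tgt e) [e]))))"
    unfolding True ind_vertex[OF i] by (rule conjunct2[OF contractive_linear_sum[OF fun_rep_contractive_linear fin D]])
  also have "\<dots> = (\<Sum>e\<in>?E. pp (tgt e) [e])"
    by (rule sum.cong[OF refl]) (simp add: fun_rep_ind_nonempty[OF e] del: path_ending_at.simps)
  also have "\<dots> = pp i J" using pp_split[OF J] True by simp
  finally show ?thesis .
qed

lemma subspace_algebra: "ops.subspace KA"
  using algebra_cstar by (simp add: cstar_algebra_def)

lemma fun_rep_algebra:
  assumes "f \<in> C0 XT"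
  shows "fun_rep f \<in> KA"
proof (rule fun_rep_closed[OF assms])
  show "closed KA" using algebra_cstar by (simp add: cstar_algebra_def)
  show "step_rep n n f \<in> KA" for n
    unfolding step_rep_def
    by (intro ops.subspace_sum[OF subspace_algebra] ops.subspace_scale[OF subspace_algebra])
      (use semigroup_subset_algebra pp_semigroup level_pathsD(3) in blast)
qed

end


section \<open>Partial permutation operators\<close>

text \<open>The Cauchy criterion for unconditional sums in norm: expansions in an orthonormal family
  are in general not absolutely summable.\<close>

lemma summable_on_Cauchy:
  fixes f :: "'a \<Rightarrow> 'b::banach"
  assumes "\<And>e. e > 0 \<Longrightarrow> \<exists>F0. finite F0 \<and> F0 \<subseteq> D \<and>
    (\<forall>F. finite F \<and> F \<subseteq> D \<and> F \<inter> F0 = {} \<longrightarrow> norm (sum f F) < e)"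
  shows "f summable_on D"
proof -
  have "\<exists>P. eventually P (finite_subsets_at_top D) \<and> (\<forall>F F'. P F \<and> P F' \<longrightarrow> dist (sum f F) (sum f F') < d)"
    if d: "d > 0" for d
  proof -
    obtain F0 where F0: "finite F0" "F0 \<subseteq> D"
      "\<And>F. finite F \<Longrightarrow> F \<subseteq> D \<Longrightarrow> F \<inter> F0 = {} \<Longrightarrow> norm (sum f F) < d / 2"
      using assms[OF half_gt_zero[OF d]] by metis
    have near: "norm (sum f F - sum f F0) < d / 2" if "finite F" "F0 \<subseteq> F" "F \<subseteq> D" for F
    proof -
      have "sum f F - sum f F0 = sum f (F - F0)" using that by (simp add: sum_diff)
      then show ?thesis using F0(3)[of "F - F0"] that by auto
    qed
    have "eventually (\<lambda>F. finite F \<and> F0 \<subseteq> F \<and> F \<subseteq> D) (finite_subsets_at_top D)"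
      unfolding eventually_finite_subsets_at_top using F0(1,2) by blast
    moreover have "dist (sum f F) (sum f F') < d"
      if "finite F \<and> F0 \<subseteq> F \<and> F \<subseteq> D" "finite F' \<and> F0 \<subseteq> F' \<and> F' \<subseteq> D" for F F'
      using near[of F] near[of F'] that
        norm_triangle_ineq4[of "sum f F - sum f F0" "sum f F' - sum f F0"] by (simp add: dist_norm)
    ultimately show ?thesis
      by (intro exI[of _ "\<lambda>F. finite F \<and> F0 \<subseteq> F \<and> F \<subseteq> D"] conjI allI impI) auto
  qed
  then have "cauchy_filter (filtermap (sum f) (finite_subsets_at_top D))"
    by (simp add: cauchy_filter_metric_filtermap)
  moreover have "complete (UNIV :: 'b set)"
    by (meson Cauchy_convergent UNIV_I complete_def convergent_def)
  ultimately obtain L where "(sum f \<longlongrightarrow> L) (finite_subsets_at_top D)"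
    using complete_uniform[where S = UNIV] by (force simp: filterlim_def)
  then show ?thesis by (auto simp: summable_on_def has_sum_def)
qed

locale orthonormal =
  fixes Y :: "'x set" and b :: "'x \<Rightarrow> 'h::chilbert_space"
  assumes orthonormal: "x \<in> Y \<Longrightarrow> y \<in> Y \<Longrightarrow> cinner (b x) (b y) = (if x = y then 1 else 0)"
begin

definition pinj :: "'x set \<Rightarrow> ('x \<Rightarrow> 'x) \<Rightarrow> bool" where
  "pinj D f \<longleftrightarrow> D \<subseteq> Y \<and> f ` D \<subseteq> Y \<and> inj_on f D"

lemma pythagoras:
  assumes "finite F" "F \<subseteq> D" "pinj D f"
  shows "(norm (\<Sum>k\<in>F. c k *\<^sub>C b (f k)))\<^sup>2 = (\<Sum>k\<in>F. (cmod (c k))\<^sup>2)"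
proof -
  have "complex_of_real ((norm (\<Sum>k\<in>F. c k *\<^sub>C b (f k)))\<^sup>2)
      = (\<Sum>k\<in>F. \<Sum>l\<in>F. c k * cnj (c l) * cinner (b (f k)) (b (f l)))"
    by (simp only: cinner_self[symmetric] cinner_sum_left cinner_scaleC_left)
      (simp only: cinner_sum_right cinner_scaleC_right sum_distrib_left mult.assoc)
  also have "\<dots> = (\<Sum>k\<in>F. \<Sum>l\<in>F. if l = k then c k * cnj (c k) else 0)"
  proof (intro sum.cong refl)
    fix k l assume kl: "k \<in> F" "l \<in> F"
    then have "f k = f l \<longleftrightarrow> k = l" using assms inj_on_eq_iff[of f D k l] by (auto simp: pinj_def)
    moreover have "f k \<in> Y" "f l \<in> Y" using assms kl by (auto simp: pinj_def)
    ultimately show "c k * cnj (c l) * cinner (b (f k)) (b (f l)) = (if l = k then c k * cnj (c k) else 0)"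
      by (auto simp: orthonormal)
  qed
  also have "\<dots> = complex_of_real (\<Sum>k\<in>F. (cmod (c k))\<^sup>2)"
    using assms(1) by (simp only: of_real_sum complex_norm_square) simp
  finally show ?thesis using of_real_eq_iff by blast
qed

lemma pinj_id: "D \<subseteq> Y \<Longrightarrow> pinj D (\<lambda>x. x)"
  by (simp add: pinj_def)

lemma bessel:
  assumes "finite F" "F \<subseteq> Y"
  shows "(\<Sum>k\<in>F. (cmod (cinner x (b k)))\<^sup>2) \<le> (norm x)\<^sup>2"
proof -
  define p where "p = (\<Sum>k\<in>F. cinner x (b k) *\<^sub>C b k)"
  have np: "(norm p)\<^sup>2 = (\<Sum>k\<in>F. (cmod (cinner x (b k)))\<^sup>2)"
    unfolding p_def using pythagoras[of F Y "\<lambda>x. x"] assms pinj_id[of Y] by simp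
  have "cinner p x = (\<Sum>k\<in>F. cinner x (b k) * cnj (cinner x (b k)))"
    unfolding p_def by (simp add: cinner_sum_left cinner_scaleC_left cinner_commute[symmetric])
  also have "\<dots> = complex_of_real ((norm p)\<^sup>2)"
    unfolding np by (simp only: of_real_sum complex_norm_square)
  finally have "inner p x = (norm p)\<^sup>2" by (simp add: Re_cinner[symmetric])
  then have "0 \<le> (norm x)\<^sup>2 - (norm p)\<^sup>2"
    using zero_le_power2[of "norm (x - p)"]
    unfolding power2_norm_eq_inner by (simp add: inner_diff_left inner_diff_right inner_commute)
  then show ?thesis using np by simp
qed

lemma summable_perm:
  assumes "pinj D f"
  shows "(\<lambda>k. cinner x (b k) *\<^sub>C b (f k)) summable_on D"
proof (rule summable_on_Cauchy)
  fix e :: real assume e: "e > 0"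
  let ?g = "\<lambda>k. (cmod (cinner x (b k)))\<^sup>2"
  have DY: "D \<subseteq> Y" using assms by (simp add: pinj_def)
  have bdd: "bdd_above (sum ?g ` {F. F \<subseteq> D \<and> finite F})"
    using bessel DY by (intro bdd_aboveI[of _ "(norm x)\<^sup>2"]) (auto intro: subset_trans)
  \<comment> \<open>The supremum of the finite square sums: once \<open>F0\<close> comes within e^2
    of it, any disjoint finite set has less than e^2 left.\<close>
  define M where "M = Sup (sum ?g ` {F. F \<subseteq> D \<and> finite F})"
  have "M - e\<^sup>2 < M" using e by simp
  then obtain F0 where F0: "F0 \<subseteq> D" "finite F0" "M - e\<^sup>2 < sum ?g F0"
    using less_cSup_iff[OF _ bdd, of "M - e\<^sup>2"] unfolding M_def by auto
  have "norm (\<Sum>k\<in>F. cinner x (b k) *\<^sub>C b (f k)) < e" if F: "finite F" "F \<subseteq> D" "F \<inter> F0 = {}" for F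
  proof -
    have "sum ?g F + sum ?g F0 = sum ?g (F \<union> F0)" using F F0 by (simp add: sum.union_disjoint)
    also have "\<dots> \<le> M" unfolding M_def by (rule cSup_upper[OF _ bdd]) (use F F0 in auto)
    finally have "sum ?g F < e\<^sup>2" using F0 by simp
    then have "(norm (\<Sum>k\<in>F. cinner x (b k) *\<^sub>C b (f k)))\<^sup>2 < e\<^sup>2"
      using pythagoras[OF F(1,2) assms] by simp
    then show ?thesis using e by (simp add: power2_less_imp_less)
  qed
  then show "\<exists>F0. finite F0 \<and> F0 \<subseteq> D \<and>
      (\<forall>F. finite F \<and> F \<subseteq> D \<and> F \<inter> F0 = {} \<longrightarrow> norm (\<Sum>k\<in>F. cinner x (b k) *\<^sub>C b (f k)) < e)"
    using F0 by blast
qed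

text \<open>For \<open>pinj D f\<close> this is the partial isometry induced by a partial bijection
  of the basis.\<close>

definition W :: "'x set \<Rightarrow> ('x \<Rightarrow> 'x) \<Rightarrow> ('h \<Rightarrow>\<^sub>L 'h)" where
  "W D f = Blinfun (\<lambda>x. \<Sum>\<^sub>\<infinity>k\<in>D. cinner x (b k) *\<^sub>C b (f k))"

text \<open>Pythagoras and Bessel bound every partial sum by \<open>norm x\<close>, which makes the
  sum a bounded operator.\<close>

lemma W_has_sum:
  assumes p: "pinj D f"
  shows "((\<lambda>k. cinner x (b k) *\<^sub>C b (f k)) has_sum blinfun_apply (W D f) x) D"
proof -
  let ?T = "\<lambda>x. \<Sum>\<^sub>\<infinity>k\<in>D. cinner x (b k) *\<^sub>C b (f k)"
  have hs: "((\<lambda>k. cinner x (b k) *\<^sub>C b (f k)) has_sum ?T x) D" for x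
    by (intro has_sum_infsum summable_perm p)
  have "bounded_linear ?T"
  proof (rule bounded_linear_intro[of _ 1])
    fix x y
    have "((\<lambda>k. cinner (x + y) (b k) *\<^sub>C b (f k)) has_sum ?T x + ?T y) D"
      using has_sum_add[OF hs[of x] hs[of y]] by (simp add: cinner_add_left scaleC_add_left)
    then show "?T (x + y) = ?T x + ?T y" by (rule infsumI)
  next
    fix r x
    have "cinner (r *\<^sub>R x) (b k) *\<^sub>C b (f k) = r *\<^sub>R (cinner x (b k) *\<^sub>C b (f k))" for k
      by (metis cinner_scaleC_left scaleC_of_real scaleC_scaleC)
    then have "((\<lambda>k. cinner (r *\<^sub>R x) (b k) *\<^sub>C b (f k)) has_sum r *\<^sub>R ?T x) D"
      using has_sum_scaleR[OF hs[of x], of r] by simp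
    then show "?T (r *\<^sub>R x) = r *\<^sub>R ?T x" by (rule infsumI)
  next
    fix x
    have "(sum (\<lambda>k. cinner x (b k) *\<^sub>C b (f k)) \<longlongrightarrow> ?T x) (finite_subsets_at_top D)"
      using hs[of x] by (simp add: has_sum_def)
    then have lim: "((\<lambda>F. norm (\<Sum>k\<in>F. cinner x (b k) *\<^sub>C b (f k))) \<longlongrightarrow> norm (?T x)) (finite_subsets_at_top D)"
      by (rule tendsto_norm)
    have "norm (?T x) \<le> norm x"
    proof (rule tendsto_upperbound[OF lim])
      show "\<forall>\<^sub>F F in finite_subsets_at_top D. norm (\<Sum>k\<in>F. cinner x (b k) *\<^sub>C b (f k)) \<le> norm x"
      proof (rule eventually_finite_subsets_at_top_weakI)
        fix F assume F: "finite F" "F \<subseteq> D"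
        have "(norm (\<Sum>k\<in>F. cinner x (b k) *\<^sub>C b (f k)))\<^sup>2 \<le> (norm x)\<^sup>2"
          unfolding pythagoras[OF F p] using p F by (intro bessel) (auto simp: pinj_def)
        then show "norm (\<Sum>k\<in>F. cinner x (b k) *\<^sub>C b (f k)) \<le> norm x"
          by (rule power2_le_imp_le) simp
      qed
    qed simp
    then show "norm (?T x) \<le> norm x * 1" by simp
  qed
  then show ?thesis using hs[of x] by (simp add: W_def bounded_linear_Blinfun_apply)
qed

lemma W_ops: 
  assumes p: "pinj D f"
  shows "W D f \<in> bounded_ops UNIV"
  unfolding bounded_ops_UNIV
proof (intro allI)
  fix c x
  have "((\<lambda>k. cinner (c *\<^sub>C x) (b k) *\<^sub>C b (f k)) has_sum c *\<^sub>C blinfun_apply (W D f) x) D"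
    using has_sum_bounded_linear[OF bounded_linear_scaleC W_has_sum[OF p, of x], of c]
    by (simp add: cinner_scaleC_left scaleC_scaleC)
  then show "blinfun_apply (W D f) (c *\<^sub>C x) = c *\<^sub>C blinfun_apply (W D f) x"
    using W_has_sum[OF p] has_sum_unique by blast
qed

lemma W_basis:
  assumes p: "pinj D f" and i: "i \<in> Y"
  shows "blinfun_apply (W D f) (b i) = (if i \<in> D then b (f i) else 0)"
proof -
  have "((\<lambda>k. cinner (b i) (b k) *\<^sub>C b (f k)) has_sum (if i \<in> D then b (f i) else 0)) D"
  proof (rule has_sum_finite_neutralI[of "D \<inter> {i}"])
    show "cinner (b i) (b k) *\<^sub>C b (f k) = 0" if "k \<in> D - D \<inter> {i}" for k
      using that p i by (auto simp: orthonormal pinj_def subset_iff)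
    show "(if i \<in> D then b (f i) else 0) = (\<Sum>k\<in>D \<inter> {i}. cinner (b i) (b k) *\<^sub>C b (f k))"
      using i by (auto simp: orthonormal)
  qed auto
  then show ?thesis using W_has_sum[OF p] has_sum_unique by blast
qed

lemma W_cong: "(\<And>k. k \<in> D \<Longrightarrow> f k = g k) \<Longrightarrow> W D f = W D g"
  unfolding W_def by (intro arg_cong[of _ _ Blinfun] ext infsum_cong) simp

text \<open>Both inner products are the same series, once indexed by \<open>D\<close> and once by
  its image under \<open>f\<close>.\<close>

lemma W_adj:
  assumes p: "pinj D f" and inv: "\<And>k. k \<in> D \<Longrightarrow> g (f k) = k"
  shows "adj (W D f) = W (f ` D) g"
proof (rule adj_eqI)
  fix x y
  have p': "pinj (f ` D) g" using p inv by (auto simp: pinj_def inj_on_def)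
  have "((\<lambda>k. cinner x (b k) * cinner (b (f k)) y) has_sum cinner (blinfun_apply (W D f) x) y) D"
    using has_sum_bounded_linear[OF bounded_linear_cinner_left W_has_sum[OF p, of x], of y]
    by (simp add: cinner_scaleC_left)
  moreover have "((\<lambda>k. cinner x (b k) * cinner (b (f k)) y) has_sum cinner x (blinfun_apply (W (f ` D) g) y)) D"
  proof -
    have "((\<lambda>m. cnj (cinner (cinner y (b m) *\<^sub>C b (g m)) x)) has_sum
        cnj (cinner (blinfun_apply (W (f ` D) g) y) x)) (f ` D)"
      by (intro has_sum_bounded_linear[OF bounded_linear_cnj]
          has_sum_bounded_linear[OF bounded_linear_cinner_left] W_has_sum[OF p'])
    then have "((\<lambda>m. cinner x (cinner y (b m) *\<^sub>C b (g m))) has_sum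
        cinner x (blinfun_apply (W (f ` D) g) y)) (f ` D)"
      by (simp only: cinner_commute[symmetric])
    then have "((\<lambda>m. cinner (b m) y * cinner x (b (g m))) has_sum
        cinner x (blinfun_apply (W (f ` D) g) y)) (f ` D)"
      by (simp only: cinner_scaleC_right cinner_commute[symmetric])
    then have "(((\<lambda>m. cinner (b m) y * cinner x (b (g m))) \<circ> f) has_sum
        cinner x (blinfun_apply (W (f ` D) g) y)) D"
      using has_sum_reindex p unfolding pinj_def by blast
    then show ?thesis
      by (rule has_sum_cong[THEN iffD1, rotated]) (simp add: inv)
  qed
  ultimately show "cinner (blinfun_apply (W D f) x) y = cinner x (blinfun_apply (W (f ` D) g) y)"
    by (rule has_sum_unique)
qed

text \<open>The outer operator is continuous and can be applied to the series of the inner one term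
  by term.\<close>

lemma W_compose:
  assumes p: "pinj D f" and p': "pinj E g"
  shows "W D f o\<^sub>L W E g = W {k \<in> E. g k \<in> D} (\<lambda>k. f (g k))"
proof (rule blinfun_eqI)
  fix x
  let ?E = "{k \<in> E. g k \<in> D}"
  have p2: "pinj ?E (\<lambda>k. f (g k))"
    using p p' unfolding pinj_def by (auto simp: inj_on_def)
  have "((\<lambda>k. blinfun_apply (W D f) (cinner x (b k) *\<^sub>C b (g k))) has_sum
      blinfun_apply (W D f) (blinfun_apply (W E g) x)) E"
    by (intro has_sum_bounded_linear[OF blinfun.bounded_linear_right] W_has_sum p')
  moreover have "blinfun_apply (W D f) (cinner x (b k) *\<^sub>C b (g k))
      = (if k \<in> ?E then cinner x (b k) *\<^sub>C b (f (g k)) else 0)" if "k \<in> E" for k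
  proof -
    have "blinfun_apply (W D f) (cinner x (b k) *\<^sub>C b (g k)) = cinner x (b k) *\<^sub>C blinfun_apply (W D f) (b (g k))"
      using W_ops[OF p] by (simp add: bounded_ops_UNIV)
    moreover have "g k \<in> Y" using that p' by (auto simp: pinj_def)
    ultimately show ?thesis using that by (simp add: W_basis[OF p])
  qed
  ultimately have "((\<lambda>k. if k \<in> ?E then cinner x (b k) *\<^sub>C b (f (g k)) else 0) has_sum
      blinfun_apply (W D f) (blinfun_apply (W E g) x)) E"
    by (simp cong: has_sum_cong)
  then have "((\<lambda>k. cinner x (b k) *\<^sub>C b (f (g k))) has_sum
      blinfun_apply (W D f) (blinfun_apply (W E g) x)) ?E"
    by (rule has_sum_cong_neutral[THEN iffD1, rotated 3]) auto
  then show "blinfun_apply (W D f o\<^sub>L W E g) x = blinfun_apply (W ?E (\<lambda>k. f (g k))) x"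
    using has_sum_unique[OF W_has_sum[OF p2, of x]] by simp
qed

lemma W_union:
  assumes "finite F" "\<And>k. k \<in> F \<Longrightarrow> D k \<subseteq> Y" "\<And>k l. k \<in> F \<Longrightarrow> l \<in> F \<Longrightarrow> k \<noteq> l \<Longrightarrow> D k \<inter> D l = {}"
  shows "W (\<Union>k\<in>F. D k) (\<lambda>x. x) = (\<Sum>k\<in>F. W (D k) (\<lambda>x. x))"
  using assms
proof (induction F)
  case empty
  show ?case by (rule blinfun_eqI) (simp add: W_def bounded_linear_Blinfun_apply)
next
  case (insert k F)
  have IH: "W (\<Union>k\<in>F. D k) (\<lambda>x. x) = (\<Sum>k\<in>F. W (D k) (\<lambda>x. x))" using insert by auto
  have p: "pinj (D k) (\<lambda>x. x)" "pinj (\<Union>k\<in>F. D k) (\<lambda>x. x)" "pinj (\<Union>k\<in>insert k F. D k) (\<lambda>x. x)"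
    using insert.prems(1) by (auto intro!: pinj_id)
  have disj: "D k \<inter> (\<Union>k\<in>F. D k) = {}" using insert by blast
  have "W (\<Union>k\<in>insert k F. D k) (\<lambda>x. x) = W (D k) (\<lambda>x. x) + W (\<Union>k\<in>F. D k) (\<lambda>x. x)"
  proof (rule blinfun_eqI)
    fix x
    have "((\<lambda>k. cinner x (b k) *\<^sub>C b k) has_sum
        blinfun_apply (W (D k) (\<lambda>x. x)) x + blinfun_apply (W (\<Union>k\<in>F. D k) (\<lambda>x. x)) x) (\<Union>k\<in>insert k F. D k)"
      using has_sum_Un_disjoint[OF W_has_sum[OF p(1), of x] W_has_sum[OF p(2), of x] disj] by simp
    then show "blinfun_apply (W (\<Union>k\<in>insert k F. D k) (\<lambda>x. x)) x =
        blinfun_apply (W (D k) (\<lambda>x. x) + W (\<Union>k\<in>F. D k) (\<lambda>x. x)) x"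
      using has_sum_unique[OF W_has_sum[OF p(3), of x]] by (simp add: blinfun.add_left)
  qed
  then show ?case using insert IH by simp
qed

end


section \<open>The representation on an orbit of paths\<close>

text \<open>Stability under shift, prefixing and the action lets the generators and their adjoints
  move basis vectors to basis vectors or kill them.\<close>

locale path_orbit = katsura_data N A B + orthonormal Y b
  for N :: enat and A :: "nat \<Rightarrow> nat \<Rightarrow> nat" and B :: "nat \<Rightarrow> nat \<Rightarrow> int"
    and Y :: "(nat \<Rightarrow> edge) set" and b :: "(nat \<Rightarrow> edge) \<Rightarrow> 'h::chilbert_space" +
  assumes Y_X: "Y \<subseteq> X"
    and Y_act: "\<gamma> \<in> Y \<Longrightarrow> u_act A B t \<gamma> \<in> Y"
    and Y_shift: "\<gamma> \<in> Y \<Longrightarrow> shift n \<gamma> \<in> Y"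
    and Y_prepend: "\<gamma> \<in> Y \<Longrightarrow> fpath (src (\<gamma> 0)) J \<Longrightarrow> prepend J \<gamma> \<in> Y"
begin

abbreviation "act \<equiv> u_act A B"

definition from_vertex :: "nat \<Rightarrow> (nat \<Rightarrow> edge) set" where
  "from_vertex i = {\<gamma> \<in> Y. src (\<gamma> 0) = i}"

lemma from_vertex_iff: "\<gamma> \<in> from_vertex i \<longleftrightarrow> \<gamma> \<in> Y \<and> src (\<gamma> 0) = i"
  by (simp add: from_vertex_def)

text \<open>The index \<open>n\<close> ranges over all integers, so it is reduced to a digit while
  the quotient acts on the remaining path, as in \<open>form_s\<close>.\<close>

definition add_edge :: "nat \<Rightarrow> nat \<Rightarrow> int \<Rightarrow> (nat \<Rightarrow> edge) \<Rightarrow> (nat \<Rightarrow> edge)" where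
  "add_edge i j n \<gamma> = prepend [(i, j, (n - 1) mod int (A i j) + 1)] (act ((n - 1) div int (A i j)) \<gamma>)"

definition "oq i = W (from_vertex i) (\<lambda>\<gamma>. \<gamma>)"
definition "ou i = W (from_vertex i) (act 1)"
definition "os i j n = W (from_vertex j) (add_edge i j n)"

lemma act_inverse: "\<gamma> \<in> Y \<Longrightarrow> act (- t) (act t \<gamma>) = \<gamma>" "\<gamma> \<in> Y \<Longrightarrow> act t (act (- t) \<gamma>) = \<gamma>"
  using Y_X by (auto simp: u_act_add u_act_0 subset_iff)

lemma pinj_act: "pinj (from_vertex i) (act t)"
  unfolding pinj_def using Y_act act_inverse(1)[of _ t]
  by (auto simp: from_vertex_iff intro!: inj_on_inverseI[where g = "act (- t)"])

lemma act_image: "act t ` from_vertex i = from_vertex i"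
proof
  show "from_vertex i \<subseteq> act t ` from_vertex i"
  proof
    fix \<gamma> assume "\<gamma> \<in> from_vertex i"
    then have "act (- t) \<gamma> \<in> from_vertex i" "\<gamma> = act t (act (- t) \<gamma>)"
      using Y_act act_inverse by (auto simp: from_vertex_iff)
    then show "\<gamma> \<in> act t ` from_vertex i" by blast
  qed
qed (use Y_act in \<open>auto simp: from_vertex_iff\<close>)

lemma pinj_from: "pinj (from_vertex i) (\<lambda>\<gamma>. \<gamma>)"
  by (rule pinj_id) (auto simp: from_vertex_iff)

lemma edge_mod:
  assumes ij: "(i, j) \<in> Omega N A"
  shows "(i, j, n mod int (A i j) + 1) \<in> edges N A"
proof -
  have pos: "int (A i j) > 0" using ij by (auto simp: Omega_def)
  show ?thesis using pos_mod_bound[OF pos, of n] pos_mod_sign[OF pos, of n] ij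
    by (auto simp: edges_def)
qed

lemma add_edge_Y:
  assumes ij: "(i, j) \<in> Omega N A" and g: "\<gamma> \<in> from_vertex j"
  shows "add_edge i j n \<gamma> \<in> from_vertex i"
proof -
  have "fpath j [(i, j, (n - 1) mod int (A i j) + 1)]" using edge_mod[OF ij] by simp
  then show ?thesis using Y_prepend[OF Y_act] g unfolding add_edge_def from_vertex_iff
    by (auto simp del: path_ending_at.simps)
qed

definition drop_edge :: "nat \<Rightarrow> nat \<Rightarrow> int \<Rightarrow> (nat \<Rightarrow> edge) \<Rightarrow> (nat \<Rightarrow> edge)" where
  "drop_edge i j n \<gamma> = act (- ((n - 1) div int (A i j))) (shift 1 \<gamma>)"

lemma drop_add_edge: "\<gamma> \<in> Y \<Longrightarrow> drop_edge i j n (add_edge i j n \<gamma>) = \<gamma>"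
  using shift_prepend[of "[(i, j, (n - 1) mod int (A i j) + 1)]"]
  by (simp add: drop_edge_def add_edge_def act_inverse)

lemma pinj_add_edge:
  assumes ij: "(i, j) \<in> Omega N A"
  shows "pinj (from_vertex j) (add_edge i j n)"
  unfolding pinj_def
proof (intro conjI)
  show "from_vertex j \<subseteq> Y" by (auto simp: from_vertex_iff)
  show "add_edge i j n ` from_vertex j \<subseteq> Y" using add_edge_Y[OF ij] by (auto simp: from_vertex_iff)
  show "inj_on (add_edge i j n) (from_vertex j)"
    by (rule inj_on_inverseI[where g = "drop_edge i j n"]) (auto simp: from_vertex_iff drop_add_edge)
qed

lemma adj_ou: "adj (ou i) = W (from_vertex i) (act (- 1))"
  unfolding ou_def using W_adj[OF pinj_act, of i "act (- 1)" 1] act_inverse(1)[of _ 1]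
  by (auto simp: act_image from_vertex_iff)

lemma adj_os: 
  assumes ij: "(i, j) \<in> Omega N A"
  shows "adj (os i j n) = W (add_edge i j n ` from_vertex j) (drop_edge i j n)"
  unfolding os_def by (rule W_adj[OF pinj_add_edge[OF ij]]) (auto simp: from_vertex_iff drop_add_edge)

lemma pinj_drop_edge:
  assumes ij: "(i, j) \<in> Omega N A"
  shows "pinj (add_edge i j n ` from_vertex j) (drop_edge i j n)"
  using pinj_add_edge[OF ij, of n] drop_add_edge
  unfolding pinj_def by (auto simp: inj_on_def from_vertex_iff)

lemma W_compose_eq:
  assumes "pinj D f" "pinj E g" "{k \<in> E. g k \<in> D} = F" "\<And>k. k \<in> F \<Longrightarrow> f (g k) = h k"
  shows "W D f o\<^sub>L W E g = W F h"
  using W_compose[OF assms(1,2)] W_cong[of F "\<lambda>k. f (g k)" h] assms(3,4) by simp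

lemma W_empty: "W {} f = 0"
  by (rule blinfun_eqI) (simp add: W_def bounded_linear_Blinfun_apply)

text \<open>For an index in the range of an edge the quotient is 0, and the map is plain
  prefixing.\<close>

lemma range_add_edge:
  assumes ij: "(i, j) \<in> Omega N A" and n: "1 \<le> n" "n \<le> int (A i j)"
  shows "add_edge i j n ` from_vertex j = {\<gamma> \<in> Y. \<gamma> 0 = (i, j, n)}"
proof (intro equalityI subsetI)
  have m: "(n - 1) mod int (A i j) + 1 = n" "(n - 1) div int (A i j) = 0" using n by auto
  fix \<gamma> assume "\<gamma> \<in> add_edge i j n ` from_vertex j"
  then obtain \<delta> where d: "\<delta> \<in> from_vertex j" "\<gamma> = add_edge i j n \<delta>" by blast
  then have "\<gamma> \<in> Y" using add_edge_Y[OF ij] by (simp add: from_vertex_iff)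
  then show "\<gamma> \<in> {\<gamma> \<in> Y. \<gamma> 0 = (i, j, n)}" by (simp add: d(2) add_edge_def m)
next
  have m: "(n - 1) mod int (A i j) + 1 = n" "(n - 1) div int (A i j) = 0" using n by auto
  fix \<gamma> assume "\<gamma> \<in> {\<gamma> \<in> Y. \<gamma> 0 = (i, j, n)}"
  then have g: "\<gamma> \<in> Y" "\<gamma> 0 = (i, j, n)" by auto
  have s: "shift 1 \<gamma> \<in> from_vertex j"
    using Y_shift[OF g(1), of 1] X_tgt[of \<gamma> 0] g Y_X by (auto simp: from_vertex_iff)
  have "\<gamma> = prepend (map \<gamma> [0..<1]) (shift 1 \<gamma>)" by simp
  also have "map \<gamma> [0..<1] = [(i, j, n)]" using g by (simp add: upt_Suc)
  also have "prepend [(i, j, n)] (shift 1 \<gamma>) = add_edge i j n (shift 1 \<gamma>)"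
    using u_act_0[of "shift 1 \<gamma>" N A B] s Y_X by (auto simp: add_edge_def m from_vertex_iff)
  finally show "\<gamma> \<in> add_edge i j n ` from_vertex j" using s by blast
qed

lemma os_range:
  assumes ij: "(i, j) \<in> Omega N A" and n: "1 \<le> n" "n \<le> int (A i j)"
  shows "os i j n o\<^sub>L adj (os i j n) = W {\<gamma> \<in> Y. \<gamma> 0 = (i, j, n)} (\<lambda>\<gamma>. \<gamma>)"
  unfolding adj_os[OF ij] unfolding os_def range_add_edge[OF ij n, symmetric]
  by (rule W_compose_eq[OF pinj_add_edge[OF ij] pinj_drop_edge[OF ij]])
    (auto simp: from_vertex_iff drop_add_edge)

lemma orbit_family: "katsura_family N A B oq ou os"
  unfolding katsura_family_def
proof (intro conjI ballI allI, goal_cases)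
  case (1 i) show ?case unfolding oq_def by (rule W_ops[OF pinj_from])
next
  case (2 i) show ?case unfolding ou_def by (rule W_ops[OF pinj_act])
next
  case (3 x) then show ?case unfolding os_def by (auto intro: W_ops pinj_add_edge)
next
  case (4 i)
  have "adj (oq i) = oq i" unfolding oq_def using W_adj[OF pinj_from, of i "\<lambda>\<gamma>. \<gamma>"] by simp
  moreover have "oq i o\<^sub>L oq i = oq i" unfolding oq_def
    by (rule W_compose_eq[OF pinj_from pinj_from]) auto
  ultimately show ?case by (simp add: is_projection_def)
next
  case (5 i j)
  show ?case
  proof
    assume "i \<noteq> j"
    then have "oq i o\<^sub>L oq j = W {} (\<lambda>\<gamma>. \<gamma>)" unfolding oq_def
      by (intro W_compose_eq[OF pinj_from pinj_from]) (auto simp: from_vertex_iff)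
    then show "oq i o\<^sub>L oq j = 0" by (simp add: W_empty)
  qed
next
  case (6 i)
  show ?case unfolding adj_ou unfolding ou_def oq_def
    by (rule W_compose_eq[OF pinj_act pinj_act])
      (use act_image[of "- 1" i] act_inverse in \<open>auto simp: from_vertex_iff\<close>)
next
  case (7 i)
  show ?case unfolding adj_ou unfolding ou_def oq_def
    by (rule W_compose_eq[OF pinj_act pinj_act])
      (use act_image[of 1 i] act_inverse in \<open>auto simp: from_vertex_iff\<close>)
next
  case (8 x)
  have "partial_isometry (os i j n)" if ij: "(i, j) \<in> Omega N A" for i j n
  proof -
    have "adj (os i j n) o\<^sub>L os i j n = oq j" unfolding adj_os[OF ij] unfolding os_def oq_def
      by (rule W_compose_eq[OF pinj_drop_edge[OF ij] pinj_add_edge[OF ij]])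
        (auto simp: from_vertex_iff drop_add_edge)
    moreover have "os i j n o\<^sub>L oq j = os i j n" unfolding os_def oq_def
      by (rule W_compose_eq[OF pinj_add_edge[OF ij] pinj_from]) auto
    ultimately show ?thesis by (simp add: partial_isometry_def blinfun_compose_assoc)
  qed
  then show ?case using 8 by auto
next
  case (9 x)
  have "os i j n o\<^sub>L ou j = os i j (n + int (A i j)) \<and> ou i o\<^sub>L os i j n = os i j (n + B i j)"
    if ij: "(i, j) \<in> Omega N A" for i j n
  proof
    have a: "int (A i j) \<noteq> 0" using ij by (auto simp: Omega_def)
    show "os i j n o\<^sub>L ou j = os i j (n + int (A i j))"
      unfolding os_def ou_def
    proof (rule W_compose_eq[OF pinj_add_edge[OF ij] pinj_act])
      show "{k \<in> from_vertex j. act 1 k \<in> from_vertex j} = from_vertex j"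
        using Y_act by (auto simp: from_vertex_iff)
      fix \<gamma> assume "\<gamma> \<in> from_vertex j"
      then have g: "\<gamma> \<in> X" using Y_X by (auto simp: from_vertex_iff)
      have eq: "n + int (A i j) - 1 = (n - 1) + int (A i j)" by simp
      have "(n + int (A i j) - 1) mod int (A i j) = (n - 1) mod int (A i j)"
        "(n + int (A i j) - 1) div int (A i j) = (n - 1) div int (A i j) + 1"
        unfolding eq using a by simp_all
      then show "add_edge i j n (act 1 \<gamma>) = add_edge i j (n + int (A i j)) \<gamma>"
        using g by (simp add: add_edge_def u_act_add)
    qed
    show "ou i o\<^sub>L os i j n = os i j (n + B i j)"
      unfolding os_def ou_def
    proof (rule W_compose_eq[OF pinj_act pinj_add_edge[OF ij]])
      show "{k \<in> from_vertex j. add_edge i j n k \<in> from_vertex i} = from_vertex j"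
        using add_edge_Y[OF ij] by auto
      fix \<gamma> assume "\<gamma> \<in> from_vertex j"
      then have g: "\<gamma> \<in> X" using Y_X by (auto simp: from_vertex_iff)
      have m: "((n - 1) mod int (A i j) + B i j) mod int (A i j) = (n + B i j - 1) mod int (A i j)"
        unfolding mod_add_left_eq by (simp add: algebra_simps)
      \<comment> \<open>Changing the digit by \<open>B i j\<close> and dividing again agrees with a
        single division of n + B - 1; the quotients add up.\<close>
      have "((n - 1) mod int (A i j) + B i j) div int (A i j) + (n - 1) div int (A i j)
          = ((n - 1) mod int (A i j) + B i j + (n - 1) div int (A i j) * int (A i j)) div int (A i j)"
        by (subst div_mult_self1[OF a]) (rule add.commute)
      also have "(n - 1) mod int (A i j) + B i j + (n - 1) div int (A i j) * int (A i j) = n + B i j - 1"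
        by (simp add: algebra_simps)
      finally show "act 1 (add_edge i j n \<gamma>) = add_edge i j (n + B i j) \<gamma>"
        using g m by (simp add: add_edge_def u_act_prepend u_act_add algebra_simps)
    qed
  qed
  then show ?case using 9 by auto
next
  case (10 x)
  have "adj (os i j n) o\<^sub>L os i j n = oq j" if ij: "(i, j) \<in> Omega N A" for i j n
    unfolding adj_os[OF ij] unfolding os_def oq_def
    by (rule W_compose_eq[OF pinj_drop_edge[OF ij] pinj_add_edge[OF ij]])
      (auto simp: from_vertex_iff drop_add_edge)
  then show ?case using 10 by auto
next
  case (11 i)
  let ?E = "{e \<in> edges N A. src e = i}"
  let ?D = "\<lambda>e. {\<gamma> \<in> Y. \<gamma> 0 = e}"
  \<comment> \<open>Paths from \<open>i\<close> are partitioned by their first edge; this is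
    relation (iii) on the basis.\<close>
  have "from_vertex i = (\<Union>e\<in>?E. ?D e)"
    using Y_X X_edges by (auto simp: from_vertex_iff)
  then have "oq i = (\<Sum>e\<in>?E. W (?D e) (\<lambda>\<gamma>. \<gamma>))"
    unfolding oq_def by (simp only:) (rule W_union, use finite_edges_from[OF 11] in auto)
  also have "\<dots> = (\<Sum>e\<in>?E. edge_op os e o\<^sub>L adj (edge_op os e))"
    by (rule sum.cong) (auto simp: edges_def edge_op_def os_range)
  also have "\<dots> = (\<Sum>j | (i, j) \<in> Omega N A. \<Sum>n\<in>{1..int (A i j)}. os i j n o\<^sub>L adj (os i j n))"
    unfolding edge_sum[OF 11, symmetric, of "\<lambda>e. edge_op os e o\<^sub>L adj (edge_op os e)"]
    by (simp add: edge_op_def)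
  finally show ?case .
qed

sublocale orb: katsura_fam N A B oq ou os
  by unfold_locales (rule orbit_family)

lemma U_basis:
  assumes i: "i \<in> V" and g: "\<gamma> \<in> Y"
  shows "blinfun_apply (u_pow oq ou i t) (b \<gamma>) = (if src (\<gamma> 0) = i then b (act t \<gamma>) else 0)"
proof (induction t rule: int_induct[where k = 0])
  case base
  show ?case unfolding orb.U_0
    using g Y_X by (auto simp: oq_def W_basis[OF pinj_from] from_vertex_iff u_act_0)
next
  case (step1 t)
  have "blinfun_apply (u_pow oq ou i (t + 1)) (b \<gamma>) = blinfun_apply (ou i) (blinfun_apply (u_pow oq ou i t) (b \<gamma>))"
    by (simp add: orb.U_Suc[OF i, symmetric])
  moreover have "blinfun_apply (ou i) (b \<delta>) = (if src (\<delta> 0) = i then b (act 1 \<delta>) else 0)" if "\<delta> \<in> Y" for \<delta>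
    using that by (simp add: ou_def W_basis[OF pinj_act] from_vertex_iff)
  moreover have "act 1 (act t \<gamma>) = act (t + 1) \<gamma>" using g Y_X by (auto simp: u_act_add add.commute)
  ultimately show ?case using Y_act[OF g] by (simp add: step1)
next
  case (step2 t)
  have "blinfun_apply (u_pow oq ou i (t - 1)) (b \<gamma>) = blinfun_apply (adj (ou i)) (blinfun_apply (u_pow oq ou i t) (b \<gamma>))"
    by (simp add: orb.U_pred[OF i, symmetric])
  then show ?case using g Y_X Y_act[OF g]
    by (auto simp: step2 adj_ou W_basis[OF pinj_act] from_vertex_iff u_act_add)
qed

lemma edge_basis:
  assumes e: "e \<in> edges N A" and g: "\<gamma> \<in> Y" "src (\<gamma> 0) = tgt e"
  shows "blinfun_apply (edge_op os e) (b \<gamma>) = b (prepend [e] \<gamma>)"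
proof -
  obtain i j n where ijn: "e = (i, j, n)" by (cases e)
  have ij: "(i, j) \<in> Omega N A" and n: "(n - 1) mod int (A i j) + 1 = n" "(n - 1) div int (A i j) = 0"
    using e by (auto simp: ijn edges_def)
  show ?thesis using g Y_X
    by (auto simp: ijn edge_op_def os_def W_basis[OF pinj_add_edge[OF ij]] from_vertex_iff add_edge_def n u_act_0 subset_iff)
qed

lemma path_basis:
  assumes J: "fpath i J" and g: "\<gamma> \<in> Y" "src (\<gamma> 0) = i"
  shows "blinfun_apply (path_op oq os i J) (b \<gamma>) = b (prepend J \<gamma>)"
  using J
proof (induction J)
  case Nil
  then show ?case using g by (simp add: oq_def W_basis[OF pinj_from] from_vertex_iff)
next
  case (Cons e J)
  then have e: "e \<in> edges N A" "tgt e = path_src i J" "fpath i J" by (auto simp: path_ending_at_Cons)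
  have Y': "prepend J \<gamma> \<in> Y" "src (prepend J \<gamma> 0) = path_src i J"
    using Y_prepend prepend_X(2)[OF e(3)] g e Y_X by auto
  have "blinfun_apply (path_op oq os i (e # J)) (b \<gamma>) = blinfun_apply (edge_op os e) (b (prepend J \<gamma>))"
    using Cons.IH[OF e(3)] by (simp add: orb.path_op_Cons[OF Cons.prems])
  also have "\<dots> = b (prepend [e] (prepend J \<gamma>))" using edge_basis[OF e(1) Y'(1)] Y'(2) e(2) by simp
  finally show ?case by (simp add: prepend_append[symmetric])
qed

text \<open>The basis vector of \<open>\<gamma>\<close> is itself obtained by applying the operator
  of its prefix \<open>K\<close>, which has the length of \<open>J\<close>. Paths of equal length
  either coincide, and cancel, or have orthogonal ranges.\<close>

lemma adj_path_basis:
  assumes J: "fpath i J" and g: "\<gamma> \<in> Y"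
  shows "blinfun_apply (adj (path_op oq os i J)) (b \<gamma>) = (if \<gamma> \<in> cyl i J then b (shift (length J) \<gamma>) else 0)"
proof -
  have gX: "\<gamma> \<in> X" using g Y_X by blast
  define K where "K = map \<gamma> [0..<length J]"
  define k where "k = src (\<gamma> (length J))"
  define \<delta> where "\<delta> = shift (length J) \<gamma>"
  have K: "fpath k K" unfolding K_def k_def by (rule X_prefix_path[OF gX])
  have d: "\<delta> \<in> Y" "src (\<delta> 0) = k" using Y_shift[OF g] by (auto simp: \<delta>_def k_def)
  have gd: "\<gamma> = prepend K \<delta>" by (simp add: K_def \<delta>_def)
  then have bg: "b \<gamma> = blinfun_apply (path_op oq os k K) (b \<delta>)" using path_basis[OF K d] by simp
  show ?thesis
  proof (cases "\<gamma> \<in> cyl i J")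
    case True
    then have JK: "J = K" "i = k"
      unfolding cyl_iff[OF J] K_def k_def by (auto intro: nth_equalityI)
    have "blinfun_apply (adj (path_op oq os i J)) (b \<gamma>) = blinfun_apply (adj (path_op oq os i J) o\<^sub>L path_op oq os i J) (b \<delta>)"
      by (simp add: bg JK)
    also have "\<dots> = blinfun_apply (oq i) (b \<delta>)" by (simp only: orb.path_op_adj[OF J])
    also have "\<dots> = b \<delta>" using d JK by (simp add: oq_def W_basis[OF pinj_from] from_vertex_iff)
    finally show ?thesis using True by (simp add: \<delta>_def)
  next
    case False
    have "adj (path_op oq os i J) o\<^sub>L path_op oq os k K = 0"
    proof (rule ccontr)
      assume "adj (path_op oq os i J) o\<^sub>L path_op oq os k K \<noteq> 0"
      moreover have "length K = length J" by (simp add: K_def)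
      ultimately have "J = K \<and> i = k" using orb.path_op_comparable[OF J K] by auto
      then have JK: "J = K" "i = k" by auto
      have "\<gamma> m = J ! m" if "m < length J" for m using that by (subst JK(1)) (simp add: K_def)
      then have "\<gamma> \<in> cyl i J" unfolding cyl_iff[OF J] using gX JK(2) by (simp add: k_def)
      then show False using False by blast
    qed
    then show ?thesis using False by (simp add: bg flip: blinfun_apply_blinfun_compose)
  qed
qed

lemma form_basis:
  assumes a: "has_form N A oq ou os a I i t J" and g: "\<gamma> \<in> Y"
  shows "blinfun_apply a (b \<gamma>)
    = (if \<gamma> \<in> cyl i J then b (prepend I (act t (shift (length J) \<gamma>))) else 0)"
proof -
  have I: "fpath i I" and J: "fpath i J"
    and ae: "a = path_op oq os i I o\<^sub>L u_pow oq ou i t o\<^sub>L adj (path_op oq os i J)"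
    using a by (auto simp: has_form_def)
  have i: "i \<in> V" using path_ending_at_vertices[OF J] .
  show ?thesis
  proof (cases "\<gamma> \<in> cyl i J")
    case True
    have s: "src (shift (length J) \<gamma> 0) = i" using True unfolding cyl_iff[OF J] by simp
    have d: "shift (length J) \<gamma> \<in> Y" by (rule Y_shift[OF g])
    show ?thesis
      using True s path_basis[OF I Y_act[OF d]]
      by (simp add: ae adj_path_basis[OF J g] U_basis[OF i d])
  next
    case False
    then show ?thesis by (simp add: ae adj_path_basis[OF J g])
  qed
qed

end

context katsura_data
begin

text \<open>Tail equivalence modulo the integer action. The two shifts are independent, so prefixing
  and shifting stay inside.\<close>

definition orbit :: "(nat \<Rightarrow> edge) \<Rightarrow> (nat \<Rightarrow> edge) set" where
  "orbit \<gamma> = {\<delta> \<in> X. \<exists>k l t. shift k \<delta> = u_act A B t (shift l \<gamma>)}"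

lemma orbit_self:
  assumes "\<gamma> \<in> X"
  shows "\<gamma> \<in> orbit \<gamma>"
proof -
  have "shift 0 \<gamma> = u_act A B 0 (shift 0 \<gamma>)" using u_act_0[OF assms] by simp
  then show ?thesis using assms unfolding orbit_def by blast
qed

text \<open>A member is recovered from a finite prefix, an integer and a shift, of which there are
  countably many choices.\<close>

lemma countable_orbit: "countable (orbit \<gamma>)"
proof (rule countable_subset)
  show "orbit \<gamma> \<subseteq> (\<lambda>(I, t, l). prepend I (u_act A B t (shift l \<gamma>))) ` UNIV"
  proof
    fix \<delta> assume "\<delta> \<in> orbit \<gamma>"
    then obtain k l t where "shift k \<delta> = u_act A B t (shift l \<gamma>)" by (auto simp: orbit_def)
    then have "\<delta> = prepend (map \<delta> [0..<k]) (u_act A B t (shift l \<gamma>))" by (metis prepend_shift)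
    then have "\<delta> = (\<lambda>(I, t, l). prepend I (u_act A B t (shift l \<gamma>))) (map \<delta> [0..<k], t, l)"
      unfolding prod.case .
    then show "\<delta> \<in> (\<lambda>(I, t, l). prepend I (u_act A B t (shift l \<gamma>))) ` UNIV" by (rule image_eqI) simp
  qed
qed simp

text \<open>The basis is taken from an orthonormal sequence of \<open>'h\<close>, indexed through an
  enumeration of the orbit.\<close>

lemma ex_path_orbit:
  assumes inf: "infinite_dimensional TYPE('h::chilbert_space)" and g: "\<gamma> \<in> X"
  shows "\<exists>Y (b :: (nat \<Rightarrow> edge) \<Rightarrow> 'h). \<gamma> \<in> Y \<and> path_orbit N A B Y b"
proof -
  obtain e :: "nat \<Rightarrow> 'h" where e: "\<And>m n. cinner (e m) (e n) = (if m = n then 1 else 0)"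
    using inf by (auto simp: infinite_dimensional_def)
  define Y where "Y = orbit \<gamma>"
  define b where "b \<delta> = e (to_nat_on Y \<delta>)" for \<delta>
  have inj: "inj_on (to_nat_on Y) Y" unfolding Y_def by (rule inj_on_to_nat_on[OF countable_orbit])
  have "path_orbit N A B Y b"
  proof
    show "cinner (b x) (b y) = (if x = y then 1 else 0)" if "x \<in> Y" "y \<in> Y" for x y
      using that inj by (auto simp: b_def e inj_on_eq_iff)
    show "Y \<subseteq> X" by (auto simp: Y_def orbit_def)
    fix \<delta> assume "\<delta> \<in> Y"
    then obtain k l t where d: "\<delta> \<in> X" "shift k \<delta> = u_act A B t (shift l \<gamma>)" by (auto simp: Y_def orbit_def)
    show "u_act A B r \<delta> \<in> Y" for r
    proof -
      \<comment> \<open>Shifting past the action only replaces the exponent by a carry.\<close>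
      have "shift k (u_act A B r \<delta>) = u_act A B (carry A B r \<delta> k + t) (shift l \<gamma>)"
        by (simp add: u_act_shift d u_act_add[OF shift_X[OF g]])
      then show ?thesis using u_act_paths[OF d(1)] by (auto simp: Y_def orbit_def)
    qed
    show "shift n \<delta> \<in> Y" for n
    proof -
      have "shift k (shift n \<delta>) = shift n (shift k \<delta>)" by (simp add: shift_shift add.commute)
      also have "\<dots> = u_act A B (carry A B t (shift l \<gamma>) n) (shift (n + l) \<gamma>)"
        by (simp add: d u_act_shift shift_shift)
      finally show ?thesis using shift_X[OF d(1)] by (auto simp: Y_def orbit_def)
    qed
    show "prepend J \<delta> \<in> Y" if "fpath (src (\<delta> 0)) J" for J
    proof -
      have "shift (k + length J) (prepend J \<delta>) = shift k \<delta>" by (simp add: shift_shift[symmetric])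
      then show ?thesis using prepend_X(1)[OF that d(1)] d(2) by (auto simp: Y_def orbit_def)
    qed
  qed
  then show ?thesis using orbit_self[OF g] by (auto simp: Y_def)
qed

end

section \<open>The action of the Katsura semigroup\<close>

context katsura_fam
begin

text \<open>A form is a word in the generators, whose images are given. Every factor has to be
  located in the algebra first, as \<open>\<phi>\<close> is multiplicative only there.\<close>

lemma hom_form:
  fixes q' u' :: "nat \<Rightarrow> ('k::chilbert_space \<Rightarrow>\<^sub>L 'k)"
  assumes fam': "katsura_family N A B q' u' s'" and hom: "star_hom KA \<B> \<phi>"
    and gens: "\<And>i. i \<in> V \<Longrightarrow> \<phi> (q i) = q' i \<and> \<phi> (u i) = u' i"
      "\<And>i j n. (i, j) \<in> Omega N A \<Longrightarrow> \<phi> (s i j n) = s' i j n"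
    and a: "form a I i t J"
  shows "has_form N A q' u' s' (\<phi> a) I i t J"
proof -
  interpret f: katsura_fam N A B q' u' s' using fam' matrices by unfold_locales
  have mult: "\<phi> (x o\<^sub>L y) = \<phi> x o\<^sub>L \<phi> y" if "x \<in> KA" "y \<in> KA" for x y
    using hom that by (simp add: star_hom_def)
  have adj: "\<phi> (adj x) = adj (\<phi> x)" if "x \<in> KA" for x using hom that by (simp add: star_hom_def)
  have SGK: "x \<in> SG \<Longrightarrow> x \<in> KA" for x using semigroup_subset_algebra by blast
  have P: "\<phi> (SP i I) = path_op q' s' i I" if "fpath i I" for I
    using that
  proof (induction I)
    case Nil
    then show ?case using gens by simp
  next
    case (Cons e I)
    then have e: "e \<in> edges N A" "fpath i I" by (auto simp: path_ending_at_Cons)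
    have "\<phi> (SP i (e # I)) = \<phi> (SE e) o\<^sub>L \<phi> (SP i I)"
      unfolding path_op_Cons[OF Cons.prems] by (intro mult SGK semigroup_edge semigroup_path_op e)
    also have "\<phi> (SE e) = edge_op s' e" using gens(2)[OF edgesD(3)[OF e(1)]] by (simp add: edge_op_def)
    finally show ?case using Cons.IH[OF e(2)] f.path_op_Cons[OF Cons.prems] by simp
  qed
  have i: "i \<in> V" and I: "fpath i I" and J: "fpath i J" using a path_ending_at_vertices by (auto simp: has_form_def)
  have UK: "U i t \<in> SG" for t
  proof (induction t rule: int_induct[where k = 0])
    case base show ?case by (simp add: semigroup_q i)
  next
    case (step1 t) then show ?case unfolding U_Suc[OF i, symmetric] by (intro semigroup_mult semigroup_gens i)
  next
    case (step2 t) then show ?case unfolding U_pred[OF i, symmetric] by (intro semigroup_mult semigroup_gens i)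
  qed
  have Ut: "\<phi> (U i t) = u_pow q' u' i t" for t
  proof (induction t rule: int_induct[where k = 0])
    case base show ?case using gens i by simp
  next
    case (step1 t)
    have "\<phi> (u i o\<^sub>L U i t) = \<phi> (u i) o\<^sub>L \<phi> (U i t)" by (intro mult SGK semigroup_gens UK i)
    then show ?case using step1 gens(1)[OF i] by (simp add: U_Suc[OF i] f.U_Suc[OF i])
  next
    case (step2 t)
    have "\<phi> (adj (u i) o\<^sub>L U i t) = \<phi> (adj (u i)) o\<^sub>L \<phi> (U i t)" by (intro mult SGK semigroup_gens UK i)
    then show ?case using step2 gens(1)[OF i] adj[OF algebra_gens(2)[OF i]] by (simp add: U_pred[OF i] f.U_pred[OF i])
  qed
  have ae: "a = SP i I o\<^sub>L U i t o\<^sub>L adj (SP i J)" using a by (simp add: has_form_def)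
  have "\<phi> a = \<phi> (SP i I) o\<^sub>L \<phi> (U i t) o\<^sub>L \<phi> (adj (SP i J))"
    unfolding ae
    by (subst mult, (intro SGK semigroup_mult semigroup_adj semigroup_path_op UK I J)+)
      (subst mult, (intro SGK semigroup_mult semigroup_adj semigroup_path_op UK I J)+, rule refl)
  then show ?thesis using I J P Ut adj[OF SGK[OF semigroup_path_op[OF J]]] by (simp add: has_form_def)
qed

end

locale universal_katsura = katsura_fam N A B q u s
  for N :: enat and A :: "nat \<Rightarrow> nat \<Rightarrow> nat" and B :: "nat \<Rightarrow> nat \<Rightarrow> int"
    and q u :: "nat \<Rightarrow> ('h::chilbert_space \<Rightarrow>\<^sub>L 'h)" and s :: "nat \<Rightarrow> nat \<Rightarrow> int \<Rightarrow> ('h \<Rightarrow>\<^sub>L 'h)" +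
  assumes universal: "universal_katsura_family N A B q u s"
    and infinite_dim: "infinite_dimensional TYPE('h)"
begin

abbreviation "dom_of \<equiv> katsura_dom N A q u s"
abbreviation "act_of \<equiv> katsura_act N A B q u s"

lemma ex_hom:
  fixes q' u' :: "nat \<Rightarrow> ('h \<Rightarrow>\<^sub>L 'h)"
  assumes "katsura_family N A B q' u' s'"
  shows "\<exists>\<phi>. star_hom KA (bounded_ops UNIV) \<phi> \<and> (\<forall>i\<in>V. \<phi> (q i) = q' i \<and> \<phi> (u i) = u' i) \<and>
    (\<forall>(i, j)\<in>Omega N A. \<forall>n. \<phi> (s i j n) = s' i j n)"
  using universal assms unfolding universal_katsura_family_def by blast

text \<open>Universality sends the family to the one on the orbit of \<open>\<gamma>\<close>;
  \<open>\<phi> 0 = 0\<close> is recorded in order to detect nonzero elements.\<close>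

lemma form_on_orbit:
  assumes g: "\<gamma> \<in> X"
  shows "\<exists>Y (b :: (nat \<Rightarrow> edge) \<Rightarrow> 'h) \<phi>. \<gamma> \<in> Y \<and> path_orbit N A B Y b \<and> \<phi> 0 = (0 :: 'h \<Rightarrow>\<^sub>L 'h) \<and>
    (\<forall>a I i t J. form a I i t J \<longrightarrow> blinfun_apply (\<phi> a) (b \<gamma>)
      = (if \<gamma> \<in> cyl i J then b (prepend I (u_act A B t (shift (length J) \<gamma>))) else 0))"
proof -
  obtain Y and b :: "(nat \<Rightarrow> edge) \<Rightarrow> 'h" where gY: "\<gamma> \<in> Y" and orb: "path_orbit N A B Y b"
    using ex_path_orbit[OF infinite_dim g] by blast
  interpret path_orbit N A B Y b by (rule orb)
  obtain \<phi> where \<phi>: "star_hom KA (bounded_ops UNIV) \<phi>" "\<forall>i\<in>V. \<phi> (q i) = oq i \<and> \<phi> (u i) = ou i"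
    "\<forall>(i, j)\<in>Omega N A. \<forall>n. \<phi> (s i j n) = os i j n"
    using ex_hom[OF orbit_family] by blast
  have "0 \<in> KA" using subspace_algebra by (simp add: subspace_op_scale_iff)
  then have "\<phi> (op_scale 0 0) = op_scale 0 (\<phi> 0)" using \<phi>(1) unfolding star_hom_def by blast
  then have "\<phi> 0 = 0" by simp
  moreover have "blinfun_apply (\<phi> a) (b \<gamma>)
      = (if \<gamma> \<in> cyl i J then b (prepend I (u_act A B t (shift (length J) \<gamma>))) else 0)"
    if "form a I i t J" for a I i t J
  proof (rule form_basis[OF _ gY], rule hom_form[OF orbit_family \<phi>(1) _ _ that])
    show "\<phi> (q i) = oq i \<and> \<phi> (u i) = ou i" if "i \<in> V" for i using \<phi>(2) that by blast
    show "\<phi> (s i j n) = os i j n" if "(i, j) \<in> Omega N A" for i j n using \<phi>(3) that by blast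
  qed
  ultimately show ?thesis using gY orb by blast
qed

text \<open>The image of \<open>b \<gamma>\<close> under \<phi> a knows nothing of the form. It is
  nonzero exactly when \<open>\<gamma>\<close> lies in the domain, and by orthonormality the image
  path can be recovered from it.\<close>

lemma form_unique:
  assumes a: "form a I i t J" and a': "form a I' i' t' J'" and g: "\<gamma> \<in> cyl i J"
  shows "a \<noteq> 0" "\<gamma> \<in> cyl i' J'"
    "prepend I (u_act A B t (shift (length J) \<gamma>)) = prepend I' (u_act A B t' (shift (length J') \<gamma>))"
proof -
  have I: "fpath i I" and J: "fpath i J" and I': "fpath i' I'" and J': "fpath i' J'"
    using a a' by (auto simp: has_form_def)
  have gX: "\<gamma> \<in> X" using g cyl_subset[OF J] by blast
  obtain Y and b :: "(nat \<Rightarrow> edge) \<Rightarrow> 'h" and \<phi> where gY: "\<gamma> \<in> Y" and orb: "path_orbit N A B Y b"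
    and zero: "\<phi> 0 = (0 :: 'h \<Rightarrow>\<^sub>L 'h)" and F: "\<And>a I i t J. form a I i t J \<Longrightarrow> blinfun_apply (\<phi> a) (b \<gamma>)
      = (if \<gamma> \<in> cyl i J then b (prepend I (u_act A B t (shift (length J) \<gamma>))) else 0)"
    using form_on_orbit[OF gX] by blast
  interpret path_orbit N A B Y b by (rule orb)
  have inY: "prepend I (act t (shift (length J) \<gamma>)) \<in> Y" if "fpath i I" "fpath i J" "\<gamma> \<in> cyl i J" for I i t J
    using that Y_act[OF Y_shift[OF gY]] unfolding cyl_iff[OF that(2)] by (intro Y_prepend) auto
  have nz: "b \<delta> \<noteq> 0" if "\<delta> \<in> Y" for \<delta> using orthonormal[OF that that] by auto
  have 1: "blinfun_apply (\<phi> a) (b \<gamma>) = b (prepend I (act t (shift (length J) \<gamma>)))" using F[OF a] g by simp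
  then have ne: "blinfun_apply (\<phi> a) (b \<gamma>) \<noteq> 0" using nz inY[OF I J g] by simp
  then show "a \<noteq> 0" using zero by auto
  show g': "\<gamma> \<in> cyl i' J'" using ne F[OF a'] by (simp split: if_splits)
  then have "b (prepend I (act t (shift (length J) \<gamma>))) = b (prepend I' (act t' (shift (length J') \<gamma>)))"
    using 1 F[OF a'] by simp
  then show "prepend I (act t (shift (length J) \<gamma>)) = prepend I' (act t' (shift (length J') \<gamma>))"
    using orthonormal[OF inY[OF I J g] inY[OF I' J' g']] orthonormal[OF inY[OF I J g] inY[OF I J g]]
    by (metis zero_neq_one)
qed

lemma form_nonzero: "form a I i t J \<Longrightarrow> a \<noteq> 0"
  using form_unique(1) cyl_nonempty by (metis ex_in_conv has_form_def)

lemma dom_form: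
  assumes a: "form a I i t J"
  shows "dom_of a = cyl i J"
proof (intro equalityI subsetI)
  fix \<gamma> assume "\<gamma> \<in> dom_of a"
  then obtain I' i' t' J' where "form a I' i' t' J'" "\<gamma> \<in> cyl i' J'"
    unfolding katsura_dom_def path_cyl_def by blast
  then show "\<gamma> \<in> cyl i J" using form_unique(2) a by blast
next
  fix \<gamma> assume "\<gamma> \<in> cyl i J"
  then show "\<gamma> \<in> dom_of a"
    using a form_nonzero[OF a] unfolding katsura_dom_def path_cyl_def by blast
qed

text \<open>By uniqueness all candidates of the choice operator coincide.\<close>

lemma act_form:
  assumes a: "form a I i t J" and g: "\<gamma> \<in> X" "src (\<gamma> 0) = i"
  shows "act_of a (prepend J \<gamma>) = prepend I (u_act A B t \<gamma>)"
  unfolding katsura_act_def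
proof (rule some_equality)
  show "\<exists>I' i' t' J' \<gamma>'. form a I' i' t' J' \<and> \<gamma>' \<in> X \<and> src (\<gamma>' 0) = i' \<and> prepend J \<gamma> = prepend J' \<gamma>' \<and>
      prepend I (u_act A B t \<gamma>) = prepend I' (u_act A B t' \<gamma>')" using a g by blast
  fix \<delta> assume "\<exists>I' i' t' J' \<gamma>'. form a I' i' t' J' \<and> \<gamma>' \<in> X \<and> src (\<gamma>' 0) = i' \<and> prepend J \<gamma> = prepend J' \<gamma>' \<and>
      \<delta> = prepend I' (u_act A B t' \<gamma>')"
  then obtain I' i' t' J' \<gamma>' where *: "form a I' i' t' J'" "\<gamma>' \<in> X" "src (\<gamma>' 0) = i'"
    "prepend J \<gamma> = prepend J' \<gamma>'" "\<delta> = prepend I' (u_act A B t' \<gamma>')" by blast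
  have "prepend J \<gamma> \<in> cyl i J" using g by (auto simp: path_cyl_def)
  from form_unique(3)[OF a *(1) this]
  have "prepend I (u_act A B t \<gamma>) = prepend I' (u_act A B t' (shift (length J') (prepend J \<gamma>)))"
    by simp
  also have "shift (length J') (prepend J \<gamma>) = \<gamma>'" unfolding *(4) by simp
  finally show "\<delta> = prepend I (u_act A B t \<gamma>)" using *(5) by simp
qed

end


section \<open>The covariant representation inside the Katsura algebra\<close>

lemma star_hom_tendsto:
  assumes \<A>: "cstar_algebra \<A>" and hom: "star_hom \<A> \<B> \<phi>" and \<B>: "\<B> \<subseteq> bounded_ops UNIV"
    and x: "\<And>n. x n \<in> \<A>" "y \<in> \<A>" and lim: "x \<longlonglongrightarrow> y"
  shows "(\<lambda>n. \<phi> (x n)) \<longlonglongrightarrow> \<phi> y"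
proof (rule metric_tendsto_imp_tendsto[OF lim always_eventually], rule allI)
  fix n
  have sub: "ops.subspace \<A>" using \<A> by (simp add: cstar_algebra_def)
  have m: "op_scale (- 1) y \<in> \<A>" by (rule ops.subspace_scale[OF sub x(2)])
  have "\<phi> (x n + op_scale (- 1) y) = \<phi> (x n) + op_scale (- 1) (\<phi> y)"
    using hom x m unfolding star_hom_def by metis
  then have "\<phi> (x n - y) = \<phi> (x n) - \<phi> y" by (simp add: op_scale_minus_one)
  moreover have "x n - y \<in> \<A>" using ops.subspace_add[OF sub x(1) m] by (simp add: op_scale_minus_one)
  ultimately show "dist (\<phi> (x n)) (\<phi> y) \<le> dist (x n) y"
    using star_hom_contractive[OF \<A> hom \<B>, of "x n - y"] by (simp add: dist_norm)
qed

lemma star_hom_span: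
  assumes \<A>: "ops.subspace \<A>" and hom: "star_hom \<A> \<B> \<phi>" and G: "G \<subseteq> \<A>"
    and S: "ops.subspace S" "\<And>g. g \<in> G \<Longrightarrow> \<phi> g \<in> S" and x: "x \<in> ops.span G"
  shows "\<phi> x \<in> S"
proof -
  have lin: "\<phi> (op_scale c a + b) = op_scale c (\<phi> a) + \<phi> b" if "a \<in> \<A>" "b \<in> \<A>" for a b c
    using hom that ops.subspace_scale[OF \<A> that(1)] unfolding star_hom_def by metis
  have z: "0 \<in> \<A>" by (rule ops.subspace_0[OF \<A>])
  have "\<phi> (op_scale 0 0) = op_scale 0 (\<phi> 0)" using hom z unfolding star_hom_def by blast
  then have z': "\<phi> 0 = 0" by simp
  have "x \<in> \<A> \<and> \<phi> x \<in> S"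
    using x
  proof (induction rule: ops.span_induct_alt)
    case base
    show ?case using ops.subspace_0[OF S(1)] z z' by simp
  next
    case (step c a b)
    then have ab: "a \<in> \<A>" "b \<in> \<A>" "\<phi> a \<in> S" "\<phi> b \<in> S" using G S(2) by auto
    show ?case unfolding lin[OF ab(1,2)]
      by (intro conjI ops.subspace_add[OF \<A>] ops.subspace_scale[OF \<A>]
          ops.subspace_add[OF S(1)] ops.subspace_scale[OF S(1)] ab)
  qed
  then show ?thesis by blast
qed

text \<open>Equality in Cauchy-Schwarz: for \<open>y\<close> in the range of \<open>e\<close>, the
  vector e* y is no longer than \<open>y\<close> while their inner product is norm(y)^2, so they
  agree. Idempotents of the semigroup are thereby recognized as range projections of paths.\<close>

lemma idempotent_contraction:
  assumes e: "e \<in> bounded_ops UNIV" "norm e \<le> 1" "e o\<^sub>L e = e"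
  shows "adj e o\<^sub>L e = e"
proof (rule blinfun_eqI)
  fix x
  let ?y = "blinfun_apply e x"
  let ?z = "blinfun_apply (adj e) ?y"
  have ey: "blinfun_apply e ?y = ?y" using e(3) by (metis blinfun_apply_blinfun_compose)
  have "norm ?z \<le> norm (adj e) * norm ?y" by (rule norm_blinfun)
  also have "\<dots> \<le> 1 * norm ?y"
    using norm_adj_le[OF e(1)] e(2) by (intro mult_right_mono) auto
  finally have "(norm ?z)\<^sup>2 \<le> (norm ?y)\<^sup>2" by (simp add: power_mono)
  moreover have "inner ?y ?z = (norm ?y)\<^sup>2"
    using cinner_adj_right[OF e(1), of ?y ?y] by (simp add: ey Re_cinner[symmetric] cinner_self)
  ultimately have "(norm (?z - ?y))\<^sup>2 \<le> 0"
    unfolding power2_norm_eq_inner by (simp add: inner_diff_left inner_diff_right inner_commute)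
  then show "blinfun_apply (adj e o\<^sub>L e) x = blinfun_apply e x" by simp
qed

lemma bounded_ops_H:
  assumes "closed_csubspace H"
  shows "S \<in> bounded_ops H \<Longrightarrow> T \<in> bounded_ops H \<Longrightarrow> S + T \<in> bounded_ops H"
    and "T \<in> bounded_ops H \<Longrightarrow> op_scale c T \<in> bounded_ops H"
    and "0 \<in> bounded_ops H"
  using assms
  by (auto simp: bounded_ops_def closed_csubspace_def subspace_scaleC_iff blinfun.add_left
      op_scale_apply scaleC_add_right scaleC_scaleC mult.commute)

context katsura_data
begin

lemma cyl_append: "prepend J \<gamma> \<in> cyl k (J @ K) \<longleftrightarrow> \<gamma> \<in> cyl k K"
  by (auto simp: path_cyl_def prepend_append)

text \<open>Stated for the inverse map, since pulling back an indicator requires preimages. The end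
  vertex survives because the action fixes all vertices of a path.\<close>

lemma cyl_act:
  assumes K: "fpath k K" and g: "\<gamma> \<in> X"
  shows "u_act A B (- t) \<gamma> \<in> cyl k K \<longleftrightarrow> \<gamma> \<in> cyl k (act_list A B t K)"
proof
  assume "u_act A B (- t) \<gamma> \<in> cyl k K"
  then obtain \<delta> where d: "\<delta> \<in> X" "src (\<delta> 0) = k" "u_act A B (- t) \<gamma> = prepend K \<delta>"
    by (auto simp: path_cyl_def)
  have "\<gamma> = u_act A B t (prepend K \<delta>)" by (simp add: d(3)[symmetric] u_act_add[OF g] u_act_0[OF g])
  then have "\<gamma> = prepend (act_list A B t K) (u_act A B (carry_list A B t K) \<delta>)"
    by (simp add: u_act_prepend)
  then show "\<gamma> \<in> cyl k (act_list A B t K)"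
    unfolding path_cyl_def using u_act_paths[OF d(1)] d(2) by fastforce
next
  assume "\<gamma> \<in> cyl k (act_list A B t K)"
  then obtain \<delta> where d: "\<delta> \<in> X" "src (\<delta> 0) = k" "\<gamma> = prepend (act_list A B t K) \<delta>"
    by (auto simp: path_cyl_def)
  define \<delta>' where "\<delta>' = u_act A B (- carry_list A B t K) \<delta>"
  have d': "\<delta>' \<in> X" "src (\<delta>' 0) = k" using u_act_paths[OF d(1)] d(2) by (auto simp: \<delta>'_def)
  have p: "prepend K \<delta>' \<in> X" using prepend_X(1)[OF K d'] .
  have "u_act A B t (prepend K \<delta>') = \<gamma>"
    by (simp add: u_act_prepend d(3) \<delta>'_def u_act_add[OF d(1)] u_act_0[OF d(1)])
  then have "u_act A B (- t) \<gamma> = prepend K \<delta>'"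
    using u_act_add[OF p, of B "- t" t] u_act_0[OF p, of B] by simp
  then show "u_act A B (- t) \<gamma> \<in> cyl k K" using d' by (auto simp: path_cyl_def)
qed

lemma C0_empty: "C0 (subtopology XT {}) = {\<lambda>_. 0}"
proof -
  have "C0 (subtopology XT {}) = {f \<in> C0 XT. \<forall>\<gamma>. \<gamma> \<notin> {} \<longrightarrow> f \<gamma> = 0}"
    by (rule C0_subtopology) auto
  also have "\<dots> = {\<lambda>_. 0}" using C0_zero by (auto simp: fun_eq_iff)
  finally show ?thesis .
qed

lemma ind_C0_cyl: "fpath i J \<Longrightarrow> ind (cyl i J) \<in> C0 (subtopology XT (cyl i J))"
  unfolding C0_cyl by (simp add: ind_cyl_C0 ind_def)

lemma level_path_in_cyl:
  assumes J: "fpath i J" and K: "K \<in> level_paths m n" and n: "length J \<le> n" and sub: "lcyl K \<subseteq> cyl i J"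
  shows "\<exists>K'. K = J @ K' \<and> path_src (tgt (last K)) K' = i"
proof -
  have r: "\<forall>k<length J. rep K k = J ! k" "src (rep K (length J)) = i"
    using rep_lcyl[OF K] sub unfolding cyl_iff[OF J, of "rep K", symmetric] by (auto simp: cyl_iff[OF J])
  have Kr: "K = map (rep K) [0..<Suc n]" using rep_prefix[OF K] by simp
  have nth: "K ! k = rep K k" if "k < Suc n" for k using that by (subst Kr) simp
  have "take (length J) K = J"
    by (rule nth_equalityI) (use r nth n level_pathsD(2)[OF K] in auto)
  then have "K = J @ drop (length J) K" by (metis append_take_drop_id)
  moreover have "path_src (tgt (last K)) (drop (length J) K) = i"
  proof -
    \<comment> \<open>As \<open>K\<close> is longer than \<open>J\<close>, there is an edge after
      the prefix, and its source is the vertex at which \<open>J\<close> ends.\<close>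
    have "drop (length J) K = K ! length J # drop (Suc (length J)) K"
      using n level_pathsD(2)[OF K] by (intro Cons_nth_drop_Suc[symmetric]) simp
    then show ?thesis using nth[of "length J"] n r(2) by simp
  qed
  ultimately show ?thesis by blast
qed

end

context katsura_fam
begin

lemma form_adj_compose:
  assumes a: "form a I i t J"
  shows "adj a o\<^sub>L a = pp i J" "a o\<^sub>L pp i J = a"
proof -
  have I: "fpath i I" and J: "fpath i J" and ae: "a = SP i I o\<^sub>L U i t o\<^sub>L adj (SP i J)"
    using a by (auto simp: has_form_def)
  have i: "i \<in> V" using path_ending_at_vertices[OF I] .
  have "adj a o\<^sub>L a = SP i J o\<^sub>L (U i (- t) o\<^sub>L ((adj (SP i I) o\<^sub>L SP i I) o\<^sub>L U i t)) o\<^sub>L adj (SP i J)"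
    using I J i by (simp add: ae adj_compose bounded_ops_compose bounded_ops_adj adj_adj U_adj blinfun_compose_assoc)
  also have "\<dots> = SP i J o\<^sub>L q i o\<^sub>L adj (SP i J)"
    by (simp add: path_op_adj[OF I] q_U[OF i] U_add[OF i])
  finally show "adj a o\<^sub>L a = pp i J" by (simp add: path_op_q[OF J] pp_def)
  have "a o\<^sub>L pp i J = SP i I o\<^sub>L (U i t o\<^sub>L ((adj (SP i J) o\<^sub>L SP i J) o\<^sub>L adj (SP i J)))"
    by (simp add: ae pp_def blinfun_compose_assoc)
  also have "\<dots> = SP i I o\<^sub>L ((U i t o\<^sub>L q i) o\<^sub>L adj (SP i J))"
    by (simp add: path_op_adj[OF J] blinfun_compose_assoc)
  finally show "a o\<^sub>L pp i J = a" by (simp add: ae U_q[OF i] blinfun_compose_assoc)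
qed

lemma form_compose_adj:
  assumes a: "form a I i t J"
  shows "a o\<^sub>L adj a = pp i I" "pp i I o\<^sub>L a = a"
proof -
  have I: "fpath i I" using a by (simp add: has_form_def)
  note * = form_adj_compose[OF form_adj[OF a]]
  show "a o\<^sub>L adj a = pp i I" using *(1) by (simp add: adj_adj form_ops[OF a])
  show "pp i I o\<^sub>L a = a" using arg_cong[OF *(2), of adj] I
    by (simp add: adj_adj adj_compose bounded_ops_adj form_ops[OF a])
qed

text \<open>A projection p satisfies p = 2 p - p^2, so \<open>norm_le_one_if_sqrt\<close> applies
  with Y = p.\<close>

lemma form_norm:
  assumes a: "form a I i t J"
  shows "norm a \<le> 1"
proof (rule norm_le_one_if_sqrt[of a "pp i J"])
  have J: "fpath i J" using a by (simp add: has_form_def)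
  then show "pp i J \<in> bounded_ops UNIV" "adj (pp i J) = pp i J" by simp_all
  show "adj a o\<^sub>L a = pp i J + pp i J - (pp i J o\<^sub>L pp i J)" using J by (simp add: form_adj_compose(1)[OF a])
qed (rule form_ops[OF a])

lemma form_src:
  assumes a: "form a I i t J"
  shows "q (path_src i I) o\<^sub>L a = a" "a o\<^sub>L q (path_src i J) = a"
proof -
  have *: "q (path_src i I) o\<^sub>L a = a" if a: "form a I i t J" for a I t J
    using a q_path_op[of i I] by (auto simp: has_form_def blinfun_compose_assoc[symmetric])
  show "q (path_src i I) o\<^sub>L a = a" by (rule *[OF a])
  have J: "fpath i J" using a by (simp add: has_form_def)
  show "a o\<^sub>L q (path_src i J) = a"
    using arg_cong[OF *[OF form_adj[OF a]], of adj] path_src_vertices[OF J]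
    by (simp add: adj_compose adj_adj bounded_ops_adj form_ops[OF a])
qed

text \<open>The essential subspace of the algebra. Covariant representations have to be
  nondegenerate, which may fail on the whole type.\<close>

definition H0 :: "'h set" where
  "H0 = closure (vec.span {blinfun_apply (q i) x |i x. i \<in> V})"

lemma q_H0: "i \<in> V \<Longrightarrow> blinfun_apply (q i) x \<in> H0"
  unfolding H0_def by (rule closure_subset[THEN subsetD], rule vec.span_base) blast

lemma H0_subspace: "closed_csubspace H0" "vec.subspace H0" "closed H0"
  unfolding closed_csubspace_def H0_def by (auto intro: subspace_closure_scaleC)

lemma semigroup_H0: "a \<in> SG \<Longrightarrow> a \<in> bounded_ops H0"
proof -
  assume aS: "a \<in> SG"
  consider "a = 0" | I i t J where "form a I i t J" using semigroup_forms[OF aS] by blast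
  then show ?thesis
  proof cases
    case 1 then show ?thesis using bounded_ops_H(3)[OF H0_subspace(1)] by simp
  next
    case 2
    note src = form_src[OF 2]
    have v: "path_src i I \<in> V" "path_src i J \<in> V" using 2 path_src_vertices by (auto simp: has_form_def)
    have "blinfun_apply a x \<in> H0" for x
      using q_H0[OF v(1), of "blinfun_apply a x"] src(1) by (metis blinfun_apply_blinfun_compose)
    moreover have "blinfun_apply a x = 0" if x: "\<forall>y\<in>H0. cinner x y = 0" for x
    proof -
      \<comment> \<open>For \<open>x\<close> orthogonal to \<open>H0\<close> this inner product is
        norm(q x)^2, so q x vanishes, and with it a x = a q x.\<close>
      have "cinner (blinfun_apply (q (path_src i J)) x) x = 0"
        using x q_H0[OF v(2), of x] by (metis cinner_commute complex_cnj_zero)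
      then have "blinfun_apply (q (path_src i J)) x = 0"
        unfolding norm_projection_apply[OF ops(1)[OF v(2)] q_proj[OF v(2)]] by simp
      then show ?thesis using src(2) by (metis blinfun.zero_right blinfun_apply_blinfun_compose)
    qed
    ultimately show ?thesis using semigroup_ops[OF aS] by (auto simp: bounded_ops_def bounded_ops_UNIV)
  qed
qed

lemma fun_rep_H0:
  assumes "f \<in> C0 XT"
  shows "fun_rep f \<in> bounded_ops H0"
proof (rule fun_rep_closed[OF assms closed_bounded_ops[OF H0_subspace(3)]])
  fix n
  have sub: "ops.subspace (bounded_ops H0)"
    unfolding subspace_op_scale_iff using bounded_ops_H[OF H0_subspace(1)] by blast
  show "step_rep n n f \<in> bounded_ops H0"
    unfolding step_rep_def
    by (intro ops.subspace_sum[OF sub] ops.subspace_scale[OF sub] semigroup_H0 pp_semigroup level_pathsD(3))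
qed

lemma fun_rep_zero: "fun_rep (\<lambda>_. 0) = 0"
  using fun_rep_contractive[OF C0_zero, of 0] by simp

text \<open>The vertex projections are images of indicators, and their ranges already generate
  \<open>H0\<close>.\<close>

lemma fun_rep_nondegenerate: "nondegenerate_star_rep XT H0 fun_rep"
  unfolding nondegenerate_star_rep_def
proof (intro conjI ballI allI)
  let ?R = "{blinfun_apply (fun_rep f) x |f x. f \<in> C0 XT \<and> x \<in> H0}"
  show "closure (vec.span ?R) = H0"
  proof
    have "?R \<subseteq> H0" using fun_rep_H0 by (auto simp: bounded_ops_def)
    then show "closure (vec.span ?R) \<subseteq> H0"
      by (intro closure_minimal vec.span_minimal H0_subspace)
    have "{blinfun_apply (q i) x |i x. i \<in> V} \<subseteq> ?R"
    proof clarify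
      fix i x assume i: "i \<in> V"
      have "fun_rep (ind (cyl i [])) = q i" using fun_rep_ind[of i "[]"] i by (simp add: pp_def)
      moreover have "blinfun_apply (q i) x = blinfun_apply (q i) (blinfun_apply (q i) x)"
        using q_idem[OF i] by (metis blinfun_apply_blinfun_compose)
      ultimately show "\<exists>f y. blinfun_apply (q i) x = blinfun_apply (fun_rep f) y \<and> f \<in> C0 XT \<and> y \<in> H0"
        using ind_cyl_C0[of i "[]"] i q_H0[OF i] by (metis path_ending_at.simps(1))
    qed
    then show "H0 \<subseteq> closure (vec.span ?R)"
      unfolding H0_def by (intro closure_mono vec.span_mono)
  qed
qed (auto simp: fun_rep_H0 fun_rep_add fun_rep_mult fun_rep_scale fun_rep_adj)

end

context universal_katsura
begin

text \<open>The function on the right-hand side of the covariance condition.\<close>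

definition pull :: "('h \<Rightarrow>\<^sub>L 'h) \<Rightarrow> ((nat \<Rightarrow> edge) \<Rightarrow> complex) \<Rightarrow> (nat \<Rightarrow> edge) \<Rightarrow> complex" where
  "pull a f = (\<lambda>\<gamma>. if \<gamma> \<in> dom_of (a o\<^sub>L adj a) then f (act_of (adj a) \<gamma>) else 0)"

lemma dom_compose:
  assumes a: "form a I i t J"
  shows "dom_of (adj a o\<^sub>L a) = cyl i J" "dom_of (a o\<^sub>L adj a) = cyl i I"
proof -
  have I: "fpath i I" and J: "fpath i J" using a by (auto simp: has_form_def)
  show "dom_of (adj a o\<^sub>L a) = cyl i J" "dom_of (a o\<^sub>L adj a) = cyl i I"
    unfolding form_adj_compose(1)[OF a] form_compose_adj(1)[OF a]
    by (rule dom_form[OF pp_form[OF J]], rule dom_form[OF pp_form[OF I]])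
qed

lemma dom_zero: "dom_of 0 = {}"
  by (simp add: katsura_dom_def)

lemma act_adj:
  assumes a: "form a I i t J" and g: "\<gamma> \<in> X" "src (\<gamma> 0) = i"
  shows "act_of (adj a) (prepend I \<gamma>) = prepend J (u_act A B (- t) \<gamma>)"
  by (rule act_form[OF form_adj[OF a] g])

lemma pull_C0:
  assumes a: "form a I i t J" and f: "f \<in> C0 XT"
  shows "pull a f \<in> C0 XT"
proof (rule C0_I)
  have I: "fpath i I" and J: "fpath i J" using a by (auto simp: has_form_def)
  show "pull a f \<gamma> = 0" if "\<gamma> \<notin> X" for \<gamma>
    using that cyl_subset[OF I] by (auto simp: pull_def dom_compose(2)[OF a])
  fix \<epsilon> :: real assume e: "\<epsilon> > 0"
  obtain m where m: "level_approx f m \<epsilon>" using C0_level_approx[OF f e] by blast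
  \<comment> \<open>The first summand decides membership in the cylinder, \<open>m\<close> covers
    the edges that matter for \<open>f\<close>, and the source of \<open>I\<close> puts the cylinder
    inside the compact part.\<close>
  define n where "n = Suc (length I) + m + path_src i I"
  have "level_approx (pull a f) n \<epsilon>"
    unfolding level_approx_def
  proof (intro conjI ballI impI)
    fix \<gamma> \<delta> assume X: "\<gamma> \<in> X" "\<delta> \<in> X" and ag: "\<forall>k<n. \<gamma> k = \<delta> k"
    have "\<forall>k<Suc (length I). \<gamma> k = \<delta> k" "\<forall>k<Suc (length I). \<delta> k = \<gamma> k" using ag by (auto simp: n_def)
    then have iff: "\<gamma> \<in> cyl i I \<longleftrightarrow> \<delta> \<in> cyl i I" using cyl_determined[OF I] X by blast
    show "cmod (pull a f \<gamma> - pull a f \<delta>) < \<epsilon>"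
    proof (cases "\<gamma> \<in> cyl i I")
      case True
      obtain \<gamma>' where g: "\<gamma>' \<in> X" "src (\<gamma>' 0) = i" "\<gamma> = prepend I \<gamma>'" using True by (auto simp: path_cyl_def)
      obtain \<delta>' where d: "\<delta>' \<in> X" "src (\<delta>' 0) = i" "\<delta> = prepend I \<delta>'" using True iff by (auto simp: path_cyl_def)
      have "\<forall>k<m. \<gamma>' k = \<delta>' k"
      proof (intro allI impI)
        fix k assume "k < m"
        then have "\<gamma> (k + length I) = \<delta> (k + length I)" using ag by (simp add: n_def)
        then show "\<gamma>' k = \<delta>' k" by (simp add: g(3) d(3) prepend_def)
      qed
      then have "\<forall>k<m. u_act A B (- t) \<gamma>' k = u_act A B (- t) \<delta>' k" by (rule u_act_agree)
      then have "\<forall>k<m. prepend J (u_act A B (- t) \<gamma>') k = prepend J (u_act A B (- t) \<delta>') k"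
        by (simp add: prepend_def)
      moreover have "prepend J (u_act A B (- t) \<gamma>') \<in> X" "prepend J (u_act A B (- t) \<delta>') \<in> X"
        using prepend_X(1)[OF J] u_act_paths g d by auto
      ultimately have "cmod (f (prepend J (u_act A B (- t) \<gamma>')) - f (prepend J (u_act A B (- t) \<delta>'))) < \<epsilon>"
        using m by (simp add: level_approx_def)
      then show ?thesis using True iff
        by (simp add: pull_def dom_compose(2)[OF a] g(3) d(3) act_adj[OF a g(1,2)] act_adj[OF a d(1,2)])
    next
      case False
      then show ?thesis using iff e by (simp add: pull_def dom_compose(2)[OF a])
    qed
  next
    fix \<gamma> assume "\<gamma> \<in> X" "n < src (\<gamma> 0)"
    then have "\<gamma> \<notin> cyl i I" using cyl_src[OF I, of \<gamma>] by (auto simp: n_def)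
    then show "cmod (pull a f \<gamma>) < \<epsilon>" using e by (simp add: pull_def dom_compose(2)[OF a])
  qed
  then show "\<exists>n. level_approx (pull a f) n \<epsilon>" by blast
qed

text \<open>The function side of covariance on cylinders within the domain; \<open>conj_pp\<close>
  reaches the same path on the operator side.\<close>

lemma pull_ind:
  assumes a: "form a I i t J" and K: "fpath k (J @ K)" "path_src k K = i"
  shows "pull a (ind (cyl k (J @ K))) = ind (cyl k (I @ act_list A B t K))"
proof
  fix \<gamma>
  have I: "fpath i I" using a by (simp add: has_form_def)
  have K': "fpath k K" using K by (simp add: path_ending_at_append)
  show "pull a (ind (cyl k (J @ K))) \<gamma> = ind (cyl k (I @ act_list A B t K)) \<gamma>"
  proof (cases "\<gamma> \<in> cyl i I")
    case True
    then obtain \<gamma>' where g: "\<gamma>' \<in> X" "src (\<gamma>' 0) = i" "\<gamma> = prepend I \<gamma>'" by (auto simp: path_cyl_def)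
    show ?thesis using True
      by (simp add: pull_def dom_compose(2)[OF a] g(3) act_adj[OF a g(1,2)] ind_def cyl_append cyl_act[OF K' g(1)])
  next
    case False
    have "\<gamma> \<notin> cyl k (I @ act_list A B t K)"
    proof
      assume "\<gamma> \<in> cyl k (I @ act_list A B t K)"
      then obtain \<delta> where d: "\<delta> \<in> X" "src (\<delta> 0) = k" "\<gamma> = prepend I (prepend (act_list A B t K) \<delta>)"
        by (auto simp: path_cyl_def prepend_append)
      have "prepend (act_list A B t K) \<delta> \<in> X" "src (prepend (act_list A B t K) \<delta> 0) = i"
        using prepend_X[OF act_list_path[OF K'] d(1,2), of B t] K(2) by simp_all
      then show False using False d(3) by (auto simp: path_cyl_def)
    qed
    then show ?thesis using False by (simp add: pull_def dom_compose(2)[OF a] ind_def)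
  qed
qed

text \<open>Moving \<open>K\<close> through \<open>a\<close> produces the transformed path times a
  power of the unitary, and this power cancels against its adjoint.\<close>

lemma conj_pp:
  assumes a: "form a I i t J" and K: "fpath k (J @ K)" "path_src k K = i"
  shows "a o\<^sub>L pp k (J @ K) o\<^sub>L adj a = pp k (I @ act_list A B t K)"
proof -
  have I: "fpath i I" and J: "fpath i J" and ae: "a = SP i I o\<^sub>L U i t o\<^sub>L adj (SP i J)"
    using a by (auto simp: has_form_def)
  have K': "fpath k K" using K by (simp add: path_ending_at_append)
  have k: "k \<in> V" using path_ending_at_vertices[OF K'] .
  let ?L = "act_list A B t K" and ?c = "carry_list A B t K"
  have L: "fpath k (I @ ?L)" using I K act_list_path[OF K'] by (simp add: path_ending_at_append)
  have "a o\<^sub>L SP k (J @ K) = SP i I o\<^sub>L (U i t o\<^sub>L (adj (SP i J) o\<^sub>L SP k (J @ K)))"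
    by (simp add: ae blinfun_compose_assoc)
  also have "adj (SP i J) o\<^sub>L SP k (J @ K) = SP k K" using path_op_cancel[OF K(1)] K(2) by simp
  also have "U i t o\<^sub>L SP k K = SP k ?L o\<^sub>L U k ?c" using U_path_op[OF K'] K(2) by simp
  also have "SP i I o\<^sub>L (SP k ?L o\<^sub>L U k ?c) = SP k (I @ ?L) o\<^sub>L U k ?c"
    using path_op_append[OF L] K(2) by (simp add: blinfun_compose_assoc)
  finally have aS: "a o\<^sub>L SP k (J @ K) = SP k (I @ ?L) o\<^sub>L U k ?c" .
  have "a o\<^sub>L pp k (J @ K) o\<^sub>L adj a = (a o\<^sub>L SP k (J @ K)) o\<^sub>L adj (a o\<^sub>L SP k (J @ K))"
    using K(1) form_ops[OF a] by (simp add: pp_def adj_compose blinfun_compose_assoc)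
  also have "\<dots> = SP k (I @ ?L) o\<^sub>L (U k ?c o\<^sub>L U k (- ?c)) o\<^sub>L adj (SP k (I @ ?L))"
    unfolding aS using L k by (simp add: adj_compose U_adj blinfun_compose_assoc)
  finally show ?thesis using L by (simp add: U_add[OF k] path_op_q pp_def)
qed

lemma contractive_conj:
  assumes a: "form a I i t J"
  shows "contractive_linear W (\<lambda>f. a o\<^sub>L fun_rep f o\<^sub>L adj a)"
  unfolding contractive_linear_def
proof (intro conjI ballI allI impI)
  have aB: "a \<in> bounded_ops UNIV" by (rule form_ops[OF a])
  fix f g assume f: "f \<in> C0_on W"
  show "a o\<^sub>L fun_rep (\<lambda>\<gamma>. f \<gamma> + g \<gamma>) o\<^sub>L adj a = (a o\<^sub>L fun_rep f o\<^sub>L adj a) + (a o\<^sub>L fun_rep g o\<^sub>L adj a)"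
    if "g \<in> C0_on W"
    using f that by (simp add: fun_rep_add blinfun_compose_add_left blinfun_compose_add_right)
  show "a o\<^sub>L fun_rep (\<lambda>\<gamma>. c * f \<gamma>) o\<^sub>L adj a = op_scale c (a o\<^sub>L fun_rep f o\<^sub>L adj a)" for c
    using f by (simp add: fun_rep_scale op_scale_compose_left op_scale_compose_right[OF aB])
  fix M :: real assume M: "0 \<le> M" "\<forall>\<gamma>. cmod (f \<gamma>) \<le> M"
  have "norm (a o\<^sub>L fun_rep f o\<^sub>L adj a) \<le> norm (a o\<^sub>L fun_rep f) * norm (adj a)"
    by (rule norm_blinfun_compose)
  also have "\<dots> \<le> (norm a * norm (fun_rep f)) * norm (adj a)"
    by (intro mult_right_mono norm_blinfun_compose) simp
  also have "\<dots> \<le> (1 * M) * 1"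
    using form_norm[OF a] norm_adj_le[OF aB] fun_rep_contractive[of f M] f M
    by (intro mult_mono) auto
  finally show "norm (a o\<^sub>L fun_rep f o\<^sub>L adj a) \<le> M" by simp
qed

lemma contractive_pull:
  assumes a: "form a I i t J"
  shows "contractive_linear W (\<lambda>f. fun_rep (pull a f))"
  unfolding contractive_linear_def
proof (intro conjI ballI allI impI)
  fix f g assume f: "f \<in> C0_on W"
  then have pf: "pull a f \<in> C0 XT" using pull_C0[OF a] by simp
  show "fun_rep (pull a (\<lambda>\<gamma>. f \<gamma> + g \<gamma>)) = fun_rep (pull a f) + fun_rep (pull a g)"
    if "g \<in> C0_on W"
  proof -
    have pg: "pull a g \<in> C0 XT" using pull_C0[OF a] that by simp
    have "pull a (\<lambda>\<gamma>. f \<gamma> + g \<gamma>) = (\<lambda>\<gamma>. pull a f \<gamma> + pull a g \<gamma>)" by (auto simp: pull_def)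
    then show ?thesis by (simp add: fun_rep_add[OF pf pg])
  qed
  show "fun_rep (pull a (\<lambda>\<gamma>. c * f \<gamma>)) = op_scale c (fun_rep (pull a f))" for c
  proof -
    have "pull a (\<lambda>\<gamma>. c * f \<gamma>) = (\<lambda>\<gamma>. c * pull a f \<gamma>)" by (auto simp: pull_def)
    then show ?thesis by (simp add: fun_rep_scale[OF pf])
  qed
  fix M :: real assume M: "0 \<le> M" "\<forall>\<gamma>. cmod (f \<gamma>) \<le> M"
  show "norm (fun_rep (pull a f)) \<le> M"
    by (rule fun_rep_contractive[OF pf _ M(1)]) (use M in \<open>auto simp: pull_def\<close>)
qed

text \<open>Both sides are linear and contractive in \<open>f\<close>, so indicators of cylinders
  inside the domain suffice.\<close>

lemma fun_rep_covariant:
  assumes aS: "a \<in> SG" and f: "f \<in> C0 (subtopology XT (dom_of (adj a o\<^sub>L a)))"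
  shows "a o\<^sub>L fun_rep f o\<^sub>L adj a = fun_rep (pull a f)"
proof -
  consider "a = 0" | I i t J where "form a I i t J" using semigroup_forms[OF aS] by blast
  then show ?thesis
  proof cases
    case 1
    then show ?thesis using fun_rep_zero by (simp add: pull_def dom_zero)
  next
    case 2
    have J: "fpath i J" using 2 by (simp add: has_form_def)
    have f': "f \<in> C0 XT" "\<And>\<gamma>. \<gamma> \<notin> cyl i J \<Longrightarrow> f \<gamma> = 0"
      using f unfolding dom_compose(1)[OF 2] C0_cyl[OF J] by auto
    show ?thesis
    proof (rule contractive_linear_eqI[OF contractive_conj[OF 2] contractive_pull[OF 2]])
      show "\<delta> \<in> cyl i J" if "\<gamma> \<in> X" "\<delta> \<in> X" "\<forall>k<Suc (length J). \<gamma> k = \<delta> k" "\<gamma> \<in> cyl i J" for \<gamma> \<delta>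
        by (rule cyl_determined[OF J that])
      fix K m n assume K: "K \<in> level_paths m n" "Suc (length J) \<le> n" "lcyl K \<subseteq> cyl i J"
      obtain K' where K': "K = J @ K'" "path_src (tgt (last K)) K' = i"
        using level_path_in_cyl[OF J K(1) _ K(3)] K(2) by auto
      let ?k = "tgt (last K)"
      have P: "fpath ?k (J @ K')" using level_pathsD(3)[OF K(1)] K'(1) by simp
      have "fpath i I" "fpath ?k K'" using 2 P by (auto simp: has_form_def path_ending_at_append)
      then have L: "fpath ?k (I @ act_list A B t K')"
        using K'(2) act_list_path[of N A ?k K' B t] by (simp add: path_ending_at_append)
      have "a o\<^sub>L fun_rep (ind (cyl ?k (J @ K'))) o\<^sub>L adj a = fun_rep (pull a (ind (cyl ?k (J @ K'))))"
        unfolding fun_rep_ind[OF P] conj_pp[OF 2 P K'(2)] pull_ind[OF 2 P K'(2)] fun_rep_ind[OF L] ..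
      then show "a o\<^sub>L fun_rep (ind (lcyl K)) o\<^sub>L adj a = fun_rep (pull a (ind (lcyl K)))"
        using K'(1) by simp
    qed (use f' in auto)
  qed
qed

text \<open>A nonzero idempotent is the image of the indicator of its domain. Its range in
  \<open>H0\<close> is its set of fixed vectors, which is a closed subspace, so forming the closed
  span adds nothing.\<close>

lemma fun_rep_idempotent:
  assumes eS: "e \<in> SG" and idem: "e o\<^sub>L e = e"
  shows "blinfun_apply e ` H0 = closure (vec.span
    {blinfun_apply (fun_rep f) x |f x. f \<in> C0 (subtopology XT (dom_of e)) \<and> x \<in> H0})"
proof -
  have zero: "0 \<in> H0" by (rule vec.subspace_0[OF H0_subspace(2)])
  consider "e = 0" | I i t J where "form e I i t J" using semigroup_forms[OF eS] by blast
  then show ?thesis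
  proof cases
    case 1
    have "{blinfun_apply (fun_rep f) x |f x. f \<in> C0 (subtopology XT (dom_of e)) \<and> x \<in> H0} = {0}"
      unfolding 1 dom_zero C0_empty using zero by (auto simp: fun_rep_zero)
    moreover have "blinfun_apply e ` H0 = {0}" using zero 1 by auto
    moreover have "vec.span {0 :: 'h} = {0}" using vec.span_insert_0[of "{}"] by simp
    ultimately show ?thesis by simp
  next
    case 2
    have J: "fpath i J" using 2 by (simp add: has_form_def)
    have e: "e = pp i J"
      using idempotent_contraction[OF form_ops[OF 2] form_norm[OF 2] idem] form_adj_compose(1)[OF 2] by simp
    have eind: "fun_rep (ind (cyl i J)) = e" using fun_rep_ind[OF J] e by simp
    let ?R = "{blinfun_apply (fun_rep f) x |f x. f \<in> C0 (subtopology XT (dom_of e)) \<and> x \<in> H0}"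
    have img: "blinfun_apply e ` H0 = {y \<in> H0. blinfun_apply e y = y}"
    proof (intro equalityI subsetI)
      fix y assume "y \<in> blinfun_apply e ` H0"
      then show "y \<in> {y \<in> H0. blinfun_apply e y = y}"
        using semigroup_H0[OF eS] idem by (auto simp: bounded_ops_def) (metis blinfun_apply_blinfun_compose)
    qed (metis (mono_tags, lifting) imageI mem_Collect_eq)
    have "closed {y \<in> H0. blinfun_apply e y = y}"
      by (intro closed_Collect_conj closed_Collect_eq continuous_intros)
        (use H0_subspace(3) in simp)
    then have cl: "closed (blinfun_apply e ` H0)" unfolding img .
    have sub: "vec.subspace (blinfun_apply e ` H0)"
      unfolding img using H0_subspace(2) form_ops[OF 2]
      by (auto simp: subspace_scaleC_iff blinfun.add_right bounded_ops_UNIV)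
    have "?R \<subseteq> blinfun_apply e ` H0"
    proof clarify
      fix f x assume "f \<in> C0 (subtopology XT (dom_of e))" and x: "x \<in> H0"
      then have f: "f \<in> C0 XT" "\<And>\<gamma>. \<gamma> \<notin> cyl i J \<Longrightarrow> f \<gamma> = 0"
        unfolding dom_form[OF 2] C0_cyl[OF J] by auto
      have "(\<lambda>\<gamma>. ind (cyl i J) \<gamma> * f \<gamma>) = f" using f(2) by (auto simp: ind_def)
      then have "fun_rep f = e o\<^sub>L fun_rep f"
        using fun_rep_mult[OF ind_cyl_C0[OF J] f(1)] eind by simp
      then have "blinfun_apply (fun_rep f) x = blinfun_apply e (blinfun_apply (fun_rep f) x)"
        by (metis blinfun_apply_blinfun_compose)
      moreover have "blinfun_apply (fun_rep f) x \<in> H0" using fun_rep_H0[OF f(1)] by (simp add: bounded_ops_def)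
      ultimately show "blinfun_apply (fun_rep f) x \<in> blinfun_apply e ` H0" by (metis imageI)
    qed
    moreover have "blinfun_apply e ` H0 \<subseteq> ?R"
      using ind_C0_cyl[OF J] eind unfolding dom_form[OF 2] by blast
    ultimately show ?thesis
      using closure_minimal[OF vec.span_minimal[OF _ sub] cl] closure_subset vec.span_superset
      by (meson order_antisym order_trans)
  qed
qed

theorem fun_rep_covariant_rep: "covariant_rep SG (o\<^sub>L) adj XT dom_of act_of H0 fun_rep (\<lambda>a. a)"
  unfolding covariant_rep_def
proof (intro conjI ballI allI impI)
  show "closed_csubspace H0" by (rule H0_subspace(1))
  show "nondegenerate_star_rep XT H0 fun_rep" by (rule fun_rep_nondegenerate)
  fix a assume a: "a \<in> SG"
  show "a \<in> bounded_ops H0" by (rule semigroup_H0[OF a])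
  show "partial_isometry a"
    unfolding partial_isometry_def
    using semigroup_forms[OF a] form_adj_compose by (metis blinfun_compose_assoc blinfun_compose_zero(2))
  show "adj a = adj a" ..
  show "a o\<^sub>L b = a o\<^sub>L b" if "b \<in> SG" for b ..
  show "a o\<^sub>L fun_rep f o\<^sub>L adj a = fun_rep (\<lambda>x. if x \<in> dom_of (a o\<^sub>L adj a) then f (act_of (adj a) x) else 0)"
    if "f \<in> C0 (subtopology XT (dom_of (adj a o\<^sub>L a)))" for f
    using fun_rep_covariant[OF a that] by (simp add: pull_def)
  show "blinfun_apply a ` H0 = closure (vec.span
      {blinfun_apply (fun_rep f) x |f x. f \<in> C0 (subtopology XT (dom_of a)) \<and> x \<in> H0})"
    if "a o\<^sub>L a = a" by (rule fun_rep_idempotent[OF a that])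
qed

end


section \<open>Covariant representations give Katsura families\<close>

locale katsura_covariant = universal_katsura N A B q u s
  for N :: enat and A :: "nat \<Rightarrow> nat \<Rightarrow> nat" and B :: "nat \<Rightarrow> nat \<Rightarrow> int"
    and q u :: "nat \<Rightarrow> ('h::chilbert_space \<Rightarrow>\<^sub>L 'h)" and s :: "nat \<Rightarrow> nat \<Rightarrow> int \<Rightarrow> ('h \<Rightarrow>\<^sub>L 'h)" +
  fixes H :: "'h set" and \<pi> :: "((nat \<Rightarrow> edge) \<Rightarrow> complex) \<Rightarrow> ('h \<Rightarrow>\<^sub>L 'h)"
    and \<sigma> :: "('h \<Rightarrow>\<^sub>L 'h) \<Rightarrow> ('h \<Rightarrow>\<^sub>L 'h)"
  assumes covariant: "covariant_rep SG (o\<^sub>L) adj XT dom_of act_of H \<pi> \<sigma>"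
begin

lemma cov:
  "closed_csubspace H" "nondegenerate_star_rep XT H \<pi>"
  "\<forall>s\<in>SG. \<sigma> s \<in> bounded_ops H \<and> partial_isometry (\<sigma> s) \<and> \<sigma> (adj s) = adj (\<sigma> s)"
  "\<forall>s\<in>SG. \<forall>t\<in>SG. \<sigma> (s o\<^sub>L t) = \<sigma> s o\<^sub>L \<sigma> t"
  "\<forall>e\<in>SG. e o\<^sub>L e = e \<longrightarrow> blinfun_apply (\<sigma> e) ` H = closure (vec.span
      {blinfun_apply (\<pi> f) x |f x. f \<in> C0 (subtopology XT (dom_of e)) \<and> x \<in> H})"
  using covariant unfolding covariant_rep_def by - (elim conjE, assumption)+

lemma \<sigma>_ops: "a \<in> SG \<Longrightarrow> \<sigma> a \<in> bounded_ops H" and \<sigma>_adj: "a \<in> SG \<Longrightarrow> \<sigma> (adj a) = adj (\<sigma> a)"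
  and \<sigma>_mult: "a \<in> SG \<Longrightarrow> b \<in> SG \<Longrightarrow> \<sigma> (a o\<^sub>L b) = \<sigma> a o\<^sub>L \<sigma> b"
  using cov(3,4) by blast+

lemma \<sigma>_ops_UNIV: "a \<in> SG \<Longrightarrow> \<sigma> a \<in> bounded_ops UNIV"
  using \<sigma>_ops bounded_ops_subset_UNIV by blast

lemma \<pi>_facts:
  "f \<in> C0 XT \<Longrightarrow> \<pi> f \<in> bounded_ops H"
  "f \<in> C0 XT \<Longrightarrow> g \<in> C0 XT \<Longrightarrow> \<pi> (\<lambda>x. f x + g x) = \<pi> f + \<pi> g"
  "f \<in> C0 XT \<Longrightarrow> g \<in> C0 XT \<Longrightarrow> \<pi> (\<lambda>x. f x * g x) = \<pi> f o\<^sub>L \<pi> g"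
  "f \<in> C0 XT \<Longrightarrow> \<pi> (\<lambda>x. c * f x) = op_scale c (\<pi> f)"
  "f \<in> C0 XT \<Longrightarrow> \<pi> (\<lambda>x. cnj (f x)) = adj (\<pi> f)"
  using cov(2) unfolding nondegenerate_star_rep_def by blast+

lemma \<pi>_ops_UNIV: "f \<in> C0 XT \<Longrightarrow> \<pi> f \<in> bounded_ops UNIV"
  using \<pi>_facts(1) bounded_ops_subset_UNIV by blast

lemma contractive_\<pi>: "contractive_linear W \<pi>"
  unfolding contractive_linear_def
proof (intro conjI ballI allI impI)
  fix f M assume f: "f \<in> C0_on W" and M: "0 \<le> M" "\<forall>\<gamma>. cmod (f \<gamma>) \<le> M"
  show "norm (\<pi> f) \<le> M"
  proof (rule star_rep_contractive[where F = "C0 XT" and \<pi> = \<pi> and f = f])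
    show "f \<in> C0 XT" using f by simp
    show "cmod (f \<gamma>) \<le> M" for \<gamma> using M by blast
    show "(\<lambda>x. h (f x)) \<in> C0 XT" if "f \<in> C0 XT" "continuous_on UNIV h" "h 0 = 0" for f and h :: "complex \<Rightarrow> complex"
      by (rule C0_compose[OF that])
    show "(\<lambda>x. f x + g x) \<in> C0 XT" if "f \<in> C0 XT" "g \<in> C0 XT" for f g by (rule C0_add[OF that])
  qed (use M \<pi>_facts \<pi>_ops_UNIV in auto)
qed (use \<pi>_facts in auto)

lemma \<pi>_zero: "\<pi> (\<lambda>_. 0) = 0"
proof -
  have "norm (\<pi> (\<lambda>_. 0)) \<le> 0"
    by (rule contractive_linearD(3)[OF contractive_\<pi>[of UNIV]]) (auto simp: C0_zero)
  then show ?thesis by simp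
qed

text \<open>Covariance determines only the range of the operator of an idempotent, but two
  self-adjoint projections with the same range are equal.\<close>

lemma \<sigma>_pp:
  assumes J: "fpath i J"
  shows "\<sigma> (pp i J) = \<pi> (ind (cyl i J))"
proof -
  define p where "p = \<sigma> (pp i J)"
  define P where "P = \<pi> (ind (cyl i J))"
  have S: "pp i J \<in> SG" by (rule pp_semigroup[OF J])
  have C: "ind (cyl i J) \<in> C0 XT" by (rule ind_cyl_C0[OF J])
  have p: "p \<in> bounded_ops H" "p \<in> bounded_ops UNIV" "adj p = p" "p o\<^sub>L p = p"
    using \<sigma>_ops[OF S] \<sigma>_ops_UNIV[OF S] \<sigma>_adj[OF S] \<sigma>_mult[OF S S] J by (auto simp: p_def)
  have "(\<lambda>\<gamma>. cnj (ind (cyl i J) \<gamma>)) = ind (cyl i J)" "(\<lambda>\<gamma>. ind (cyl i J) \<gamma> * ind (cyl i J) \<gamma>) = ind (cyl i J)"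
    by (auto simp: ind_def)
  then have P: "P \<in> bounded_ops H" "P \<in> bounded_ops UNIV" "adj P = P" "P o\<^sub>L P = P"
    using \<pi>_facts(1)[OF C] \<pi>_ops_UNIV[OF C] \<pi>_facts(5)[OF C] \<pi>_facts(3)[OF C C] by (auto simp: P_def)
  let ?R = "{blinfun_apply (\<pi> f) x |f x. f \<in> C0 (subtopology XT (cyl i J)) \<and> x \<in> H}"
  have range: "blinfun_apply p ` H = closure (vec.span ?R)"
    using cov(5) S J by (simp add: p_def dom_form[OF pp_form[OF J], symmetric])
  have "P o\<^sub>L p = p"
  proof (rule blinfun_eqI)
    fix x
    have "vec.subspace {y. blinfun_apply P y = y}"
      using P(2) by (auto simp: subspace_scaleC_iff blinfun.add_right bounded_ops_UNIV)
    moreover have "?R \<subseteq> {y. blinfun_apply P y = y}"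
    proof clarify
      fix f x assume "f \<in> C0 (subtopology XT (cyl i J))"
      then have f: "f \<in> C0 XT" "\<And>\<gamma>. \<gamma> \<notin> cyl i J \<Longrightarrow> f \<gamma> = 0" unfolding C0_cyl[OF J] by auto
      have "(\<lambda>\<gamma>. ind (cyl i J) \<gamma> * f \<gamma>) = f" using f(2) by (auto simp: ind_def)
      then have "P o\<^sub>L \<pi> f = \<pi> f" using \<pi>_facts(3)[OF C f(1)] by (simp add: P_def)
      then show "blinfun_apply P (blinfun_apply (\<pi> f) x) = blinfun_apply (\<pi> f) x"
        by (metis blinfun_apply_blinfun_compose)
    qed
    moreover have "closed {y. blinfun_apply P y = y}"
      by (intro closed_Collect_eq continuous_intros)
    ultimately have fix_: "closure (vec.span ?R) \<subseteq> {y. blinfun_apply P y = y}"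
      by (intro closure_minimal vec.span_minimal)
    have "blinfun_apply p x \<in> H" using p(1) by (simp add: bounded_ops_def)
    then have "blinfun_apply p (blinfun_apply p x) \<in> closure (vec.span ?R)" unfolding range[symmetric] by blast
    moreover have "blinfun_apply p (blinfun_apply p x) = blinfun_apply p x"
      using p(4) by (metis blinfun_apply_blinfun_compose)
    ultimately show "blinfun_apply (P o\<^sub>L p) x = blinfun_apply p x" using fix_ by auto
  qed
  moreover have "p o\<^sub>L P = P"
  proof (rule blinfun_eqI)
    fix x
    have "blinfun_apply P x = blinfun_apply P (blinfun_apply P x)"
      using P(4) by (metis blinfun_apply_blinfun_compose)
    moreover have "blinfun_apply P x \<in> H" using P(1) by (simp add: bounded_ops_def)
    ultimately have "blinfun_apply P x \<in> ?R" unfolding P_def using ind_C0_cyl[OF J] by blast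
    then have "blinfun_apply P x \<in> blinfun_apply p ` H"
      unfolding range by (rule closure_subset[THEN subsetD, OF vec.span_base])
    then obtain y where "blinfun_apply P x = blinfun_apply p y" by blast
    then show "blinfun_apply (p o\<^sub>L P) x = blinfun_apply P x"
      using p(4) by (metis blinfun_apply_blinfun_compose)
  qed
  \<comment> \<open>Taking adjoints reverses the product, so that both relations speak of the same
    composite.\<close>
  then have "adj (p o\<^sub>L P) = adj P" by simp
  then have "P o\<^sub>L p = P" using p(2,3) P(2,3) by (simp add: adj_compose)
  ultimately show ?thesis by (simp add: p_def P_def)
qed

text \<open>The domain of 0 is empty and carries only the zero function, so the condition on
  idempotents leaves no range.\<close>

lemma \<sigma>_zero:
  assumes "0 \<in> SG"
  shows "\<sigma> 0 = 0"
proof (rule blinfun_eqI)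
  fix x
  have "blinfun_apply (\<sigma> 0) ` H = closure (vec.span
      {blinfun_apply (\<pi> f) x |f x. f \<in> C0 (subtopology XT {}) \<and> x \<in> H})"
    using cov(5) assms by (simp add: dom_zero)
  also have "{blinfun_apply (\<pi> f) x |f x. f \<in> C0 (subtopology XT {}) \<and> x \<in> H} \<subseteq> {0}"
    unfolding C0_empty by (auto simp: \<pi>_zero)
  then have "closure (vec.span {blinfun_apply (\<pi> f) x |f x. f \<in> C0 (subtopology XT {}) \<and> x \<in> H}) \<subseteq> {0}"
    by (intro closure_minimal vec.span_minimal) (auto simp: subspace_scaleC_iff)
  finally have "blinfun_apply (\<sigma> 0) ` H \<subseteq> {0}" .
  moreover have "blinfun_apply (\<sigma> 0) x \<in> H" using \<sigma>_ops[OF assms] by (simp add: bounded_ops_def)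
  \<comment> \<open>On \<open>H\<close> the operator vanishes, and all its values lie in
    \<open>H\<close>; idempotence then extends this to the whole type.\<close>
  ultimately have "blinfun_apply (\<sigma> 0) (blinfun_apply (\<sigma> 0) x) = 0" by blast
  then show "blinfun_apply (\<sigma> 0) x = blinfun_apply 0 x"
    using \<sigma>_mult[OF assms assms] by (metis blinfun_apply_blinfun_compose blinfun_compose_zero(2) zero_blinfun.rep_eq)
qed

lemma \<pi>_vertex:
  assumes i: "i \<in> V"
  shows "\<pi> (ind (cyl i [])) = (\<Sum>e | e \<in> edges N A \<and> src e = i. \<pi> (ind (cyl (tgt e) [e])))"
proof -
  let ?E = "{e \<in> edges N A. src e = i}"
  have e: "fpath (tgt e) [e]" if "e \<in> ?E" for e using that edgesD(2) by simp
  have D: "ind (cyl (tgt e) [e]) \<in> C0_on UNIV" if "e \<in> ?E" for e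
    using ind_cyl_C0[OF e[OF that]] by simp
  have "\<pi> (ind (cyl i [])) = (\<Sum>e\<in>?E. op_scale 1 (\<pi> (ind (cyl (tgt e) [e]))))"
    unfolding ind_vertex[OF i]
    by (rule conjunct2[OF contractive_linear_sum[OF contractive_\<pi> finite_edges_from[OF i] D]])
  then show ?thesis by (simp add: ops.scale_one)
qed

lemma covariant_family: "katsura_family N A B (\<lambda>i. \<sigma> (q i)) (\<lambda>i. \<sigma> (u i)) (\<lambda>i j n. \<sigma> (s i j n))"
  unfolding katsura_family_def
proof (intro conjI ballI allI, goal_cases)
  case (1 i) then show ?case by (intro \<sigma>_ops_UNIV semigroup_q)
next
  case (2 i) then show ?case by (intro \<sigma>_ops_UNIV semigroup_gens)
next
  case (3 x) then show ?case by (auto intro: \<sigma>_ops_UNIV semigroup_gens)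
next
  case (4 i) then show ?case
    using \<sigma>_adj[OF semigroup_q, of i] \<sigma>_mult[OF semigroup_q semigroup_q, of i i]
    by (simp add: is_projection_def)
next
  case (5 i j)
  show ?case
  proof
    assume "i \<noteq> j"
    then have z: "q i o\<^sub>L q j = 0" using 5 q_orth by blast
    then have "0 \<in> SG" using semigroup_mult[OF semigroup_q[OF 5(1)] semigroup_q[OF 5(2)]] by simp
    then show "\<sigma> (q i) o\<^sub>L \<sigma> (q j) = 0"
      using \<sigma>_mult[OF semigroup_q[OF 5(1)] semigroup_q[OF 5(2)]] z \<sigma>_zero by simp
  qed
next
  case (6 i) then show ?case
    using \<sigma>_mult[OF semigroup_gens(1,2), of i i] \<sigma>_adj[OF semigroup_gens(1), of i] by (simp add: u_adj)
next
  case (7 i) then show ?case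
    using \<sigma>_mult[OF semigroup_gens(2,1), of i i] \<sigma>_adj[OF semigroup_gens(1), of i] by (simp add: u_adj)
next
  case (8 x)
  have "partial_isometry (\<sigma> (s i j n))" if "(i, j) \<in> Omega N A" for i j n
    using cov(3) semigroup_gens(3)[OF that] by blast
  then show ?case using 8 by auto
next
  case (9 x)
  have "\<sigma> (s i j n) o\<^sub>L \<sigma> (u j) = \<sigma> (s i j (n + int (A i j))) \<and> \<sigma> (u i) o\<^sub>L \<sigma> (s i j n) = \<sigma> (s i j (n + B i j))"
    if ij: "(i, j) \<in> Omega N A" for i j n
    using \<sigma>_mult[OF semigroup_gens(3)[OF ij] semigroup_gens(1), of j n]
      \<sigma>_mult[OF semigroup_gens(1) semigroup_gens(3)[OF ij], of i n] Omega_vertices[OF ij]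
    by (simp add: s_u u_s ij)
  then show ?case using 9 by auto
next
  case (10 x)
  have "adj (\<sigma> (s i j n)) o\<^sub>L \<sigma> (s i j n) = \<sigma> (q j)" if ij: "(i, j) \<in> Omega N A" for i j n
    using \<sigma>_mult[OF semigroup_gens(4)[OF ij] semigroup_gens(3)[OF ij], of n n] \<sigma>_adj[OF semigroup_gens(3)[OF ij], of n]
    by (simp add: s_adj ij)
  then show ?case using 10 by auto
next
  case (11 i)
  have e: "fpath (tgt e) [e]" if "e \<in> edges N A" for e using that edgesD(2) by simp
  have pe: "pp (tgt e) [e] = SE e o\<^sub>L adj (SE e)" if "e \<in> edges N A" for e
    by (cases e) (simp add: pp_def edge_op_def)
  \<comment> \<open>The sum in relation (iii) cannot be formed in the semigroup; it is carried over
    to indicators, where \<pi> is additive.\<close>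
  have "\<sigma> (q i) = \<pi> (ind (cyl i []))" using \<sigma>_pp[of i "[]"] 11 by (simp add: pp_def)
  also have "\<dots> = (\<Sum>e | e \<in> edges N A \<and> src e = i. \<pi> (ind (cyl (tgt e) [e])))" by (rule \<pi>_vertex[OF 11])
  also have "\<dots> = (\<Sum>e | e \<in> edges N A \<and> src e = i. \<sigma> (SE e) o\<^sub>L adj (\<sigma> (SE e)))"
  proof (rule sum.cong[OF refl])
    fix e assume "e \<in> {e \<in> edges N A. src e = i}"
    then have eE: "e \<in> edges N A" by simp
    show "\<pi> (ind (cyl (tgt e) [e])) = \<sigma> (SE e) o\<^sub>L adj (\<sigma> (SE e))"
      unfolding \<sigma>_pp[OF e[OF eE], symmetric] pe[OF eE]
      by (simp add: \<sigma>_mult \<sigma>_adj semigroup_adj semigroup_edge[OF eE])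
  qed
  also have "\<dots> = (\<Sum>j | (i, j) \<in> Omega N A. \<Sum>n\<in>{1..int (A i j)}. \<sigma> (s i j n) o\<^sub>L adj (\<sigma> (s i j n)))"
    unfolding edge_sum[OF 11, symmetric, of "\<lambda>e. \<sigma> (SE e) o\<^sub>L adj (\<sigma> (SE e))"] by (simp add: edge_op_def)
  finally show ?case .
qed

section \<open>The two homomorphisms between the Katsura algebra and the crossed product\<close>

abbreviation "CP \<equiv> crossed_product SG (o\<^sub>L) adj XT dom_of \<pi> \<sigma>"

definition CP_gens :: "('h \<Rightarrow>\<^sub>L 'h) set" where
  "CP_gens = {\<pi> f o\<^sub>L \<sigma> a |f a. a \<in> SG \<and> f \<in> C0 (subtopology XT (dom_of (a o\<^sub>L adj a)))}"

lemma CP_eq: "CP = closure (ops.span CP_gens)"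
  by (simp add: crossed_product_def CP_gens_def)

lemma CP_gensI:
  "a \<in> SG \<Longrightarrow> f \<in> C0 (subtopology XT (dom_of (a o\<^sub>L adj a))) \<Longrightarrow> \<pi> f o\<^sub>L \<sigma> a \<in> CP_gens"
  unfolding CP_gens_def by blast

lemma CP_gens_C0:
  assumes "a \<in> SG" "f \<in> C0 (subtopology XT (dom_of (a o\<^sub>L adj a)))"
  shows "f \<in> C0 XT"
proof -
  consider "a = 0" | I i t J where "form a I i t J" using semigroup_forms[OF assms(1)] by blast
  then show ?thesis
  proof cases
    case 1
    have "f \<in> C0 (subtopology XT {})" using assms(2) by (simp add: 1 dom_zero)
    then show ?thesis unfolding C0_empty using C0_zero by simp
  next
    case 2
    then show ?thesis using assms(2) C0_cyl[of i I] unfolding dom_compose(2)[OF 2] by (auto simp: has_form_def)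
  qed
qed

lemma isomorphic:
  assumes univ: "universal_covariant_rep SG (o\<^sub>L) adj XT dom_of act_of H \<pi> \<sigma>"
  shows "cstar_isomorphic KA CP"
proof -
  have closed_KA: "closed KA" using algebra_cstar by (simp add: cstar_algebra_def)
  have SGK: "a \<in> SG \<Longrightarrow> a \<in> KA" for a using semigroup_subset_algebra by blast
  obtain \<phi> where \<phi>: "star_hom KA (bounded_ops UNIV) \<phi>" "\<forall>i\<in>V. \<phi> (q i) = \<sigma> (q i) \<and> \<phi> (u i) = \<sigma> (u i)"
    "\<forall>(i, j)\<in>Omega N A. \<forall>n. \<phi> (s i j n) = \<sigma> (s i j n)"
    using ex_hom[OF covariant_family] by blast
  have \<phi>_mult: "\<phi> (a o\<^sub>L b) = \<phi> a o\<^sub>L \<phi> b" "\<phi> (a + b) = \<phi> a + \<phi> b"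
    "\<phi> (op_scale c a) = op_scale c (\<phi> a)" "\<phi> (adj a) = adj (\<phi> a)" "\<phi> a \<in> bounded_ops UNIV"
    if "a \<in> KA" "b \<in> KA" for a b c
    using \<phi>(1) that unfolding star_hom_def by auto
  have \<phi>\<sigma>: "\<phi> a = \<sigma> a" if "a \<in> SG" for a
  proof -
    \<comment> \<open>Membership is carried along, as multiplicativity of \<phi> and \<sigma> is
      known only for elements of the algebra and of the semigroup.\<close>
    have "a \<in> SG \<and> \<phi> a = \<sigma> a" using that unfolding katsura_semigroup_def
    proof (induction rule: semigroup_generated.induct)
      case (gen a)
      then have aS: "a \<in> SG" unfolding katsura_semigroup_def by (rule semigroup_generated.gen)
      have su: "\<phi> (s i j n) = \<sigma> (s i j n)" if "(i, j) \<in> Omega N A" for i j n using \<phi>(3) that by blast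
      have "\<phi> a = \<sigma> a" using gen
      proof (elim UnE CollectE exE conjE)
        fix i assume "a = u i" "i \<in> V" then show ?thesis using \<phi>(2) by simp
      next
        fix i assume "a = adj (u i)" "i \<in> V"
        then show ?thesis using \<phi>(2) \<phi>_mult(4)[OF algebra_gens(2) algebra_gens(2), of i i] \<sigma>_adj[OF semigroup_gens(1), of i] by simp
      next
        fix i j n assume "a = s i j n" "(i, j) \<in> Omega N A" then show ?thesis using su by simp
      next
        fix i j n assume a: "a = adj (s i j n)" and ij: "(i, j) \<in> Omega N A"
        show ?thesis using su[OF ij] \<phi>_mult(4)[OF algebra_gens(3)[OF ij] algebra_gens(3)[OF ij], of n]
            \<sigma>_adj[OF semigroup_gens(3)[OF ij], of n] a by simp
      qed
      then show ?case using aS unfolding katsura_semigroup_def by blast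
    next
      case (mult a b)
      then have S: "a \<in> SG" "b \<in> SG" unfolding katsura_semigroup_def by blast+
      show ?case
        using \<phi>_mult(1)[OF SGK[OF S(1)] SGK[OF S(2)]] \<sigma>_mult[OF S] mult.IH semigroup_mult[OF S]
        unfolding katsura_semigroup_def by simp
    qed
    then show ?thesis by blast
  qed
  have subCP: "ops.subspace CP" "closed CP"
    unfolding CP_eq by (auto intro: subspace_closure_op_scale)
  have \<sigma>_CP: "\<sigma> a \<in> CP" if aS: "a \<in> SG" for a
  proof -
    consider "a = 0" | I i t J where "form a I i t J" using semigroup_forms[OF aS] by blast
    then show ?thesis
    proof cases
      case 1
      then show ?thesis using aS \<sigma>_zero ops.subspace_0[OF subCP(1)] by simp
    next
      case 2
      have I: "fpath i I" using 2 by (simp add: has_form_def)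
      \<comment> \<open>Absorbing the range projection exhibits \<sigma> a as a generator of the
        crossed product, with an indicator as its function.\<close>
      have "\<sigma> a = \<sigma> (pp i I) o\<^sub>L \<sigma> a"
        using \<sigma>_mult[OF pp_semigroup[OF I] aS] form_compose_adj(2)[OF 2] by simp
      then have eq: "\<sigma> a = \<pi> (ind (cyl i I)) o\<^sub>L \<sigma> a" unfolding \<sigma>_pp[OF I] .
      have "\<sigma> a \<in> CP_gens"
        by (subst eq, rule CP_gensI[OF aS]) (simp add: dom_compose(2)[OF 2] ind_C0_cyl[OF I])
      then show ?thesis unfolding CP_eq using closure_subset ops.span_superset by blast
    qed
  qed
  have \<phi>_CP: "\<phi> x \<in> CP" if x: "x \<in> KA" for x
  proof -
    obtain f where f: "\<And>n. f n \<in> ops.span SG" "f \<longlonglongrightarrow> x"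
      using x unfolding algebra_eq_closure_span closure_sequential by blast
    have fK: "f n \<in> KA" for n
      using f(1) ops.span_minimal[OF semigroup_subset_algebra subspace_algebra] by blast
    have "\<phi> (f n) \<in> CP" for n
      by (rule star_hom_span[OF subspace_algebra \<phi>(1) semigroup_subset_algebra subCP(1) _ f(1)])
        (simp add: \<phi>\<sigma> \<sigma>_CP)
    then show ?thesis
      by (rule closed_sequentially[OF subCP(2) _ star_hom_tendsto[OF algebra_cstar \<phi>(1) order_refl fK x f(2)]])
  qed
  have hom_CP: "star_hom KA CP \<phi>" using \<phi>(1) \<phi>_CP unfolding star_hom_def by blast
  \<comment> \<open>Both maps are contractive and linear in \<open>f\<close>, and they agree on
    indicators by \<open>\<sigma>_pp\<close>.\<close>
  have \<phi>\<pi>: "\<phi> (fun_rep f) = \<pi> f" if f: "f \<in> C0 XT" for f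
  proof (rule contractive_linear_eqI[OF _ contractive_\<pi>])
    show "contractive_linear UNIV (\<lambda>f. \<phi> (fun_rep f))"
      unfolding contractive_linear_def
    proof (intro conjI ballI allI impI)
      fix f g assume f: "f \<in> C0_on UNIV"
      then have fK: "fun_rep f \<in> KA" using fun_rep_algebra by simp
      show "\<phi> (fun_rep (\<lambda>\<gamma>. f \<gamma> + g \<gamma>)) = \<phi> (fun_rep f) + \<phi> (fun_rep g)"
        if "g \<in> C0_on UNIV"
        using f that fun_rep_algebra by (simp add: fun_rep_add \<phi>_mult(2))
      show "\<phi> (fun_rep (\<lambda>\<gamma>. c * f \<gamma>)) = op_scale c (\<phi> (fun_rep f))" for c
        using f fK by (simp add: fun_rep_scale \<phi>_mult(3)[OF fK fK])
      fix M :: real assume "0 \<le> M" "\<forall>\<gamma>. cmod (f \<gamma>) \<le> M"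
      then show "norm (\<phi> (fun_rep f)) \<le> M"
        using star_hom_contractive[OF algebra_cstar \<phi>(1) order_refl fK] fun_rep_contractive[of f M] f by force
    qed
    fix K m n assume K: "K \<in> level_paths m n"
    note P = level_pathsD(3)[OF K]
    show "\<phi> (fun_rep (ind (lcyl K))) = \<pi> (ind (lcyl K))"
      unfolding fun_rep_ind[OF P] \<phi>\<sigma>[OF pp_semigroup[OF P]] by (rule \<sigma>_pp[OF P])
  qed (use f in auto)
  have gens_\<phi>: "CP_gens \<subseteq> \<phi> ` KA"
  proof
    fix y assume "y \<in> CP_gens"
    then obtain f a where y: "y = \<pi> f o\<^sub>L \<sigma> a" and a: "a \<in> SG"
      and f: "f \<in> C0 (subtopology XT (dom_of (a o\<^sub>L adj a)))" unfolding CP_gens_def by blast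
    have f': "f \<in> C0 XT" by (rule CP_gens_C0[OF a f])
    have "y = \<phi> (fun_rep f o\<^sub>L a)"
      unfolding y \<phi>_mult(1)[OF fun_rep_algebra[OF f'] SGK[OF a]] by (simp add: \<phi>\<sigma>[OF a] \<phi>\<pi>[OF f'])
    moreover have "fun_rep f o\<^sub>L a \<in> KA"
      using algebra_cstar fun_rep_algebra[OF f'] SGK[OF a] by (simp add: cstar_algebra_def)
    ultimately show "y \<in> \<phi> ` KA" by blast
  qed
  have sub_img: "ops.subspace (\<phi> ` KA)"
    unfolding subspace_op_scale_iff
  proof (intro conjI ballI allI)
    have z: "0 \<in> KA" by (rule ops.subspace_0[OF subspace_algebra])
    show "0 \<in> \<phi> ` KA" using \<phi>_mult(3)[OF z z, of 0] z by (metis imageI op_scale_zero(1))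
    show "S + T \<in> \<phi> ` KA" if S: "S \<in> \<phi> ` KA" and T: "T \<in> \<phi> ` KA" for S T
    proof -
      obtain x y where xy: "x \<in> KA" "y \<in> KA" "S = \<phi> x" "T = \<phi> y" using S T by blast
      have "S + T = \<phi> (x + y)" using \<phi>_mult(2)[OF xy(1,2)] xy(3,4) by simp
      then show ?thesis using ops.subspace_add[OF subspace_algebra xy(1,2)] by blast
    qed
    show "op_scale c T \<in> \<phi> ` KA" if T: "T \<in> \<phi> ` KA" for c T
    proof -
      obtain x where x: "x \<in> KA" "T = \<phi> x" using T by blast
      have "op_scale c T = \<phi> (op_scale c x)" using \<phi>_mult(3)[OF x(1,1)] x(2) by simp
      then show ?thesis using ops.subspace_scale[OF subspace_algebra x(1)] by blast
    qed
  qed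
  have span_img: "ops.span CP_gens \<subseteq> \<phi> ` KA" by (rule ops.span_minimal[OF gens_\<phi> sub_img])
  \<comment> \<open>This makes the crossed product a C*-algebra: the image of \<phi> is closed under
    products and adjoints, so its closure is too.\<close>
  have "CP = closure (\<phi> ` KA)"
  proof
    show "CP \<subseteq> closure (\<phi> ` KA)" unfolding CP_eq by (rule closure_mono[OF span_img])
    show "closure (\<phi> ` KA) \<subseteq> CP" by (rule closure_minimal[OF _ subCP(2)]) (use \<phi>_CP in blast)
  qed
  then have CP_cstar: "cstar_algebra CP"
  proof (simp only:, intro cstar_algebra_closure[OF sub_img])
    show "\<phi> ` KA \<subseteq> bounded_ops UNIV" using \<phi>_mult(5) by blast
    show "S o\<^sub>L T \<in> \<phi> ` KA" if S: "S \<in> \<phi> ` KA" and T: "T \<in> \<phi> ` KA" for S T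
    proof -
      obtain x y where xy: "x \<in> KA" "y \<in> KA" "S = \<phi> x" "T = \<phi> y" using S T by blast
      have "x o\<^sub>L y \<in> KA" using algebra_cstar xy by (simp add: cstar_algebra_def)
      then show ?thesis using \<phi>_mult(1)[OF xy(1,2)] xy by (metis imageI)
    qed
    show "adj S \<in> \<phi> ` KA" if S: "S \<in> \<phi> ` KA" for S
    proof -
      obtain x where x: "x \<in> KA" "S = \<phi> x" using S by blast
      have "adj x \<in> KA" using algebra_cstar x by (simp add: cstar_algebra_def)
      then show ?thesis using \<phi>_mult(4)[OF x(1,1)] x by (metis imageI)
    qed
  qed
  obtain \<psi> where \<psi>: "star_hom CP (bounded_ops H0) \<psi>"
    "\<forall>a\<in>SG. \<forall>f\<in>C0 (subtopology XT (dom_of (a o\<^sub>L adj a))). \<psi> (\<pi> f o\<^sub>L \<sigma> a) = fun_rep f o\<^sub>L a"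
    using univ fun_rep_covariant_rep unfolding universal_covariant_rep_def by blast
  have comp: "star_hom KA (bounded_ops H0) (\<lambda>x. \<psi> (\<phi> x))"
    using hom_CP \<psi>(1) unfolding star_hom_def by (auto simp: image_subset_iff)
  have inv_SG: "\<psi> (\<phi> a) = a" if aS: "a \<in> SG" for a
  proof -
    consider "a = 0" | I i t J where "form a I i t J" using semigroup_forms[OF aS] by blast
    then show ?thesis
    proof cases
      case 1
      have "\<psi> (op_scale 0 0) = op_scale 0 (\<psi> 0)"
        using \<psi>(1) ops.subspace_0[OF subCP(1)] unfolding star_hom_def by blast
      then show ?thesis using 1 \<phi>\<sigma>[OF aS] \<sigma>_zero aS by simp
    next
      case 2
      have I: "fpath i I" using 2 by (simp add: has_form_def)
      have "\<sigma> a = \<sigma> (pp i I) o\<^sub>L \<sigma> a"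
        using \<sigma>_mult[OF pp_semigroup[OF I] aS] form_compose_adj(2)[OF 2] by simp
      then have "\<psi> (\<phi> a) = \<psi> (\<pi> (ind (cyl i I)) o\<^sub>L \<sigma> a)" unfolding \<phi>\<sigma>[OF aS] \<sigma>_pp[OF I] by simp
      also have "\<dots> = fun_rep (ind (cyl i I)) o\<^sub>L a"
        using \<psi>(2) aS ind_C0_cyl[OF I] dom_compose(2)[OF 2] by simp
      also have "\<dots> = a" by (simp add: fun_rep_ind[OF I] form_compose_adj(2)[OF 2])
      finally show ?thesis .
    qed
  qed
  have inv: "\<psi> (\<phi> x) = x" if x: "x \<in> KA" for x
  proof -
    obtain f where f: "\<And>n. f n \<in> ops.span SG" "f \<longlonglongrightarrow> x"
      using x unfolding algebra_eq_closure_span closure_sequential by blast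
    have fK: "f n \<in> KA" for n
      using f(1) ops.span_minimal[OF semigroup_subset_algebra subspace_algebra] by blast
    have lin: "\<psi> (\<phi> (op_scale c a + b)) = op_scale c (\<psi> (\<phi> a)) + \<psi> (\<phi> b)" if "a \<in> KA" "b \<in> KA" for a b c
      using comp that ops.subspace_scale[OF subspace_algebra that(1)] unfolding star_hom_def by metis
    have "y \<in> KA \<and> \<psi> (\<phi> y) = y" if "y \<in> ops.span SG" for y
      using that
    proof (induction rule: ops.span_induct_alt)
      case base
      have z: "0 \<in> KA" by (rule ops.subspace_0[OF subspace_algebra])
      then have "\<psi> (\<phi> (op_scale 0 0)) = op_scale 0 (\<psi> (\<phi> 0))" using comp unfolding star_hom_def by blast
      then show ?case using z by simp
    next
      case (step c a b)
      then show ?case using lin[of a b c] inv_SG[of a] SGK[of a] subspace_algebra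
        by (simp add: ops.subspace_add ops.subspace_scale)
    qed
    then have "\<psi> (\<phi> (f n)) = f n" for n using f(1) by blast
    then have "f \<longlonglongrightarrow> \<psi> (\<phi> x)"
      using star_hom_tendsto[OF algebra_cstar comp bounded_ops_subset_UNIV fK x f(2)] by simp
    then show ?thesis using f(2) LIMSEQ_unique by blast
  qed
  have surj: "\<exists>x\<in>KA. \<phi> x = y" if y: "y \<in> CP" for y
  proof -
    obtain g where g: "\<And>n. g n \<in> ops.span CP_gens" "g \<longlonglongrightarrow> y"
      using y unfolding CP_eq closure_sequential by blast
    have "\<exists>x\<in>KA. g n = \<phi> x" for n using g(1) span_img by blast
    then obtain f where f: "\<And>n. f n \<in> KA" "\<And>n. g n = \<phi> (f n)" by metis
    have gCP: "g n \<in> CP" for n using f \<phi>_CP by simp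
    \<comment> \<open>The range of \<phi> is dense. Continuity of \<psi>, which recovers the
      preimages of the approximants, makes these preimages converge, and their limit is a preimage
      of \<open>y\<close>.\<close>
    have "(\<lambda>n. \<psi> (g n)) \<longlonglongrightarrow> \<psi> y"
      by (rule star_hom_tendsto[OF CP_cstar \<psi>(1) bounded_ops_subset_UNIV gCP y g(2)])
    then have lim: "f \<longlonglongrightarrow> \<psi> y" using f inv by simp
    have yK: "\<psi> y \<in> KA" by (rule closed_sequentially[OF closed_KA f(1) lim])
    have "(\<lambda>n. \<phi> (f n)) \<longlonglongrightarrow> \<phi> (\<psi> y)"
      by (rule star_hom_tendsto[OF algebra_cstar \<phi>(1) order_refl f(1) yK lim])
    then have "g \<longlonglongrightarrow> \<phi> (\<psi> y)" by (simp only: f(2)[symmetric])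
    then show ?thesis using g(2) LIMSEQ_unique yK by blast
  qed
  have "inj_on \<phi> KA" by (rule inj_on_inverseI[where g = \<psi>]) (rule inv)
  moreover have "\<phi> ` KA = CP" using \<phi>_CP surj by blast
  ultimately show ?thesis
    using hom_CP unfolding cstar_isomorphic_def bij_betw_def by blast
qed

end

theorem corollary5p18:
  fixes N :: enat
    and A :: "nat \<Rightarrow> nat \<Rightarrow> nat"
    and B :: "nat \<Rightarrow> nat \<Rightarrow> int"
    and q u :: "nat \<Rightarrow> ('h::chilbert_space \<Rightarrow>\<^sub>L 'h)"
    and s :: "nat \<Rightarrow> nat \<Rightarrow> int \<Rightarrow> ('h \<Rightarrow>\<^sub>L 'h)"
    and H :: "'h set"
    and \<pi> :: "((nat \<Rightarrow> edge) \<Rightarrow> complex) \<Rightarrow> ('h \<Rightarrow>\<^sub>L 'h)"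
    and \<sigma> :: "('h \<Rightarrow>\<^sub>L 'h) \<Rightarrow> ('h \<Rightarrow>\<^sub>L 'h)"
  assumes "infinite_dimensional TYPE('h)"
    and "katsura_matrices N A B"
    and "universal_katsura_family N A B q u s"
    and "universal_covariant_rep (katsura_semigroup N A u s) (o\<^sub>L) adj (path_space N A)
           (katsura_dom N A q u s) (katsura_act N A B q u s) H \<pi> \<sigma>"
  shows "cstar_isomorphic (katsura_algebra N A q u s)
           (crossed_product (katsura_semigroup N A u s) (o\<^sub>L) adj (path_space N A)
             (katsura_dom N A q u s) \<pi> \<sigma>)"
proof -
  have fam: "katsura_family N A B q u s" using assms(3) by (simp add: universal_katsura_family_def)
  have cov: "covariant_rep (katsura_semigroup N A u s) (o\<^sub>L) adj (path_space N A)
      (katsura_dom N A q u s) (katsura_act N A B q u s) H \<pi> \<sigma>"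
    using assms(4) by (simp add: universal_covariant_rep_def)
  interpret katsura_covariant N A B q u s H \<pi> \<sigma>
    by unfold_locales (fact assms(2) fam assms(3) assms(1) cov)+
  show ?thesis by (rule isomorphic[OF assms(4)])
qed

end
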